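(* Let $H$ be a quasi-Hopf algebra over a field $k$, let $(B,\rho,\Phi_\rho)$ be a right $H$-comodule algebra, with $\rho(b)=b_{(0)}\otimes b_{(1)}$, and suppose that there exists a morphism $v:H\to B$ of right $H$-comodule algebras (where $H$ is a right $H$-comodule algebra via $\rho=\Delta$, $\Phi_\rho=\Phi$). Then there exists a left $H$-module algebra $A$ such that $B\simeq A\# H$ as right $H$-comodule algebras. Explicitly, one may take $A$ as follows: define $E:B\to B$ by $E(b)=v(q^1)\,b_{(0)}\,v(\beta S(q^2b_{(1)}))$, where $q^1\otimes q^2=X^1\otimes S^{-1}(\alpha X^3)X^2$; as a vector space $A=E(B)\subseteq B$, with multiplication $a*a'=E(aa')$, unit $1_B$, and left $H$-action $h\triangleright a=E(v(h)a)$, for $a,a'\in A$, $h\in H$.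
   Context: Everything is over a field $k$; $\otimes=\otimes_k$. Quasi-bialgebra: $(H,\Delta,\varepsilon,\Phi)$ with $H$ an associative unital algebra, $\Phi\in H\otimes H\otimes H$ invertible, $\Delta:H\to H\otimes H$ and $\varepsilon:H\to k$ algebra homomorphisms such that for all $h\in H$: $(id\otimes\Delta)(\Delta(h))=\Phi(\Delta\otimes id)(\Delta(h))\Phi^{-1}$; $(id\otimes\varepsilon)(\Delta(h))=h$ and $(\varepsilon\otimes id)(\Delta(h))=h$ (identifying $H\otimes k=k\otimes H=H$); $(1\otimes\Phi)(id\otimes\Delta\otimes id)(\Phi)(\Phi\otimes1)=(id\otimes id\otimes\Delta)(\Phi)(\Delta\otimes id\otimes id)(\Phi)$; $(id\otimes\varepsilon\otimes id)(\Phi)=1\otimes1\otimes 1$ (identified with $1\otimes 1$). Notation (summation understood): $\Delta(h)=h_1\otimes h_2$, $\Phi=X^1\otimes X^2\otimes X^3$, $\Phi^{-1}=x^1\otimes x^2\otimes x^3$. Quasi-Hopf algebra: a quasi-bialgebra $H$ with an anti-automorphism $S$ of the algebra $H$ (in particular $S$ is bijective) and elements $\alpha,\beta\in H$ such that for all $h$: $S(h_1)\alpha h_2=\varepsilon(h)\alpha$, $h_1\beta S(h_2)=\varepsilon(h)\beta$, $X^1\beta S(X^2)\alpha X^3=1$, $S(x^1)\alpha x^2\beta S(x^3)=1$. Right $H$-comodule algebra $(B,\rho,\Phi_\rho)$: a unital associative algebra $B$ with an algebra morphism $\rho:B\to B\otimes H$ and an invertible element $\Phi_\rho\in B\otimes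 H\otimes H$ such that $\Phi_\rho(\rho\otimes id)(\rho(b))=(id\otimes\Delta)(\rho(b))\Phi_\rho$ for all $b\in B$; $(1_B\otimes\Phi)(id\otimes\Delta\otimes id)(\Phi_\rho)(\Phi_\rho\otimes1_H)=(id\otimes id\otimes\Delta)(\Phi_\rho)(\rho\otimes id\otimes id)(\Phi_\rho)$; $(id\otimes\varepsilon)\circ\rho=id$; $(id\otimes\varepsilon\otimes id)(\Phi_\rho)=(id\otimes id\otimes\varepsilon)(\Phi_\rho)=1_B\otimes1_H$. A morphism $f:(B,\rho,\Phi_\rho)\to(B',\rho',\Phi_{\rho'})$ of right $H$-comodule algebras is a (unital) algebra map with $\rho'\circ f=(f\otimes id)\circ\rho$ and $\Phi_{\rho'}=(f\otimes id\otimes id)(\Phi_\rho)$. Left $H$-module algebra: a left $H$-module $A$ (action $h\cdot a$) with a bilinear multiplication and a two-sided unit $1_A$ such that $(aa')a''=(X^1\cdot a)[(X^2\cdot a')(X^3\cdot a'')]$, $h\cdot(aa')=(h_1\cdot a)(h_2\cdot a')$, $h\cdot1_A=\varepsilon(h)1_A$ for all $a,a',a''\in A$, $h\in H$. Smash product $A\#H$: the vector space $A\otimes H$ (elements written $a\#h$) with multiplication $(a\#h)(a'\#h')=(x^1\cdot a)(x^2h_1\cdot a')\#x^3h_2h'$; it is an associative algebra with unit $1_A\#1$, and a right $H$-comodule algebra with $\rho(a\#h)=(x^1\cdot a\#x^2h_1)\otimes x^3h_2$ and $\Phi_\rho=(1_A\#X^1)\otimes X^2\otimes X^3$. *)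

theory Defs
  imports "HOL-Algebra.Module"
begin

section \<open>Vector spaces and algebras\<close>

text \<open>
  Vector spaces are modules (in the sense of \<^theory>\<open>HOL-Algebra.Module\<close>) over a field; the ring
  operations of the record are ignored unless an algebra is meant. The locale
  \<^locale>\<open>algebra\<close> of the library is restricted to commutative algebras.
\<close>

locale k_algebra = K?: field K + module K A + ring A for K (structure) and A (structure) +
  assumes smult_mult_left:
      "\<lbrakk>c \<in> carrier K; x \<in> carrier A; y \<in> carrier A\<rbrakk>
        \<Longrightarrow> (c \<odot>\<^bsub>A\<^esub> x) \<otimes>\<^bsub>A\<^esub> y = c \<odot>\<^bsub>A\<^esub> (x \<otimes>\<^bsub>A\<^esub> y)"
    and smult_mult_right:
      "\<lbrakk>c \<in> carrier K; x \<in> carrier A; y \<in> carrier A\<rbrakk>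
        \<Longrightarrow> x \<otimes>\<^bsub>A\<^esub> (c \<odot>\<^bsub>A\<^esub> y) = c \<odot>\<^bsub>A\<^esub> (x \<otimes>\<^bsub>A\<^esub> y)"

definition linear_maps ::
  "('k, 'r) ring_scheme \<Rightarrow> ('k, 'a, 'm) module_scheme \<Rightarrow> ('k, 'b, 'n) module_scheme \<Rightarrow> ('a \<Rightarrow> 'b) set"
  where "linear_maps K M N =
    {f \<in> carrier M \<rightarrow> carrier N.
      (\<forall>x\<in>carrier M. \<forall>y\<in>carrier M. f (x \<oplus>\<^bsub>M\<^esub> y) = f x \<oplus>\<^bsub>N\<^esub> f y) \<and>
      (\<forall>c\<in>carrier K. \<forall>x\<in>carrier M. f (c \<odot>\<^bsub>M\<^esub> x) = c \<odot>\<^bsub>N\<^esub> f x)}"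

definition algebra_hom ::
  "('k, 'r) ring_scheme \<Rightarrow> ('k, 'a, 'm) module_scheme \<Rightarrow> ('k, 'b, 'n) module_scheme \<Rightarrow> ('a \<Rightarrow> 'b) set"
  where "algebra_hom K A B = ring_hom A B \<inter> linear_maps K A B"

definition bilinear_map ::
  "('k, 'r) ring_scheme \<Rightarrow> ('k, 'a, 'm) module_scheme \<Rightarrow> ('k, 'b, 'n) module_scheme \<Rightarrow>
    ('k, 'c, 'p) module_scheme \<Rightarrow> ('a \<Rightarrow> 'b \<Rightarrow> 'c) \<Rightarrow> bool"
  where "bilinear_map K M N P f \<longleftrightarrow>
    (\<forall>x\<in>carrier M. f x \<in> linear_maps K N P) \<and>
    (\<forall>y\<in>carrier N. (\<lambda>x. f x y) \<in> linear_maps K M P)"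


section \<open>Tensor products\<close>

text \<open>
  An element of the tensor product of \<open>M\<close> and \<open>N\<close> is a formal finite sum
  \<open>a\<^sub>1 \<otimes> b\<^sub>1 + \<dots> + a\<^sub>n \<otimes> b\<^sub>n\<close>, given by the list of the pairs \<open>(a\<^sub>i, b\<^sub>i)\<close>, modulo the smallest
  congruence (for concatenation) that makes the formal sum commutative and \<open>\<otimes>\<close> bilinear.
  Scalars need no coefficients of their own since \<open>c (a \<otimes> b) = (c a) \<otimes> b\<close>; the rule for
  \<open>0 \<otimes> b\<close> identifies it with the empty sum.
\<close>

inductive_set tensor_rel ::
  "('k, 'r) ring_scheme \<Rightarrow> ('k, 'a, 'm) module_scheme \<Rightarrow> ('k, 'b, 'n) module_scheme \<Rightarrow>
    (('a \<times> 'b) list \<times> ('a \<times> 'b) list) set"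
  for K M N where
  refl: "l \<in> lists (carrier M \<times> carrier N) \<Longrightarrow> (l, l) \<in> tensor_rel K M N"
| sym: "(l, l') \<in> tensor_rel K M N \<Longrightarrow> (l', l) \<in> tensor_rel K M N"
| trans: "\<lbrakk>(l, l') \<in> tensor_rel K M N; (l', l'') \<in> tensor_rel K M N\<rbrakk>
    \<Longrightarrow> (l, l'') \<in> tensor_rel K M N"
| append: "\<lbrakk>(l\<^sub>1, l\<^sub>1') \<in> tensor_rel K M N; (l\<^sub>2, l\<^sub>2') \<in> tensor_rel K M N\<rbrakk>
    \<Longrightarrow> (l\<^sub>1 @ l\<^sub>2, l\<^sub>1' @ l\<^sub>2') \<in> tensor_rel K M N"
| commute: "\<lbrakk>l \<in> lists (carrier M \<times> carrier N); l' \<in> lists (carrier M \<times> carrier N)\<rbrakk>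
    \<Longrightarrow> (l @ l', l' @ l) \<in> tensor_rel K M N"
| zero_left: "b \<in> carrier N \<Longrightarrow> ([(\<zero>\<^bsub>M\<^esub>, b)], []) \<in> tensor_rel K M N"
| add_left: "\<lbrakk>a \<in> carrier M; a' \<in> carrier M; b \<in> carrier N\<rbrakk>
    \<Longrightarrow> ([(a \<oplus>\<^bsub>M\<^esub> a', b)], [(a, b), (a', b)]) \<in> tensor_rel K M N"
| add_right: "\<lbrakk>a \<in> carrier M; b \<in> carrier N; b' \<in> carrier N\<rbrakk>
    \<Longrightarrow> ([(a, b \<oplus>\<^bsub>N\<^esub> b')], [(a, b), (a, b')]) \<in> tensor_rel K M N"
| smult: "\<lbrakk>c \<in> carrier K; a \<in> carrier M; b \<in> carrier N\<rbrakk>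
    \<Longrightarrow> ([(c \<odot>\<^bsub>M\<^esub> a, b)], [(a, c \<odot>\<^bsub>N\<^esub> b)]) \<in> tensor_rel K M N"

type_synonym ('a, 'b) tensor = "('a \<times> 'b) list set"
type_synonym ('a, 'b, 'c) tensor3 = "('a, ('b, 'c) tensor) tensor"

definition tensor_class ::
  "('k, 'r) ring_scheme \<Rightarrow> ('k, 'a, 'm) module_scheme \<Rightarrow> ('k, 'b, 'n) module_scheme \<Rightarrow>
    ('a \<times> 'b) list \<Rightarrow> ('a, 'b) tensor"
  where "tensor_class K M N l = tensor_rel K M N `` {l}"

abbreviation tensor_rep :: "('a, 'b) tensor \<Rightarrow> ('a \<times> 'b) list"
  where "tensor_rep t \<equiv> (SOME l. l \<in> t)"

definition pure_tensor ::
  "('k, 'r) ring_scheme \<Rightarrow> ('k, 'a, 'm) module_scheme \<Rightarrow> ('k, 'b, 'n) module_scheme \<Rightarrow>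
    'a \<Rightarrow> 'b \<Rightarrow> ('a, 'b) tensor"
  where "pure_tensor K M N a b = tensor_class K M N [(a, b)]"

text \<open>The tensor product of two algebras; as a vector space it only depends on the vector space
  structures of \<open>M\<close> and \<open>N\<close>.\<close>

definition tensor_product ::
  "('k, 'r) ring_scheme \<Rightarrow> ('k, 'a, 'm) module_scheme \<Rightarrow> ('k, 'b, 'n) module_scheme \<Rightarrow>
    ('k, ('a, 'b) tensor) module"
  where "tensor_product K M N =
    \<lparr>carrier = lists (carrier M \<times> carrier N) // tensor_rel K M N,
     mult = (\<lambda>s t. tensor_class K M N
       [(a \<otimes>\<^bsub>M\<^esub> a', b \<otimes>\<^bsub>N\<^esub> b'). (a, b) \<leftarrow> tensor_rep s, (a', b') \<leftarrow> tensor_rep t]),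
     one = pure_tensor K M N \<one>\<^bsub>M\<^esub> \<one>\<^bsub>N\<^esub>,
     zero = tensor_class K M N [],
     add = (\<lambda>s t. tensor_class K M N (tensor_rep s @ tensor_rep t)),
     smult = (\<lambda>c t. tensor_class K M N [(c \<odot>\<^bsub>M\<^esub> a, b). (a, b) \<leftarrow> tensor_rep t])\<rparr>"

text \<open>Iterated tensor products are bracketed to the right.\<close>

abbreviation "tensor_product3 K M N P \<equiv> tensor_product K M (tensor_product K N P)"

abbreviation "tensor_product4 K M N P Q \<equiv> tensor_product K M (tensor_product3 K N P Q)"

text \<open>
  \<open>tensor_lift P f\<close> is the linear map into \<open>P\<close> induced by a bilinear map \<open>f\<close>, i.e. it sends
  \<open>\<Sum>i. a\<^sub>i \<otimes> b\<^sub>i\<close> to \<open>\<Sum>i. f a\<^sub>i b\<^sub>i\<close>. Thus \<open>tensor_lift P (\<lambda>h\<^sub>1 h\<^sub>2. \<dots>) (\<Delta> h)\<close> is what is written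
  with \<open>\<Delta> h = h\<^sub>1 \<otimes> h\<^sub>2\<close> in Sweedler notation. Independence of the representative is the lemma
  \<open>tensor_lift_class\<close> below.
\<close>

definition list_sum :: "('c, 'p) ring_scheme \<Rightarrow> ('a \<Rightarrow> 'b \<Rightarrow> 'c) \<Rightarrow> ('a \<times> 'b) list \<Rightarrow> 'c"
  where "list_sum P f l = foldr (\<lambda>(a, b) s. f a b \<oplus>\<^bsub>P\<^esub> s) l \<zero>\<^bsub>P\<^esub>"

definition tensor_lift :: "('c, 'p) ring_scheme \<Rightarrow> ('a \<Rightarrow> 'b \<Rightarrow> 'c) \<Rightarrow> ('a, 'b) tensor \<Rightarrow> 'c"
  where "tensor_lift P f t = list_sum P f (tensor_rep t)"

definition tensor_lift3 ::
  "('d, 'p) ring_scheme \<Rightarrow> ('a \<Rightarrow> 'b \<Rightarrow> 'c \<Rightarrow> 'd) \<Rightarrow> ('a, 'b, 'c) tensor3 \<Rightarrow> 'd"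
  where "tensor_lift3 P f t = tensor_lift P (\<lambda>a. tensor_lift P (f a)) t"

text \<open>The map \<open>f \<otimes> g\<close>, with values in the tensor product of \<open>M\<close> and \<open>N\<close>.\<close>

definition tensor_map ::
  "('k, 'r) ring_scheme \<Rightarrow> ('k, 'c, 'm) module_scheme \<Rightarrow> ('k, 'd, 'n) module_scheme \<Rightarrow>
    ('a \<Rightarrow> 'c) \<Rightarrow> ('b \<Rightarrow> 'd) \<Rightarrow> ('a, 'b) tensor \<Rightarrow> ('c, 'd) tensor"
  where "tensor_map K M N f g =
    tensor_lift (tensor_product K M N) (\<lambda>a b. pure_tensor K M N (f a) (g b))"

text \<open>The identification of \<open>(M \<otimes> N) \<otimes> P\<close> with \<open>M \<otimes> (N \<otimes> P)\<close>.\<close>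

definition tensor_assoc ::
  "('k, 'r) ring_scheme \<Rightarrow> ('k, 'a, 'm) module_scheme \<Rightarrow> ('k, 'b, 'n) module_scheme \<Rightarrow>
    ('k, 'c, 'p) module_scheme \<Rightarrow> (('a, 'b) tensor, 'c) tensor \<Rightarrow> ('a, 'b, 'c) tensor3"
  where "tensor_assoc K M N P =
    (let NP = tensor_product K N P; MNP = tensor_product K M NP in
      tensor_lift MNP (\<lambda>s c. tensor_lift MNP
        (\<lambda>a b. pure_tensor K M NP a (pure_tensor K N P b c)) s))"

lemma tensor_rel_subset:
  assumes "module K M" "module K N"
  shows "tensor_rel K M N \<subseteq> lists (carrier M \<times> carrier N) \<times> lists (carrier M \<times> carrier N)"
proof -
  interpret M: module K M by fact
  interpret N: module K N by fact
  have "l \<in> lists (carrier M \<times> carrier N) \<and> l' \<in> lists (carrier M \<times> carrier N)"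
    if "(l, l') \<in> tensor_rel K M N" for l l'
    using that by induction auto
  then show ?thesis by (intro subrelI SigmaI) blast+
qed

lemma equiv_tensor_rel:
  assumes "module K M" "module K N"
  shows "equiv (lists (carrier M \<times> carrier N)) (tensor_rel K M N)"
  using tensor_rel_subset[OF assms]
  by (intro equivI refl_onI symI transI)
    (auto intro: tensor_rel.refl tensor_rel.sym tensor_rel.trans)

lemma list_sum_closed:
  assumes "abelian_monoid P" and "\<And>a b. (a, b) \<in> set l \<Longrightarrow> f a b \<in> carrier P"
  shows "list_sum P f l \<in> carrier P"
proof -
  interpret P: abelian_monoid P by fact
  show ?thesis using assms(2) by (induction l) (auto simp: list_sum_def)
qed

lemma list_sum_append:
  assumes "abelian_monoid P" and "\<And>a b. (a, b) \<in> set (l @ l') \<Longrightarrow> f a b \<in> carrier P"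
  shows "list_sum P f (l @ l') = list_sum P f l \<oplus>\<^bsub>P\<^esub> list_sum P f l'"
proof -
  interpret P: abelian_monoid P by fact
  show ?thesis using assms(2)
  proof (induction l)
    case Nil
    then show ?case using list_sum_closed[OF assms(1), of l' f] by (simp add: list_sum_def)
  next
    case (Cons p l)
    obtain a b where p: "p = (a, b)" by fastforce
    have "f a b \<in> carrier P" "list_sum P f l \<in> carrier P" "list_sum P f l' \<in> carrier P"
      using Cons.prems p by (auto intro!: list_sum_closed[OF assms(1)])
    then show ?case using Cons p by (simp add: list_sum_def P.a_assoc)
  qed
qed

lemma list_sum_tensor_rel:
  assumes "module K M" "module K N" "module K P" "bilinear_map K M N P f"
    and "(l, l') \<in> tensor_rel K M N"
  shows "list_sum P f l = list_sum P f l'"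
proof -
  interpret M: module K M by fact
  interpret N: module K N by fact
  interpret P: module K P by fact
  have P: "abelian_monoid P" by unfold_locales
  have f: "f a b \<in> carrier P" if "a \<in> carrier M" "b \<in> carrier N" for a b
    using assms(4) that by (auto simp: bilinear_map_def linear_maps_def)
  have app: "list_sum P f (k @ k') = list_sum P f k \<oplus>\<^bsub>P\<^esub> list_sum P f k'"
    "list_sum P f k \<in> carrier P" "list_sum P f k' \<in> carrier P"
    if "k \<in> lists (carrier M \<times> carrier N)" "k' \<in> lists (carrier M \<times> carrier N)" for k k'
  proof -
    have "f a b \<in> carrier P" if "(a, b) \<in> set (k @ k')" for a b
      using that \<open>k \<in> _\<close> \<open>k' \<in> _\<close> f by fastforce
    then show "list_sum P f (k @ k') = list_sum P f k \<oplus>\<^bsub>P\<^esub> list_sum P f k'"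
      "list_sum P f k \<in> carrier P" "list_sum P f k' \<in> carrier P"
      by (auto intro!: list_sum_append[OF P] list_sum_closed[OF P])
  qed
  note sub = tensor_rel_subset[OF assms(1,2)]
  show ?thesis
    using assms(5)
  proof induction
    case (append l1 l1' l2 l2')
    then show ?case
      using subsetD[OF sub append.hyps(1)] subsetD[OF sub append.hyps(2)] by (simp add: app(1))
  next
    case (commute k k')
    then show ?case
      using app[of k k'] app[of k' k] by (simp add: P.a_comm)
  next
    case (zero_left b)
    have "f \<zero>\<^bsub>M\<^esub> b = f (\<zero>\<^bsub>K\<^esub> \<odot>\<^bsub>M\<^esub> \<zero>\<^bsub>M\<^esub>) b" by simp
    also have "\<dots> = \<zero>\<^bsub>K\<^esub> \<odot>\<^bsub>P\<^esub> f \<zero>\<^bsub>M\<^esub> b"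
      using zero_left assms(4) unfolding bilinear_map_def linear_maps_def by blast
    finally show ?case using zero_left f by (simp add: list_sum_def)
  next
    case (add_left a a' b)
    then have "f (a \<oplus>\<^bsub>M\<^esub> a') b = f a b \<oplus>\<^bsub>P\<^esub> f a' b"
      using assms(4) unfolding bilinear_map_def linear_maps_def by blast
    then show ?case using add_left f by (simp add: list_sum_def)
  next
    case (add_right a b b')
    then have "f a (b \<oplus>\<^bsub>N\<^esub> b') = f a b \<oplus>\<^bsub>P\<^esub> f a b'"
      using assms(4) unfolding bilinear_map_def linear_maps_def by blast
    then show ?case using add_right f by (simp add: list_sum_def)
  next
    case (smult c a b)
    then have "f (c \<odot>\<^bsub>M\<^esub> a) b = c \<odot>\<^bsub>P\<^esub> f a b" "f a (c \<odot>\<^bsub>N\<^esub> b) = c \<odot>\<^bsub>P\<^esub> f a b"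
      using assms(4) unfolding bilinear_map_def linear_maps_def by blast+
    then show ?case by (simp add: list_sum_def)
  qed auto
qed

lemma tensor_lift_class:
  assumes "module K M" "module K N" "module K P" "bilinear_map K M N P f"
    and "l \<in> lists (carrier M \<times> carrier N)"
  shows "tensor_lift P f (tensor_class K M N l) = list_sum P f l"
proof -
  have "l \<in> tensor_class K M N l"
    using assms(5) by (auto simp: tensor_class_def intro: tensor_rel.refl)
  then have "tensor_rep (tensor_class K M N l) \<in> tensor_class K M N l"
    by (rule someI)
  then have "(l, tensor_rep (tensor_class K M N l)) \<in> tensor_rel K M N"
    by (simp add: tensor_class_def)
  from list_sum_tensor_rel[OF assms(1-4) this] show ?thesis
    by (simp add: tensor_lift_def)
qed


section \<open>Quasi-Hopf algebras\<close>

text \<open>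
  The following maps between the tensor powers \<open>M \<otimes> H \<otimes> \<dots> \<otimes> H\<close> are used with \<open>M = H\<close> and \<open>\<rho> = \<Delta>\<close>
  for quasi-bialgebras, and for comodule algebras \<open>M\<close> with coaction \<open>\<rho>\<close>. They are, in this order,
  \<open>\<rho> \<otimes> id\<close>, \<open>id \<otimes> \<Delta>\<close>, \<open>\<rho> \<otimes> id \<otimes> id\<close>, \<open>id \<otimes> \<Delta> \<otimes> id\<close>, \<open>id \<otimes> id \<otimes> \<Delta>\<close> and \<open>t \<mapsto> t \<otimes> 1\<close>, each followed by
  the rebracketing to the right.
\<close>

definition "coact_id K M H \<rho> =
  tensor_assoc K M H H \<circ> tensor_map K (tensor_product K M H) H \<rho> (\<lambda>x. x)"

definition "id_comult K M H \<Delta> = tensor_map K M (tensor_product K H H) (\<lambda>x. x) \<Delta>"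

definition "coact_id_id K M H \<rho> =
  tensor_assoc K M H (tensor_product K H H) \<circ>
  tensor_map K (tensor_product K M H) (tensor_product K H H) \<rho> (\<lambda>x. x)"

definition "id_comult_id K M H \<Delta> =
  tensor_map K M (tensor_product3 K H H H) (\<lambda>x. x) (coact_id K H H \<Delta>)"

definition "id_id_comult K M H \<Delta> =
  tensor_map K M (tensor_product3 K H H H) (\<lambda>x. x) (id_comult K H H \<Delta>)"

definition "tensor_one K M H =
  tensor_map K M (tensor_product3 K H H H) (\<lambda>x. x)
    (tensor_map K H (tensor_product K H H) (\<lambda>x. x) (\<lambda>h. pure_tensor K H H h \<one>\<^bsub>H\<^esub>))"

text \<open>The maps \<open>id \<otimes> \<epsilon>\<close> and \<open>\<epsilon> \<otimes> id\<close>, composed with the identifications of \<open>M \<otimes> k\<close> and \<open>k \<otimes> M\<close>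
  with \<open>M\<close>.\<close>

definition counit_right ::
  "('k, 'a, 'm) module_scheme \<Rightarrow> ('h \<Rightarrow> 'k) \<Rightarrow> ('a, 'h) tensor \<Rightarrow> 'a"
  where "counit_right M \<epsilon> = tensor_lift M (\<lambda>a h. \<epsilon> h \<odot>\<^bsub>M\<^esub> a)"

definition counit_left ::
  "('k, 'a, 'm) module_scheme \<Rightarrow> ('h \<Rightarrow> 'k) \<Rightarrow> ('h, 'a) tensor \<Rightarrow> 'a"
  where "counit_left M \<epsilon> = tensor_lift M (\<lambda>h a. \<epsilon> h \<odot>\<^bsub>M\<^esub> a)"

locale quasi_bialgebra = k_algebra K H
  for K :: "'k ring" (structure) and H :: "('k, 'h) module" (structure) +
  fixes \<Delta> :: "'h \<Rightarrow> ('h, 'h) tensor"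
    and \<epsilon> :: "'h \<Rightarrow> 'k"
    and \<Phi> :: "('h, 'h, 'h) tensor3"
  assumes comult_hom: "\<Delta> \<in> algebra_hom K H (tensor_product K H H)"
    and counit_hom: "\<epsilon> \<in> ring_hom H K"
    and counit_smult: "\<lbrakk>c \<in> carrier K; h \<in> carrier H\<rbrakk> \<Longrightarrow> \<epsilon> (c \<odot>\<^bsub>H\<^esub> h) = c \<otimes>\<^bsub>K\<^esub> \<epsilon> h"
    and reassociator_unit: "\<Phi> \<in> Units (tensor_product3 K H H H)"
    and quasi_coassoc: "h \<in> carrier H \<Longrightarrow>
      id_comult K H H \<Delta> (\<Delta> h) =
      \<Phi> \<otimes>\<^bsub>tensor_product3 K H H H\<^esub> coact_id K H H \<Delta> (\<Delta> h)
        \<otimes>\<^bsub>tensor_product3 K H H H\<^esub> inv\<^bsub>tensor_product3 K H H H\<^esub> \<Phi>"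
    and counit_right: "h \<in> carrier H \<Longrightarrow> counit_right H \<epsilon> (\<Delta> h) = h"
    and counit_left: "h \<in> carrier H \<Longrightarrow> counit_left H \<epsilon> (\<Delta> h) = h"
    and pentagon:
      "pure_tensor K H (tensor_product3 K H H H) \<one>\<^bsub>H\<^esub> \<Phi>
        \<otimes>\<^bsub>tensor_product4 K H H H H\<^esub> id_comult_id K H H \<Delta> \<Phi>
        \<otimes>\<^bsub>tensor_product4 K H H H H\<^esub> tensor_one K H H \<Phi>
       = id_id_comult K H H \<Delta> \<Phi>
        \<otimes>\<^bsub>tensor_product4 K H H H H\<^esub> coact_id_id K H H \<Delta> \<Phi>"
    and counit_reassociator:
      "tensor_map K H H (\<lambda>x. x) (counit_left H \<epsilon>) \<Phi> = \<one>\<^bsub>tensor_product K H H\<^esub>"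

locale quasi_hopf_algebra = quasi_bialgebra K H \<Delta> \<epsilon> \<Phi>
  for K :: "'k ring" (structure) and H :: "('k, 'h) module" (structure) and \<Delta> \<epsilon> \<Phi> +
  fixes S :: "'h \<Rightarrow> 'h" and \<alpha> \<beta> :: 'h
  assumes antipode_linear: "S \<in> linear_maps K H H"
    and antipode_bij: "bij_betw S (carrier H) (carrier H)"
    and antipode_mult: "\<lbrakk>x \<in> carrier H; y \<in> carrier H\<rbrakk> \<Longrightarrow> S (x \<otimes>\<^bsub>H\<^esub> y) = S y \<otimes>\<^bsub>H\<^esub> S x"
    and antipode_one: "S \<one>\<^bsub>H\<^esub> = \<one>\<^bsub>H\<^esub>"
    and alpha_closed: "\<alpha> \<in> carrier H"
    and beta_closed: "\<beta> \<in> carrier H"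
    and antipode_alpha: "h \<in> carrier H \<Longrightarrow>
      tensor_lift H (\<lambda>h\<^sub>1 h\<^sub>2. S h\<^sub>1 \<otimes>\<^bsub>H\<^esub> \<alpha> \<otimes>\<^bsub>H\<^esub> h\<^sub>2) (\<Delta> h) = \<epsilon> h \<odot>\<^bsub>H\<^esub> \<alpha>"
    and antipode_beta: "h \<in> carrier H \<Longrightarrow>
      tensor_lift H (\<lambda>h\<^sub>1 h\<^sub>2. h\<^sub>1 \<otimes>\<^bsub>H\<^esub> \<beta> \<otimes>\<^bsub>H\<^esub> S h\<^sub>2) (\<Delta> h) = \<epsilon> h \<odot>\<^bsub>H\<^esub> \<beta>"
    and antipode_reassociator:
      "tensor_lift3 H (\<lambda>X\<^sub>1 X\<^sub>2 X\<^sub>3. X\<^sub>1 \<otimes>\<^bsub>H\<^esub> \<beta> \<otimes>\<^bsub>H\<^esub> S X\<^sub>2 \<otimes>\<^bsub>H\<^esub> \<alpha> \<otimes>\<^bsub>H\<^esub> X\<^sub>3) \<Phi> = \<one>\<^bsub>H\<^esub>"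
    and antipode_inv_reassociator:
      "tensor_lift3 H (\<lambda>x\<^sub>1 x\<^sub>2 x\<^sub>3. S x\<^sub>1 \<otimes>\<^bsub>H\<^esub> \<alpha> \<otimes>\<^bsub>H\<^esub> x\<^sub>2 \<otimes>\<^bsub>H\<^esub> \<beta> \<otimes>\<^bsub>H\<^esub> S x\<^sub>3)
        (inv\<^bsub>tensor_product3 K H H H\<^esub> \<Phi>) = \<one>\<^bsub>H\<^esub>"


section \<open>Comodule algebras and module algebras\<close>

locale right_comodule_algebra = quasi_bialgebra K H \<Delta> \<epsilon> \<Phi> + B: k_algebra K B
  for K :: "'k ring" (structure) and H :: "('k, 'h) module" (structure) and \<Delta> \<epsilon> \<Phi>
    and B :: "('k, 'b) module" (structure) +
  fixes \<rho> :: "'b \<Rightarrow> ('b, 'h) tensor"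
    and \<Phi>\<^sub>\<rho> :: "('b, 'h, 'h) tensor3"
  assumes coaction_hom: "\<rho> \<in> algebra_hom K B (tensor_product K B H)"
    and coassociator_unit: "\<Phi>\<^sub>\<rho> \<in> Units (tensor_product3 K B H H)"
    and coaction_coassoc: "b \<in> carrier B \<Longrightarrow>
      \<Phi>\<^sub>\<rho> \<otimes>\<^bsub>tensor_product3 K B H H\<^esub> coact_id K B H \<rho> (\<rho> b) =
      id_comult K B H \<Delta> (\<rho> b) \<otimes>\<^bsub>tensor_product3 K B H H\<^esub> \<Phi>\<^sub>\<rho>"
    and coaction_pentagon:
      "pure_tensor K B (tensor_product3 K H H H) \<one>\<^bsub>B\<^esub> \<Phi>
        \<otimes>\<^bsub>tensor_product4 K B H H H\<^esub> id_comult_id K B H \<Delta> \<Phi>\<^sub>\<rho>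
        \<otimes>\<^bsub>tensor_product4 K B H H H\<^esub> tensor_one K B H \<Phi>\<^sub>\<rho>
       = id_id_comult K B H \<Delta> \<Phi>\<^sub>\<rho>
        \<otimes>\<^bsub>tensor_product4 K B H H H\<^esub> coact_id_id K B H \<rho> \<Phi>\<^sub>\<rho>"
    and coaction_counit: "b \<in> carrier B \<Longrightarrow> counit_right B \<epsilon> (\<rho> b) = b"
    and counit_coassociator_middle:
      "tensor_map K B H (\<lambda>x. x) (counit_left H \<epsilon>) \<Phi>\<^sub>\<rho> = \<one>\<^bsub>tensor_product K B H\<^esub>"
    and counit_coassociator_right:
      "tensor_map K B H (\<lambda>x. x) (counit_right H \<epsilon>) \<Phi>\<^sub>\<rho> = \<one>\<^bsub>tensor_product K B H\<^esub>"

definition comodule_algebra_morphism ::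
  "'k ring \<Rightarrow> ('k, 'h) module \<Rightarrow>
    ('k, 'b) module \<Rightarrow> ('b \<Rightarrow> ('b, 'h) tensor) \<Rightarrow> ('b, 'h, 'h) tensor3 \<Rightarrow>
    ('k, 'c) module \<Rightarrow> ('c \<Rightarrow> ('c, 'h) tensor) \<Rightarrow> ('c, 'h, 'h) tensor3 \<Rightarrow> ('b \<Rightarrow> 'c) \<Rightarrow> bool"
  where "comodule_algebra_morphism K H B \<rho> \<Phi>\<^sub>\<rho> B' \<rho>' \<Phi>\<^sub>\<rho>' f \<longleftrightarrow>
    f \<in> algebra_hom K B B' \<and>
    (\<forall>b\<in>carrier B. \<rho>' (f b) = tensor_map K B' H f (\<lambda>x. x) (\<rho> b)) \<and>
    \<Phi>\<^sub>\<rho>' = tensor_map K B' (tensor_product K H H) f (\<lambda>x. x) \<Phi>\<^sub>\<rho>"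

definition comodule_algebra_isomorphic ::
  "'k ring \<Rightarrow> ('k, 'h) module \<Rightarrow>
    ('k, 'b) module \<Rightarrow> ('b \<Rightarrow> ('b, 'h) tensor) \<Rightarrow> ('b, 'h, 'h) tensor3 \<Rightarrow>
    ('k, 'c) module \<Rightarrow> ('c \<Rightarrow> ('c, 'h) tensor) \<Rightarrow> ('c, 'h, 'h) tensor3 \<Rightarrow> bool"
  where "comodule_algebra_isomorphic K H B \<rho> \<Phi>\<^sub>\<rho> B' \<rho>' \<Phi>\<^sub>\<rho>' \<longleftrightarrow>
    (\<exists>f. comodule_algebra_morphism K H B \<rho> \<Phi>\<^sub>\<rho> B' \<rho>' \<Phi>\<^sub>\<rho>' f \<and>
      bij_betw f (carrier B) (carrier B'))"

text \<open>The multiplication of a module algebra need not be associative, hence \<open>A\<close> is only assumed to be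
  a vector space with a bilinear unital multiplication.\<close>

locale left_module_algebra = quasi_bialgebra K H \<Delta> \<epsilon> \<Phi> + A: module K A
  for K :: "'k ring" (structure) and H :: "('k, 'h) module" (structure) and \<Delta> \<epsilon> \<Phi>
    and A :: "('k, 'a) module" (structure) +
  fixes act :: "'h \<Rightarrow> 'a \<Rightarrow> 'a"
  assumes act_bilinear: "bilinear_map K H A A act"
    and act_mult: "\<lbrakk>h \<in> carrier H; h' \<in> carrier H; a \<in> carrier A\<rbrakk>
      \<Longrightarrow> act (h \<otimes>\<^bsub>H\<^esub> h') a = act h (act h' a)"
    and act_one: "a \<in> carrier A \<Longrightarrow> act \<one>\<^bsub>H\<^esub> a = a"
    and mult_bilinear: "bilinear_map K A A A (mult A)"
    and unit_closed: "\<one>\<^bsub>A\<^esub> \<in> carrier A"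
    and unit_left: "a \<in> carrier A \<Longrightarrow> \<one>\<^bsub>A\<^esub> \<otimes>\<^bsub>A\<^esub> a = a"
    and unit_right: "a \<in> carrier A \<Longrightarrow> a \<otimes>\<^bsub>A\<^esub> \<one>\<^bsub>A\<^esub> = a"
    and quasi_assoc: "\<lbrakk>a \<in> carrier A; a' \<in> carrier A; a'' \<in> carrier A\<rbrakk> \<Longrightarrow>
      (a \<otimes>\<^bsub>A\<^esub> a') \<otimes>\<^bsub>A\<^esub> a'' =
      tensor_lift3 A (\<lambda>X\<^sub>1 X\<^sub>2 X\<^sub>3. act X\<^sub>1 a \<otimes>\<^bsub>A\<^esub> (act X\<^sub>2 a' \<otimes>\<^bsub>A\<^esub> act X\<^sub>3 a'')) \<Phi>"
    and act_on_mult: "\<lbrakk>h \<in> carrier H; a \<in> carrier A; a' \<in> carrier A\<rbrakk> \<Longrightarrow>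
      act h (a \<otimes>\<^bsub>A\<^esub> a') = tensor_lift A (\<lambda>h\<^sub>1 h\<^sub>2. act h\<^sub>1 a \<otimes>\<^bsub>A\<^esub> act h\<^sub>2 a') (\<Delta> h)"
    and act_on_unit: "h \<in> carrier H \<Longrightarrow> act h \<one>\<^bsub>A\<^esub> = \<epsilon> h \<odot>\<^bsub>A\<^esub> \<one>\<^bsub>A\<^esub>"


section \<open>The smash product\<close>

text \<open>The underlying vector space and the unit are those of \<open>A \<otimes> H\<close>.\<close>

definition smash_product ::
  "'k ring \<Rightarrow> ('k, 'h) module \<Rightarrow> ('h \<Rightarrow> ('h, 'h) tensor) \<Rightarrow> ('h, 'h, 'h) tensor3 \<Rightarrow>
    ('k, 'a) module \<Rightarrow> ('h \<Rightarrow> 'a \<Rightarrow> 'a) \<Rightarrow> ('k, ('a, 'h) tensor) module"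
  where "smash_product K H \<Delta> \<Phi> A act =
    (let AH = tensor_product K A H in
      AH\<lparr>mult := (\<lambda>s t.
        tensor_lift AH (\<lambda>a h. tensor_lift AH (\<lambda>a' h'.
          tensor_lift3 AH (\<lambda>x\<^sub>1 x\<^sub>2 x\<^sub>3. tensor_lift AH (\<lambda>h\<^sub>1 h\<^sub>2.
            pure_tensor K A H
              (act x\<^sub>1 a \<otimes>\<^bsub>A\<^esub> act (x\<^sub>2 \<otimes>\<^bsub>H\<^esub> h\<^sub>1) a')
              (x\<^sub>3 \<otimes>\<^bsub>H\<^esub> h\<^sub>2 \<otimes>\<^bsub>H\<^esub> h')) (\<Delta> h)) (inv\<^bsub>tensor_product3 K H H H\<^esub> \<Phi>)) t) s)\<rparr>)"

definition smash_coaction ::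
  "'k ring \<Rightarrow> ('k, 'h) module \<Rightarrow> ('h \<Rightarrow> ('h, 'h) tensor) \<Rightarrow> ('h, 'h, 'h) tensor3 \<Rightarrow>
    ('k, 'a) module \<Rightarrow> ('h \<Rightarrow> 'a \<Rightarrow> 'a) \<Rightarrow> ('a, 'h) tensor \<Rightarrow> (('a, 'h) tensor, 'h) tensor"
  where "smash_coaction K H \<Delta> \<Phi> A act =
    (let AsH = smash_product K H \<Delta> \<Phi> A act; T = tensor_product K AsH H in
      tensor_lift T (\<lambda>a h. tensor_lift3 T (\<lambda>x\<^sub>1 x\<^sub>2 x\<^sub>3. tensor_lift T (\<lambda>h\<^sub>1 h\<^sub>2.
        pure_tensor K AsH H (pure_tensor K A H (act x\<^sub>1 a) (x\<^sub>2 \<otimes>\<^bsub>H\<^esub> h\<^sub>1)) (x\<^sub>3 \<otimes>\<^bsub>H\<^esub> h\<^sub>2))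
        (\<Delta> h)) (inv\<^bsub>tensor_product3 K H H H\<^esub> \<Phi>)))"

definition smash_coassociator ::
  "'k ring \<Rightarrow> ('k, 'h) module \<Rightarrow> ('h \<Rightarrow> ('h, 'h) tensor) \<Rightarrow> ('h, 'h, 'h) tensor3 \<Rightarrow>
    ('k, 'a) module \<Rightarrow> ('h \<Rightarrow> 'a \<Rightarrow> 'a) \<Rightarrow> (('a, 'h) tensor, 'h, 'h) tensor3"
  where "smash_coassociator K H \<Delta> \<Phi> A act =
    (let AsH = smash_product K H \<Delta> \<Phi> A act; HH = tensor_product K H H in
      tensor_lift3 (tensor_product K AsH HH) (\<lambda>X\<^sub>1 X\<^sub>2 X\<^sub>3.
        pure_tensor K AsH HH (pure_tensor K A H \<one>\<^bsub>A\<^esub> X\<^sub>1) (pure_tensor K H H X\<^sub>2 X\<^sub>3)) \<Phi>)"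


section \<open>The module algebra attached to a morphism from \<open>H\<close>\<close>

text \<open>The element \<open>q\<^sup>1 \<otimes> q\<^sup>2 = X\<^sup>1 \<otimes> S\<^sup>-\<^sup>1(\<alpha> X\<^sup>3) X\<^sup>2\<close>.\<close>

definition q_element ::
  "'k ring \<Rightarrow> ('k, 'h) module \<Rightarrow> ('h, 'h, 'h) tensor3 \<Rightarrow> ('h \<Rightarrow> 'h) \<Rightarrow> 'h \<Rightarrow> ('h, 'h) tensor"
  where "q_element K H \<Phi> S \<alpha> =
    tensor_lift3 (tensor_product K H H) (\<lambda>X\<^sub>1 X\<^sub>2 X\<^sub>3.
      pure_tensor K H H X\<^sub>1 (inv_into (carrier H) S (\<alpha> \<otimes>\<^bsub>H\<^esub> X\<^sub>3) \<otimes>\<^bsub>H\<^esub> X\<^sub>2)) \<Phi>"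

definition E_map ::
  "'k ring \<Rightarrow> ('k, 'h) module \<Rightarrow> ('h, 'h, 'h) tensor3 \<Rightarrow> ('h \<Rightarrow> 'h) \<Rightarrow> 'h \<Rightarrow> 'h \<Rightarrow>
    ('k, 'b) module \<Rightarrow> ('b \<Rightarrow> ('b, 'h) tensor) \<Rightarrow> ('h \<Rightarrow> 'b) \<Rightarrow> 'b \<Rightarrow> 'b"
  where "E_map K H \<Phi> S \<alpha> \<beta> B \<rho> v b =
    tensor_lift B (\<lambda>q\<^sub>1 q\<^sub>2. tensor_lift B (\<lambda>b\<^sub>0 b\<^sub>1.
      v q\<^sub>1 \<otimes>\<^bsub>B\<^esub> b\<^sub>0 \<otimes>\<^bsub>B\<^esub> v (\<beta> \<otimes>\<^bsub>H\<^esub> S (q\<^sub>2 \<otimes>\<^bsub>H\<^esub> b\<^sub>1))) (\<rho> b)) (q_element K H \<Phi> S \<alpha>)"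

text \<open>Zero, addition and scalar multiplication, as well as the unit, are those of \<open>B\<close>.\<close>

definition E_algebra :: "('k, 'b) module \<Rightarrow> ('b \<Rightarrow> 'b) \<Rightarrow> ('k, 'b) module"
  where "E_algebra B E = B\<lparr>carrier := E ` carrier B, mult := (\<lambda>a a'. E (a \<otimes>\<^bsub>B\<^esub> a'))\<rparr>"

definition E_action :: "('k, 'b) module \<Rightarrow> ('b \<Rightarrow> 'b) \<Rightarrow> ('h \<Rightarrow> 'b) \<Rightarrow> 'h \<Rightarrow> 'b \<Rightarrow> 'b"
  where "E_action B E v h a = E (v h \<otimes>\<^bsub>B\<^esub> a)"

end

theory Submission
  imports Defs
begin

text \<open>
  Suppress \<open>v\<close> from the notation. With \<open>contractB(b \<otimes> u \<otimes> w) = b \<beta> S(u) \<alpha> w\<close> one has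
  \<open>E(m) = contractB(\<Phi>\<^sub>\<rho> (\<rho>(m) \<otimes> 1))\<close>, and the antipode axioms together with quasi-coassociativity give
  \<open>E(m h) = \<epsilon>(h) E(m)\<close> and \<open>b E(m) = E(b\<^sub>0 m) b\<^sub>1\<close> for all \<open>b\<close>, \<open>m\<close> and \<open>h\<close>. Formal consequences are
  \<open>b = E(b\<^sub>0) b\<^sub>1\<close>, \<open>E(E(m)) = E(m)\<close> and \<open>E(b E(m)) = E(b m)\<close>. The pentagon for \<open>\<Phi>\<^sub>\<rho>\<close> shows that the
  elements \<open>a\<close> of \<open>E(B)\<close> are coinvariant, \<open>E(a\<^sub>0) \<otimes> a\<^sub>1 = a \<otimes> 1\<close>, whence
  \<open>\<rho>(a) = E(x\<^sup>1 a) x\<^sup>2 \<otimes> x\<^sup>3\<close>. So \<open>b \<mapsto> E(b\<^sub>0) \<otimes> b\<^sub>1\<close> and \<open>a \<otimes> h \<mapsto> a h\<close> are mutually inverse, and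
  evaluating the former at \<open>(a h)(a' h')\<close> yields the multiplication of the smash product. The structure
  of \<open>A # H\<close> is therefore the transport of that of \<open>B\<close>, and its axioms need not be derived from those
  of a module algebra.
\<close>

section \<open>Linear maps\<close>

text \<open>The inverse antipode in \<open>q_element\<close> cancels:
  \<open>S(q2 b1) = S(b1) S(X2) \<alpha> X3\<close>. Hence only \<open>\<beta> S(-) \<alpha>\<close>
  survives in \<open>E\<close>, and two mechanisms drive every cancellation: a coproduct enclosing
  \<open>\<beta>\<close> or \<open>\<alpha>\<close> collapses to its counit, and \<open>E\<close>
  forgets a right factor \<open>v h\<close>. As
  \<open>\<Phi>\<^sub>\<rho> = (v \<otimes> id \<otimes> id) \<Phi>\<close>, the second one also
  removes \<open>\<Phi>\<^sub>\<rho>\<close> standing at the right end, provided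
  \<open>(\<epsilon> \<otimes> id \<otimes> id) \<Phi> = 1\<close>; this is not among the axioms and
  is derived from the pentagon. A tensor is a class of lists, so Sweedler computations are recast as
  identities between linear maps, and each Sweedler expression in use gets a named linear map. Since
  \<open>\<Delta> h\<close>, \<open>\<rho> b\<close> and \<open>\<Phi>\<close> are not pure, a
  computation is first carried out with an arbitrary tensor in their place, where linearity reduces
  it to pure tensors, and is then specialised. This is the purpose of the local facts quantified
  over \<open>y\<close>, \<open>r\<close>, \<open>s\<close> or \<open>x\<close>.\<close>

lemma linear_mapsI:
  assumes "\<And>x. x \<in> carrier M \<Longrightarrow> f x \<in> carrier N"
    and "\<And>x y. \<lbrakk>x \<in> carrier M; y \<in> carrier M\<rbrakk> \<Longrightarrow> f (x \<oplus>\<^bsub>M\<^esub> y) = f x \<oplus>\<^bsub>N\<^esub> f y"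
    and "\<And>c x. \<lbrakk>c \<in> carrier K; x \<in> carrier M\<rbrakk> \<Longrightarrow> f (c \<odot>\<^bsub>M\<^esub> x) = c \<odot>\<^bsub>N\<^esub> f x"
  shows "f \<in> linear_maps K M N"
  using assms by (simp add: linear_maps_def)

lemma
  assumes "f \<in> linear_maps K M N"
  shows linear_map_closed: "x \<in> carrier M \<Longrightarrow> f x \<in> carrier N"
    and linear_map_add:
      "\<lbrakk>x \<in> carrier M; y \<in> carrier M\<rbrakk> \<Longrightarrow> f (x \<oplus>\<^bsub>M\<^esub> y) = f x \<oplus>\<^bsub>N\<^esub> f y"
    and linear_map_smult:
      "\<lbrakk>c \<in> carrier K; x \<in> carrier M\<rbrakk> \<Longrightarrow> f (c \<odot>\<^bsub>M\<^esub> x) = c \<odot>\<^bsub>N\<^esub> f x"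
  using assms by (auto simp: linear_maps_def)

lemma linear_map_zero:
  assumes "module K M" "module K N" "f \<in> linear_maps K M N"
  shows "f \<zero>\<^bsub>M\<^esub> = \<zero>\<^bsub>N\<^esub>"
proof -
  interpret M: module K M by fact
  interpret N: module K N by fact
  have "f \<zero>\<^bsub>M\<^esub> = f (\<zero>\<^bsub>K\<^esub> \<odot>\<^bsub>M\<^esub> \<zero>\<^bsub>M\<^esub>)" by simp
  also have "\<dots> = \<zero>\<^bsub>K\<^esub> \<odot>\<^bsub>N\<^esub> f \<zero>\<^bsub>M\<^esub>"
    by (intro linear_map_smult[OF assms(3)]) auto
  finally show ?thesis using linear_map_closed[OF assms(3)] by simp
qed

lemma linear_map_id: "(\<lambda>x. x) \<in> linear_maps K M M"
  by (auto intro: linear_mapsI)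

lemma linear_map_comp:
  assumes "f \<in> linear_maps K N P" "(\<lambda>x. h x) \<in> linear_maps K M N"
  shows "(\<lambda>x. f (h x)) \<in> linear_maps K M P"
  using assms by (auto simp: linear_maps_def Pi_def)

lemma linear_map_cong:
  assumes "f \<in> linear_maps K M N" "\<And>x. x \<in> carrier M \<Longrightarrow> f x = g x" "module K M"
  shows "g \<in> linear_maps K M N"
proof -
  interpret M: module K M by fact
  show ?thesis
  proof (rule linear_mapsI)
    fix x y assume "x \<in> carrier M" "y \<in> carrier M"
    then show "g (x \<oplus>\<^bsub>M\<^esub> y) = g x \<oplus>\<^bsub>N\<^esub> g y"
      using linear_map_add[OF assms(1), of x y] assms(2)[of x] assms(2)[of y]
        assms(2)[of "x \<oplus>\<^bsub>M\<^esub> y"] by simp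
  next
    fix c x assume "c \<in> carrier K" "x \<in> carrier M"
    then show "g (c \<odot>\<^bsub>M\<^esub> x) = c \<odot>\<^bsub>N\<^esub> g x"
      using linear_map_smult[OF assms(1), of c x] assms(2)[of x] assms(2)[of "c \<odot>\<^bsub>M\<^esub> x"] by simp
  next
    fix x assume "x \<in> carrier M"
    then show "g x \<in> carrier N"
      using linear_map_closed[OF assms(1), of x] assms(2)[of x] by simp
  qed
qed

lemma bilinear_mapI:
  assumes "\<And>x. x \<in> carrier M \<Longrightarrow> (\<lambda>y. f x y) \<in> linear_maps K N P"
    and "\<And>y. y \<in> carrier N \<Longrightarrow> (\<lambda>x. f x y) \<in> linear_maps K M P"
  shows "bilinear_map K M N P f"
  using assms by (simp add: bilinear_map_def)

lemma
  assumes "bilinear_map K M N P f"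
  shows bilinear_map_left:
      "\<lbrakk>y \<in> carrier N; (\<lambda>x. h x) \<in> linear_maps K Q M\<rbrakk>
        \<Longrightarrow> (\<lambda>x. f (h x) y) \<in> linear_maps K Q P"
    and bilinear_map_right:
      "\<lbrakk>x \<in> carrier M; (\<lambda>y. h' y) \<in> linear_maps K Q N\<rbrakk>
        \<Longrightarrow> (\<lambda>y. f x (h' y)) \<in> linear_maps K Q P"
    and bilinear_map_closed: "\<lbrakk>x \<in> carrier M; y \<in> carrier N\<rbrakk> \<Longrightarrow> f x y \<in> carrier P"
  using assms linear_map_comp[of "\<lambda>x. f x y" K M P h Q] linear_map_comp[of "f x" K N P h' Q]
  by (auto simp: bilinear_map_def linear_maps_def)

lemma algebra_homI:
  assumes "f \<in> linear_maps K A B"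
    and "\<And>x y. \<lbrakk>x \<in> carrier A; y \<in> carrier A\<rbrakk> \<Longrightarrow> f (x \<otimes>\<^bsub>A\<^esub> y) = f x \<otimes>\<^bsub>B\<^esub> f y"
    and "f \<one>\<^bsub>A\<^esub> = \<one>\<^bsub>B\<^esub>"
  shows "f \<in> algebra_hom K A B"
  using assms by (auto simp: algebra_hom_def ring_hom_def linear_maps_def)

lemma
  assumes "f \<in> algebra_hom K A B"
  shows algebra_hom_linear: "f \<in> linear_maps K A B"
    and algebra_hom_mult:
      "\<lbrakk>x \<in> carrier A; y \<in> carrier A\<rbrakk> \<Longrightarrow> f (x \<otimes>\<^bsub>A\<^esub> y) = f x \<otimes>\<^bsub>B\<^esub> f y"
    and algebra_hom_one: "f \<one>\<^bsub>A\<^esub> = \<one>\<^bsub>B\<^esub>"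
  using assms by (auto simp: algebra_hom_def ring_hom_def)

lemma algebra_hom_id: "(\<lambda>x. x) \<in> algebra_hom K A A"
  by (rule algebra_homI) (auto intro: linear_map_id)

lemma algebra_hom_comp:
  assumes "f \<in> algebra_hom K A B" "g \<in> algebra_hom K B C"
  shows "(\<lambda>x. g (f x)) \<in> algebra_hom K A C"
  using assms
  by (auto intro!: algebra_homI linear_map_comp[of g K B C f A] dest: algebra_hom_linear
      simp: algebra_hom_mult algebra_hom_one linear_map_closed[OF algebra_hom_linear])

lemma k_algebraI:
  assumes "field K" "module K A" "ring A" "bilinear_map K A A A (mult A)"
  shows "k_algebra K A"
proof -
  have "k_algebra_axioms K A"
    using assms(4) by unfold_locales (auto simp: bilinear_map_def linear_maps_def)
  then show ?thesis using assms by (simp add: k_algebra_def)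
qed

context k_algebra
begin

lemma mult_linear:
  "\<lbrakk>a \<in> carrier A; (\<lambda>x. h x) \<in> linear_maps K M A\<rbrakk> \<Longrightarrow> (\<lambda>x. a \<otimes>\<^bsub>A\<^esub> h x) \<in> linear_maps K M A"
  "\<lbrakk>a \<in> carrier A; (\<lambda>x. h x) \<in> linear_maps K M A\<rbrakk> \<Longrightarrow> (\<lambda>x. h x \<otimes>\<^bsub>A\<^esub> a) \<in> linear_maps K M A"
  by (auto simp: linear_maps_def Pi_def l_distr r_distr smult_mult_left smult_mult_right)

lemma module: "module K A" ..

lemma k_algebra: "k_algebra K A" ..

end

lemma (in module) smult_linear:
  assumes "c \<in> carrier R" "(\<lambda>x. h x) \<in> linear_maps R N M"
  shows "(\<lambda>x. c \<odot>\<^bsub>M\<^esub> h x) \<in> linear_maps R N M"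
  using assms by (auto simp: linear_maps_def Pi_def smult_r_distr smult_assoc1[symmetric] m_comm)

text \<open>Here the scalar varies and the vector is fixed. The hypotheses spell out that
  \<open>h\<close> is a linear form, because the ring \<open>K\<close> is no module record and
  \<open>linear_maps\<close> cannot express it; the case in view is the counit.\<close>

lemma (in module) smult_linear':
  assumes "a \<in> carrier M" "\<And>x. x \<in> carrier N \<Longrightarrow> h x \<in> carrier R"
    "\<And>x y. \<lbrakk>x \<in> carrier N; y \<in> carrier N\<rbrakk> \<Longrightarrow> h (x \<oplus>\<^bsub>N\<^esub> y) = h x \<oplus> h y"
    "\<And>c x. \<lbrakk>c \<in> carrier R; x \<in> carrier N\<rbrakk> \<Longrightarrow> h (c \<odot>\<^bsub>N\<^esub> x) = c \<otimes> h x"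
  shows "(\<lambda>x. h x \<odot>\<^bsub>M\<^esub> a) \<in> linear_maps R N M"
  using assms by (auto simp: linear_maps_def Pi_def smult_l_distr smult_assoc1)


section \<open>The tensor product of two modules\<close>

lemma linear_map_list_sum:
  assumes "module K P" "module K Q" "F \<in> linear_maps K P Q"
    and "\<And>a b. (a, b) \<in> set l \<Longrightarrow> f a b \<in> carrier P"
  shows "F (list_sum P f l) = list_sum Q (\<lambda>a b. F (f a b)) l"
proof -
  interpret P: module K P by fact
  have P: "abelian_monoid P" by unfold_locales
  show ?thesis using assms(4)
  proof (induction l)
    case Nil
    then show ?case using linear_map_zero[OF assms(1-3)] by (simp add: list_sum_def)
  next
    case (Cons p l)
    obtain a b where p: "p = (a, b)" by fastforce
    have "f a b \<in> carrier P" "list_sum P f l \<in> carrier P"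
      using Cons.prems p by (auto intro!: list_sum_closed[OF P])
    then show ?case using Cons p by (simp add: list_sum_def linear_map_add[OF assms(3)])
  qed
qed

lemma list_sum_cong:
  assumes "\<And>a b. (a, b) \<in> set l \<Longrightarrow> f a b = g a b"
  shows "list_sum P f l = list_sum P g l"
  using assms by (induction l) (auto simp: list_sum_def)

locale tensor_modules = M: module K M + N: module K N
  for K (structure) and M :: "('k, 'a, 'm) module_scheme" and N :: "('k, 'b, 'n) module_scheme"
begin

abbreviation "L \<equiv> lists (carrier M \<times> carrier N)"
abbreviation "T \<equiv> tensor_product K M N"
abbreviation "cls \<equiv> tensor_class K M N"
abbreviation "pure \<equiv> pure_tensor K M N"
abbreviation "rel \<equiv> tensor_rel K M N"

section \<open>The vector space of formal sums modulo bilinearity\<close>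

lemma rel_equiv: "equiv L rel"
  using equiv_tensor_rel[OF M.module_axioms N.module_axioms] .

lemma relD: "(l, l') \<in> rel \<Longrightarrow> l \<in> L \<and> l' \<in> L"
  using tensor_rel_subset[OF M.module_axioms N.module_axioms] by blast

lemma cls_closed: "l \<in> L \<Longrightarrow> cls l \<in> carrier T"
  by (auto simp: tensor_class_def tensor_product_def quotient_def)

lemma cls_eqI: "(l, l') \<in> rel \<Longrightarrow> cls l = cls l'"
  unfolding tensor_class_def using rel_equiv by (rule equiv_class_eq)

lemma rep_cls: "l \<in> L \<Longrightarrow> (l, tensor_rep (cls l)) \<in> rel"
proof -
  assume "l \<in> L"
  then have "l \<in> cls l" by (auto simp: tensor_class_def intro: tensor_rel.refl)
  then have "tensor_rep (cls l) \<in> cls l" by (rule someI)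
  then show ?thesis by (simp add: tensor_class_def)
qed

lemma carrier_rep:
  assumes "t \<in> carrier T"
  shows "tensor_rep t \<in> L" "cls (tensor_rep t) = t"
proof -
  obtain l where l: "l \<in> L" "t = cls l"
    using assms by (auto simp: tensor_class_def tensor_product_def quotient_def)
  from rep_cls[OF l(1)] l(2) show "tensor_rep t \<in> L" "cls (tensor_rep t) = t"
    using relD cls_eqI[of l "tensor_rep t"] by auto
qed

lemma add_cls:
  assumes "l \<in> L" "l' \<in> L"
  shows "cls l \<oplus>\<^bsub>T\<^esub> cls l' = cls (l @ l')"
  using tensor_rel.append[OF rep_cls rep_cls, OF assms]
  by (auto simp: tensor_product_def intro!: cls_eqI intro: tensor_rel.sym)

abbreviation "scale c \<equiv> map (\<lambda>(a, b). (c \<odot>\<^bsub>M\<^esub> a, b))"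

lemma scale_closed: "\<lbrakk>c \<in> carrier K; l \<in> L\<rbrakk> \<Longrightarrow> scale c l \<in> L"
  by (induction l) auto

text \<open>Scalar multiplication in \<open>tensor_product\<close> acts on a chosen representative;
  this makes the result independent of the choice. Commutativity of the scalars enters in the case
  \<open>smult\<close>.\<close>

lemma scale_rel:
  assumes "c \<in> carrier K" "(l, l') \<in> rel"
  shows "(scale c l, scale c l') \<in> rel"
  using assms(2)
proof induction
  case (refl l)
  then have "scale c l \<in> L" using assms(1) by (intro scale_closed)
  then show ?case by (rule tensor_rel.refl)
next
  case (commute l l')
  then have "scale c l \<in> L" "scale c l' \<in> L" using assms(1) by (simp_all only: scale_closed)
  then show ?case by (simp add: tensor_rel.commute)
next
  case (smult d a b)
  then have "c \<odot>\<^bsub>M\<^esub> (d \<odot>\<^bsub>M\<^esub> a) = d \<odot>\<^bsub>M\<^esub> (c \<odot>\<^bsub>M\<^esub> a)"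
    using assms(1) by (simp add: M.smult_assoc1[symmetric] M.m_comm)
  then show ?case using smult assms(1) by (auto intro: tensor_rel.smult)
next
  case (zero_left b)
  then show ?case using assms(1) by (auto intro: tensor_rel.zero_left)
next
  case (add_left a a' b)
  then show ?case using assms(1) by (auto simp: M.smult_r_distr intro: tensor_rel.add_left)
next
  case (add_right a b b')
  then show ?case using assms(1) by (auto intro: tensor_rel.add_right)
next
  case (append l1 l1' l2 l2')
  then show ?case by (auto intro: tensor_rel.append)
qed (auto intro: tensor_rel.sym tensor_rel.trans)

lemma smult_cls:
  assumes "c \<in> carrier K" "l \<in> L"
  shows "c \<odot>\<^bsub>T\<^esub> cls l = cls (scale c l)"
  using scale_rel[OF assms(1) rep_cls[OF assms(2)]]
  by (auto simp: tensor_product_def intro!: cls_eqI intro: tensor_rel.sym)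

lemma zero_cls: "\<zero>\<^bsub>T\<^esub> = cls []"
  by (simp add: tensor_product_def)

lemma cls_cases:
  assumes "t \<in> carrier T" obtains l where "l \<in> L" "t = cls l"
  using carrier_rep[OF assms] by metis

lemma abelian_monoid_T: "abelian_monoid T"
proof (rule abelian_monoidI)
  fix x y assume "x \<in> carrier T" "y \<in> carrier T"
  then obtain l l' where "l \<in> L" "x = cls l" "l' \<in> L" "y = cls l'"
    by (elim cls_cases)
  then show "x \<oplus>\<^bsub>T\<^esub> y \<in> carrier T" "x \<oplus>\<^bsub>T\<^esub> y = y \<oplus>\<^bsub>T\<^esub> x"
    by (auto simp: add_cls intro!: cls_closed cls_eqI tensor_rel.commute)
next
  fix x y z assume "x \<in> carrier T" "y \<in> carrier T" "z \<in> carrier T"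
  then obtain l l' l'' where "l \<in> L" "x = cls l" "l' \<in> L" "y = cls l'" "l'' \<in> L" "z = cls l''"
    by (elim cls_cases)
  then show "(x \<oplus>\<^bsub>T\<^esub> y) \<oplus>\<^bsub>T\<^esub> z = x \<oplus>\<^bsub>T\<^esub> (y \<oplus>\<^bsub>T\<^esub> z)"
    by (simp add: add_cls)
next
  fix x assume "x \<in> carrier T"
  then obtain l where "l \<in> L" "x = cls l" by (elim cls_cases)
  then show "\<zero>\<^bsub>T\<^esub> \<oplus>\<^bsub>T\<^esub> x = x" using add_cls[of "[]" l] by (simp add: zero_cls)
qed (simp add: zero_cls cls_closed)

lemma pure_closed [simp]: "\<lbrakk>a \<in> carrier M; b \<in> carrier N\<rbrakk> \<Longrightarrow> pure a b \<in> carrier T"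
  by (simp add: pure_tensor_def cls_closed)

text \<open>Peeling off the head of a representative exhibits a class as a finite sum of pure
  tensors. There is no case for scalars, since a scalar can be moved into the left factor of a pure
  tensor.\<close>

lemma tensor_induct [consumes 1, case_names zero pure add]:
  assumes "t \<in> carrier T"
    and "P \<zero>\<^bsub>T\<^esub>"
    and "\<And>a b. \<lbrakk>a \<in> carrier M; b \<in> carrier N\<rbrakk> \<Longrightarrow> P (pure a b)"
    and "\<And>s t. \<lbrakk>s \<in> carrier T; t \<in> carrier T; P s; P t\<rbrakk> \<Longrightarrow> P (s \<oplus>\<^bsub>T\<^esub> t)"
  shows "P t"
proof -
  have "P (cls l)" if "l \<in> L" for l
    using that
  proof (induction l)
    case Nil
    then show ?case using assms(2) by (simp add: zero_cls)
  next
    case (Cons p l)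
    obtain a b where p: "p = (a, b)" by fastforce
    have "cls (p # l) = pure a b \<oplus>\<^bsub>T\<^esub> cls l"
      using Cons p by (simp add: pure_tensor_def add_cls)
    then show ?case using Cons p assms(3,4) by (auto simp: cls_closed)
  qed
  then show ?thesis using carrier_rep[OF assms(1)] by metis
qed

lemma smult_pure:
  "\<lbrakk>c \<in> carrier K; a \<in> carrier M; b \<in> carrier N\<rbrakk> \<Longrightarrow> c \<odot>\<^bsub>T\<^esub> pure a b = pure (c \<odot>\<^bsub>M\<^esub> a) b"
  "\<lbrakk>c \<in> carrier K; a \<in> carrier M; b \<in> carrier N\<rbrakk> \<Longrightarrow> c \<odot>\<^bsub>T\<^esub> pure a b = pure a (c \<odot>\<^bsub>N\<^esub> b)"
  by (auto simp: pure_tensor_def smult_cls intro!: cls_eqI tensor_rel.smult)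

lemma add_pure:
  "\<lbrakk>a \<in> carrier M; a' \<in> carrier M; b \<in> carrier N\<rbrakk>
    \<Longrightarrow> pure (a \<oplus>\<^bsub>M\<^esub> a') b = pure a b \<oplus>\<^bsub>T\<^esub> pure a' b"
  "\<lbrakk>a \<in> carrier M; b \<in> carrier N; b' \<in> carrier N\<rbrakk>
    \<Longrightarrow> pure a (b \<oplus>\<^bsub>N\<^esub> b') = pure a b \<oplus>\<^bsub>T\<^esub> pure a b'"
  by (auto simp: pure_tensor_def add_cls intro!: cls_eqI tensor_rel.add_left tensor_rel.add_right)

lemma pure_zero: "b \<in> carrier N \<Longrightarrow> pure \<zero>\<^bsub>M\<^esub> b = \<zero>\<^bsub>T\<^esub>"
  by (auto simp: pure_tensor_def zero_cls intro!: cls_eqI tensor_rel.zero_left)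

lemma smult_T_closed: "\<lbrakk>c \<in> carrier K; t \<in> carrier T\<rbrakk> \<Longrightarrow> c \<odot>\<^bsub>T\<^esub> t \<in> carrier T"
  by (elim cls_cases) (simp add: smult_cls scale_closed cls_closed)

lemma smult_T_add:
  assumes "c \<in> carrier K" "s \<in> carrier T" "t \<in> carrier T"
  shows "c \<odot>\<^bsub>T\<^esub> (s \<oplus>\<^bsub>T\<^esub> t) = c \<odot>\<^bsub>T\<^esub> s \<oplus>\<^bsub>T\<^esub> c \<odot>\<^bsub>T\<^esub> t"
proof -
  obtain l l' where l: "l \<in> L" "s = cls l" "l' \<in> L" "t = cls l'"
    using assms(2,3) by (elim cls_cases)
  moreover have "scale c l \<in> L" "scale c l' \<in> L"
    using assms(1) l by (simp_all only: scale_closed)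
  ultimately show ?thesis using assms(1) by (simp add: add_cls smult_cls)
qed

lemma smult_T_zero: "c \<in> carrier K \<Longrightarrow> c \<odot>\<^bsub>T\<^esub> \<zero>\<^bsub>T\<^esub> = \<zero>\<^bsub>T\<^esub>"
  by (simp add: zero_cls smult_cls)

lemma module_T: "module K T"
proof -
  interpret T: abelian_monoid T by (rule abelian_monoid_T)
  have l_distr: "(c \<oplus> d) \<odot>\<^bsub>T\<^esub> t = c \<odot>\<^bsub>T\<^esub> t \<oplus>\<^bsub>T\<^esub> d \<odot>\<^bsub>T\<^esub> t"
    if "c \<in> carrier K" "d \<in> carrier K" "t \<in> carrier T" for c d t
    using that(3)
    by (induction rule: tensor_induct)
      (simp_all add: that(1,2) smult_T_zero smult_pure(1) M.smult_l_distr add_pure smult_T_add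
        smult_T_closed T.a_ac)
  have zero: "\<zero> \<odot>\<^bsub>T\<^esub> t = \<zero>\<^bsub>T\<^esub>" if "t \<in> carrier T" for t
    using that
    by (induction rule: tensor_induct)
      (simp_all add: smult_T_zero smult_pure(1) pure_zero smult_T_add)
  have one: "\<one> \<odot>\<^bsub>T\<^esub> t = t" if "t \<in> carrier T" for t
    using that
    by (induction rule: tensor_induct)
      (simp_all add: smult_T_zero smult_pure(1) smult_T_add)
  have assoc: "(c \<otimes> d) \<odot>\<^bsub>T\<^esub> t = c \<odot>\<^bsub>T\<^esub> (d \<odot>\<^bsub>T\<^esub> t)"
    if "c \<in> carrier K" "d \<in> carrier K" "t \<in> carrier T" for c d t
    using that(3)
    by (induction rule: tensor_induct)
      (simp_all add: that(1,2) smult_T_zero smult_pure(1) M.smult_assoc1 smult_T_add smult_T_closed)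
  have "abelian_group T"
  proof (intro abelian_groupI)
    fix x assume x: "x \<in> carrier T"
    \<comment> \<open>Formal sums carry no negation; the additive inverse of \<open>x\<close> is
      \<open>(-1) x\<close>, by distributivity over scalars and \<open>0 x = 0\<close>.\<close>
    have "(\<ominus> \<one>) \<odot>\<^bsub>T\<^esub> x \<oplus>\<^bsub>T\<^esub> x = (\<ominus> \<one> \<oplus> \<one>) \<odot>\<^bsub>T\<^esub> x"
      using x by (simp add: l_distr one del: M.R.l_neg)
    also have "\<dots> = \<zero>\<^bsub>T\<^esub>" using x by (simp add: M.R.l_neg zero)
    finally show "\<exists>y\<in>carrier T. y \<oplus>\<^bsub>T\<^esub> x = \<zero>\<^bsub>T\<^esub>" 
      using x smult_T_closed[of "\<ominus> \<one>" x] by auto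
  qed (auto simp: T.a_ac)
  then show ?thesis
    by (intro moduleI) (auto simp: M.is_cring smult_T_closed l_distr smult_T_add assoc one)
qed

sublocale T: module K T by (rule module_T)

section \<open>The universal property and the evaluation of lifts\<close>

lemma pure_bilinear: "bilinear_map K M N T pure"
  by (intro bilinear_mapI linear_mapsI) (auto simp: add_pure smult_pure[symmetric])

lemmas pure_linear = bilinear_map_left[OF pure_bilinear] bilinear_map_right[OF pure_bilinear]

lemma lift_pure:
  assumes "module K P" "bilinear_map K M N P f" "a \<in> carrier M" "b \<in> carrier N"
  shows "tensor_lift P f (pure a b) = f a b"
proof -
  interpret P: module K P by fact
  have "f a b \<in> carrier P" by (rule bilinear_map_closed[OF assms(2-4)])
  moreover have "tensor_lift P f (cls [(a, b)]) = list_sum P f [(a, b)]"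
    using assms by (intro tensor_lift_class[OF M.module_axioms N.module_axioms]) auto
  ultimately show ?thesis by (simp add: pure_tensor_def list_sum_def)
qed

lemma lift_linear:
  assumes "module K P" "bilinear_map K M N P f"
  shows "tensor_lift P f \<in> linear_maps K T P"
proof -
  interpret P: module K P by fact
  have P: "abelian_monoid P" by unfold_locales
  have f: "f a b \<in> carrier P" if "a \<in> carrier M" "b \<in> carrier N" for a b
    using bilinear_map_closed[OF assms(2)] that .
  note lift = tensor_lift_class[OF M.module_axioms N.module_axioms assms]
  have closed: "list_sum P f l \<in> carrier P" if "l \<in> L" for l
    using that f by (intro list_sum_closed[OF P]) auto
  show ?thesis
  proof (rule linear_mapsI)
    fix x assume "x \<in> carrier T"
    then show "tensor_lift P f x \<in> carrier P" by (elim cls_cases) (simp add: lift closed)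
  next
    fix x y assume "x \<in> carrier T" "y \<in> carrier T"
    then obtain l l' where l: "l \<in> L" "x = cls l" "l' \<in> L" "y = cls l'" by (elim cls_cases)
    have "list_sum P f (l @ l') = list_sum P f l \<oplus>\<^bsub>P\<^esub> list_sum P f l'"
      using l f by (intro list_sum_append[OF P]) auto
    then show "tensor_lift P f (x \<oplus>\<^bsub>T\<^esub> y) = tensor_lift P f x \<oplus>\<^bsub>P\<^esub> tensor_lift P f y"
      using l by (simp add: add_cls lift)
  next
    fix c x assume c: "c \<in> carrier K" and "x \<in> carrier T"
    then obtain l where l: "l \<in> L" "x = cls l" by (elim cls_cases)
    have "list_sum P f (scale c l) = c \<odot>\<^bsub>P\<^esub> list_sum P f l" using l(1)
    proof (induction l)
      case Nil
      then show ?case using c by (simp add: list_sum_def)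
    next
      case (Cons p l)
      then have p: "fst p \<in> carrier M" "snd p \<in> carrier N" and lL: "l \<in> L" by auto
      have "f (c \<odot>\<^bsub>M\<^esub> fst p) (snd p) = c \<odot>\<^bsub>P\<^esub> f (fst p) (snd p)"
        by (rule linear_map_smult[OF bilinear_map_left[OF assms(2) p(2) linear_map_id] c p(1)])
      moreover have "f (fst p) (snd p) \<in> carrier P" "list_sum P f l \<in> carrier P"
        using f[OF p] closed[OF lL] by auto
      ultimately show ?case
        using Cons c by (auto simp: list_sum_def case_prod_beta P.smult_r_distr)
    qed
    moreover have "scale c l \<in> L" using c l by (intro scale_closed)
    ultimately show "tensor_lift P f (c \<odot>\<^bsub>T\<^esub> x) = c \<odot>\<^bsub>P\<^esub> tensor_lift P f x"
      using c l by (simp add: smult_cls lift)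
  qed
qed

lemma linear_ext:
  assumes "f \<in> linear_maps K T P" "g \<in> linear_maps K T P" "t \<in> carrier T" "module K P"
    and "\<And>a b. \<lbrakk>a \<in> carrier M; b \<in> carrier N\<rbrakk> \<Longrightarrow> f (pure a b) = g (pure a b)"
  shows "f t = g t"
  using assms(3)
  by (induction rule: tensor_induct)
    (simp_all add: assms(5) linear_map_add[OF assms(1)] linear_map_add[OF assms(2)]
      linear_map_zero[OF module_T assms(4,1)] linear_map_zero[OF module_T assms(4,2)])

text \<open>Both sides run over the same chosen list, whose entries lie in the carriers, so they
  agree term by term.\<close>

lemma lift_cong:
  assumes "t \<in> carrier T"
    and "\<And>a b. \<lbrakk>a \<in> carrier M; b \<in> carrier N\<rbrakk> \<Longrightarrow> f a b = g a b"
  shows "tensor_lift P f t = tensor_lift P g t"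
  unfolding tensor_lift_def using carrier_rep(1)[OF assms(1)] assms(2)
  by (intro list_sum_cong) auto

lemma lift_closed:
  assumes "module K P" "t \<in> carrier T"
    and "\<And>a b. \<lbrakk>a \<in> carrier M; b \<in> carrier N\<rbrakk> \<Longrightarrow> f a b \<in> carrier P"
  shows "tensor_lift P f t \<in> carrier P"
proof -
  interpret P: module K P by fact
  show ?thesis
    unfolding tensor_lift_def using carrier_rep(1)[OF assms(2)] assms(3)
    by (intro list_sum_closed) (auto intro: P.abelian_monoid_axioms)
qed

lemma linear_map_lift:
  assumes "module K P" "module K Q" "F \<in> linear_maps K P Q" "t \<in> carrier T"
    and "\<And>a b. \<lbrakk>a \<in> carrier M; b \<in> carrier N\<rbrakk> \<Longrightarrow> f a b \<in> carrier P"
  shows "F (tensor_lift P f t) = tensor_lift Q (\<lambda>a b. F (f a b)) t"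
  unfolding tensor_lift_def using carrier_rep(1)[OF assms(4)] assms(5)
  by (intro linear_map_list_sum[OF assms(1-3)]) auto

lemma lift_pure_id: "t \<in> carrier T \<Longrightarrow> tensor_lift T pure t = t"
  by (rule linear_ext[OF lift_linear linear_map_id])
    (auto simp: module_T pure_bilinear lift_pure)

text \<open>No multilinearity of \<open>f\<close> is required here, so that the nested sums in definitions can be evaluated
  without checking that they are independent of representatives.\<close>

lemma linear_map_expand:
  assumes "module K P" "F \<in> linear_maps K T P" "t \<in> carrier T"
    and "\<And>a b. \<lbrakk>a \<in> carrier M; b \<in> carrier N\<rbrakk> \<Longrightarrow> F (pure a b) = f a b"
  shows "F t = tensor_lift P f t"
proof -
  have "F t = F (tensor_lift T pure t)" using assms(3) by (simp add: lift_pure_id)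
  also have "\<dots> = tensor_lift P (\<lambda>a b. F (pure a b)) t"
    using assms by (intro linear_map_lift) (auto simp: module_T)
  also have "\<dots> = tensor_lift P f t" using assms by (intro lift_cong)
  finally show ?thesis .
qed

text \<open>For fixed \<open>t\<close> the chosen representative is one fixed list, so the lift is a
  finite sum of maps linear in the parameter. This gives linearity in data that occur under a
  Sweedler sum.\<close>

lemma lift_param_linear:
  assumes "module K P" "module K Q" "t \<in> carrier T"
    and "\<And>a b. \<lbrakk>a \<in> carrier M; b \<in> carrier N\<rbrakk> \<Longrightarrow> (\<lambda>x. f x a b) \<in> linear_maps K Q P"
  shows "(\<lambda>x. tensor_lift P (f x) t) \<in> linear_maps K Q P"
proof -
  interpret P: module K P by fact
  have P: "abelian_monoid P" by unfold_locales
  have f: "f x a b \<in> carrier P" if "x \<in> carrier Q" "a \<in> carrier M" "b \<in> carrier N" for x a b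
    using linear_map_closed[OF assms(4)] that by auto
  have "(\<lambda>x. list_sum P (f x) l) \<in> linear_maps K Q P" if "l \<in> L" for l
    using that
  proof (induction l)
    case Nil
    then show ?case by (auto simp: list_sum_def linear_maps_def)
  next
    case (Cons p l)
    obtain a b where p: "p = (a, b)" "a \<in> carrier M" "b \<in> carrier N" using Cons by force
    have eq: "list_sum P (f x) (p # l) = f x a b \<oplus>\<^bsub>P\<^esub> list_sum P (f x) l" for x
      using p by (simp add: list_sum_def)
    have IH: "(\<lambda>x. list_sum P (f x) l) \<in> linear_maps K Q P" using Cons by auto
    show ?case unfolding eq
      using linear_map_closed[OF IH] linear_map_closed[OF assms(4)[OF p(2,3)]]
      by (intro linear_mapsI)
       (auto simp: p P.a_ac P.smult_r_distr linear_map_add[OF IH] linear_map_smult[OF IH]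
          linear_map_add[OF assms(4)] linear_map_smult[OF assms(4)])
  qed
  then show ?thesis using carrier_rep(1)[OF assms(3)] unfolding tensor_lift_def .
qed

lemma map_bilinear:
  assumes "tensor_modules K M' N'" "f \<in> linear_maps K M M'" "g \<in> linear_maps K N N'"
  shows "bilinear_map K M N (tensor_product K M' N') (\<lambda>a b. pure_tensor K M' N' (f a) (g b))"
proof -
  interpret T': tensor_modules K M' N' by fact
  show ?thesis
    using assms(2,3)
    by (intro bilinear_mapI T'.pure_linear) (auto intro: linear_map_closed)
qed

lemma map_linear:
  assumes "tensor_modules K M' N'" "f \<in> linear_maps K M M'" "g \<in> linear_maps K N N'"
  shows "tensor_map K M' N' f g \<in> linear_maps K T (tensor_product K M' N')"
  unfolding tensor_map_def
  by (intro lift_linear map_bilinear assms tensor_modules.module_T)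

lemma map_pure:
  assumes "tensor_modules K M' N'" "f \<in> linear_maps K M M'" "g \<in> linear_maps K N N'"
    and "a \<in> carrier M" "b \<in> carrier N"
  shows "tensor_map K M' N' f g (pure a b) = pure_tensor K M' N' (f a) (g b)"
  unfolding tensor_map_def
  by (intro lift_pure map_bilinear assms tensor_modules.module_T)

end

lemma tensor_modulesI: "\<lbrakk>module K M; module K N\<rbrakk> \<Longrightarrow> tensor_modules K M N"
  by (simp add: tensor_modules_def)

text \<open>Bracketing to the right lets the two-factor rules apply twice: to the outer tensor
  product, and then, with \<open>a\<close> fixed, to \<open>z \<mapsto> F (a \<otimes> z)\<close> on
  the inner one.\<close>

lemma
  assumes "module K M" "module K N" "module K P" "module K Q" and t: "t \<in> carrier (tensor_product3 K M N P)"
    and F: "F \<in> linear_maps K (tensor_product3 K M N P) Q"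
  shows linear_ext3: "\<lbrakk>G \<in> linear_maps K (tensor_product3 K M N P) Q;
      \<And>a b c. \<lbrakk>a \<in> carrier M; b \<in> carrier N; c \<in> carrier P\<rbrakk> \<Longrightarrow>
        F (pure_tensor K M (tensor_product K N P) a (pure_tensor K N P b c)) =
        G (pure_tensor K M (tensor_product K N P) a (pure_tensor K N P b c))\<rbrakk> \<Longrightarrow> F t = G t"
    and linear_map_expand3: "(\<And>a b c. \<lbrakk>a \<in> carrier M; b \<in> carrier N; c \<in> carrier P\<rbrakk> \<Longrightarrow>
        F (pure_tensor K M (tensor_product K N P) a (pure_tensor K N P b c)) = f a b c)
      \<Longrightarrow> F t = tensor_lift3 Q f t"
proof -
  interpret NP: tensor_modules K N P by (intro tensor_modulesI assms)
  interpret MNP: tensor_modules K M NP.T by (intro tensor_modulesI assms NP.module_T)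
  show "F t = G t" if G: "G \<in> linear_maps K MNP.T Q"
    and eq: "\<And>a b c. \<lbrakk>a \<in> carrier M; b \<in> carrier N; c \<in> carrier P\<rbrakk> \<Longrightarrow>
      F (MNP.pure a (NP.pure b c)) = G (MNP.pure a (NP.pure b c))"
  proof (rule MNP.linear_ext[OF F G t assms(4)])
    fix a z assume az: "a \<in> carrier M" "z \<in> carrier NP.T"
    show "F (MNP.pure a z) = G (MNP.pure a z)"
      by (rule NP.linear_ext[of "\<lambda>z. F (MNP.pure a z)" Q "\<lambda>z. G (MNP.pure a z)"])
        (insert az, auto intro!: linear_map_comp[OF F] linear_map_comp[OF G] MNP.pure_linear linear_map_id simp: assms(1-4) eq)
  qed
  show "F t = tensor_lift3 Q f t"
    if eq: "\<And>a b c. \<lbrakk>a \<in> carrier M; b \<in> carrier N; c \<in> carrier P\<rbrakk> \<Longrightarrow>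
      F (MNP.pure a (NP.pure b c)) = f a b c"
    unfolding tensor_lift3_def
  proof (rule MNP.linear_map_expand[OF assms(4) F t])
    fix a z assume az: "a \<in> carrier M" "z \<in> carrier NP.T"
    show "F (MNP.pure a z) = tensor_lift Q (f a) z"
      by (rule NP.linear_map_expand[of Q "\<lambda>z. F (MNP.pure a z)"])
        (insert az, auto intro!: linear_map_comp[OF F] MNP.pure_linear linear_map_id simp: assms(1-4) eq)
  qed
qed

lemma linear_map_lift3:
  assumes "module K M" "module K N" "module K P" "module K Q" "module K R"
    and t: "t \<in> carrier (tensor_product3 K M N P)" and F: "F \<in> linear_maps K Q R"
    and f: "\<And>a b c. \<lbrakk>a \<in> carrier M; b \<in> carrier N; c \<in> carrier P\<rbrakk> \<Longrightarrow> f a b c \<in> carrier Q"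
  shows "F (tensor_lift3 Q f t) = tensor_lift3 R (\<lambda>a b c. F (f a b c)) t"
proof -
  interpret NP: tensor_modules K N P by (intro tensor_modulesI assms)
  interpret MNP: tensor_modules K M NP.T by (intro tensor_modulesI assms NP.module_T)
  have "F (tensor_lift3 Q f t) = tensor_lift R (\<lambda>a z. F (tensor_lift Q (f a) z)) t"
    unfolding tensor_lift3_def
    by (rule MNP.linear_map_lift[OF assms(4,5) F t]) (auto intro: NP.lift_closed assms(4) f)
  also have "\<dots> = tensor_lift3 R (\<lambda>a b c. F (f a b c)) t"
    unfolding tensor_lift3_def
    by (rule MNP.lift_cong[OF t], rule NP.linear_map_lift[OF assms(4,5) F]) (auto intro: f)
  finally show ?thesis .
qed

lemma linear_ext4:
  assumes "module K M" "module K N" "module K P" "module K Q" "module K R"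
    and t: "t \<in> carrier (tensor_product4 K M N P Q)"
    and F: "F \<in> linear_maps K (tensor_product4 K M N P Q) R"
    and G: "G \<in> linear_maps K (tensor_product4 K M N P Q) R"
    and eq: "\<And>a b c d. \<lbrakk>a \<in> carrier M; b \<in> carrier N; c \<in> carrier P; d \<in> carrier Q\<rbrakk> \<Longrightarrow>
        F (pure_tensor K M (tensor_product3 K N P Q) a (pure_tensor K N (tensor_product K P Q) b
          (pure_tensor K P Q c d))) =
        G (pure_tensor K M (tensor_product3 K N P Q) a (pure_tensor K N (tensor_product K P Q) b
          (pure_tensor K P Q c d)))"
  shows "F t = G t"
proof -
  interpret PQ: tensor_modules K P Q by (intro tensor_modulesI assms)
  interpret NPQ: tensor_modules K N PQ.T by (intro tensor_modulesI assms PQ.module_T)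
  interpret MNPQ: tensor_modules K M NPQ.T by (intro tensor_modulesI assms NPQ.module_T)
  show ?thesis
  proof (rule MNPQ.linear_ext[OF F G t assms(5)])
    fix a z assume az: "a \<in> carrier M" "z \<in> carrier NPQ.T"
    show "F (MNPQ.pure a z) = G (MNPQ.pure a z)"
      by (rule linear_ext3[OF assms(2,3,4,5), of z "\<lambda>z. F (MNPQ.pure a z)" "\<lambda>z. G (MNPQ.pure a z)"])
        (insert az, auto intro!: linear_map_comp[OF F] linear_map_comp[OF G] MNPQ.pure_linear linear_map_id simp: assms(1-4) eq)
  qed
qed

section \<open>Tensor products of algebras\<close>

named_theorems lin "linearity of compound expressions"

lemmas [lin] = linear_map_id

locale tensor_algebras = M: k_algebra K M + N: k_algebra K N
  for K (structure) and M :: "('k, 'a, 'm) module_scheme" and N :: "('k, 'b, 'n) module_scheme"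
begin

sublocale tensor_modules K M N
  by unfold_locales

lemma cls_concat:
  assumes "\<And>a b. (a, b) \<in> set l \<Longrightarrow> F a b \<in> L"
  shows "cls (concat (map (\<lambda>(a, b). F a b) l)) = list_sum T (\<lambda>a b. cls (F a b)) l"
  using assms
proof (induction l)
  case Nil
  then show ?case by (simp add: list_sum_def zero_cls)
next
  case (Cons p l)
  obtain a b where p: "p = (a, b)" by fastforce
  have "concat (map (\<lambda>(a, b). F a b) l) \<in> L" "F a b \<in> L" using Cons.prems p by force+
  then show ?case using Cons p by (simp add: list_sum_def add_cls[symmetric])
qed

text \<open>The record multiplies chosen representatives by a double list comprehension. Written as
  nested lifts, the product inherits bilinearity from the universal property.\<close>

lemma mult_lift:
  assumes "s \<in> carrier T" "t \<in> carrier T"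
  shows "s \<otimes>\<^bsub>T\<^esub> t = tensor_lift T (\<lambda>a b. tensor_lift T (\<lambda>a' b'.
    pure (a \<otimes>\<^bsub>M\<^esub> a') (b \<otimes>\<^bsub>N\<^esub> b')) t) s"
proof -
  note s = carrier_rep(1)[OF assms(1)] and t = carrier_rep(1)[OF assms(2)]
  \<comment> \<open>The inner comprehension is viewed as a concatenation of singletons, so that
    \<open>cls_concat\<close> applies at both levels.\<close>
  have singletons: "concat (map (\<lambda>(a', b'). [(f a', g b')]) l) = map (\<lambda>(a', b'). (f a', g b')) l"
    for f :: "'a \<Rightarrow> 'a" and g :: "'b \<Rightarrow> 'b" and l
    by (induction l) auto
  have mem: "a' \<in> carrier M \<and> b' \<in> carrier N" if "(a', b') \<in> set (tensor_rep t)" for a' b'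
    using that t by auto
  have inner: "cls (concat (map (\<lambda>(a', b'). [(a \<otimes>\<^bsub>M\<^esub> a', b \<otimes>\<^bsub>N\<^esub> b')]) (tensor_rep t))) =
      tensor_lift T (\<lambda>a' b'. pure (a \<otimes>\<^bsub>M\<^esub> a') (b \<otimes>\<^bsub>N\<^esub> b')) t"
    and inner_L: "concat (map (\<lambda>(a', b'). [(a \<otimes>\<^bsub>M\<^esub> a', b \<otimes>\<^bsub>N\<^esub> b')]) (tensor_rep t)) \<in> L"
    if "a \<in> carrier M" "b \<in> carrier N" for a b
    using that t by (auto simp: tensor_lift_def pure_tensor_def intro!: cls_concat dest!: mem)
  have "s \<otimes>\<^bsub>T\<^esub> t = cls (concat (map (\<lambda>(a, b). concat (map (\<lambda>(a', b').
      [(a \<otimes>\<^bsub>M\<^esub> a', b \<otimes>\<^bsub>N\<^esub> b')]) (tensor_rep t))) (tensor_rep s)))"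
    by (simp add: tensor_product_def singletons)
  also have "\<dots> = list_sum T (\<lambda>a b. cls (concat (map (\<lambda>(a', b').
      [(a \<otimes>\<^bsub>M\<^esub> a', b \<otimes>\<^bsub>N\<^esub> b')]) (tensor_rep t)))) (tensor_rep s)"
    using s by (intro cls_concat inner_L) auto
  also have "\<dots> = list_sum T (\<lambda>a b. tensor_lift T (\<lambda>a' b'.
      pure (a \<otimes>\<^bsub>M\<^esub> a') (b \<otimes>\<^bsub>N\<^esub> b')) t) (tensor_rep s)"
    using s by (intro list_sum_cong inner) auto
  finally show ?thesis by (simp only: tensor_lift_def)
qed

lemma mult_bilinear_pure:
  assumes "a \<in> carrier M" "b \<in> carrier N"
  shows "bilinear_map K M N T (\<lambda>a' b'. pure (a \<otimes>\<^bsub>M\<^esub> a') (b \<otimes>\<^bsub>N\<^esub> b'))"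
  using assms
  by (intro bilinear_mapI pure_linear M.mult_linear N.mult_linear linear_map_id) auto

lemma mult_bilinear_lift:
  assumes "t \<in> carrier T"
  shows "bilinear_map K M N T (\<lambda>a b. tensor_lift T (\<lambda>a' b'.
    pure (a \<otimes>\<^bsub>M\<^esub> a') (b \<otimes>\<^bsub>N\<^esub> b')) t)"
  using assms
  by (intro bilinear_mapI lift_param_linear pure_linear M.mult_linear N.mult_linear linear_map_id
      module_T M.module N.module) auto

lemma mult_bilinear: "bilinear_map K T T T (mult T)"
proof (rule bilinear_mapI)
  fix s assume s: "s \<in> carrier T"
  have "(\<lambda>t. tensor_lift T (\<lambda>a b. tensor_lift T (\<lambda>a' b'.
      pure (a \<otimes>\<^bsub>M\<^esub> a') (b \<otimes>\<^bsub>N\<^esub> b')) t) s) \<in> linear_maps K T T"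
    using s by (intro lift_param_linear lift_linear module_T mult_bilinear_pure)
  then show "(\<lambda>t. s \<otimes>\<^bsub>T\<^esub> t) \<in> linear_maps K T T"
    by (rule linear_map_cong) (simp_all add: mult_lift s module_T)
next
  fix t assume t: "t \<in> carrier T"
  have "tensor_lift T (\<lambda>a b. tensor_lift T (\<lambda>a' b'.
      pure (a \<otimes>\<^bsub>M\<^esub> a') (b \<otimes>\<^bsub>N\<^esub> b')) t) \<in> linear_maps K T T"
    by (intro lift_linear module_T mult_bilinear_lift t)
  then show "(\<lambda>s. s \<otimes>\<^bsub>T\<^esub> t) \<in> linear_maps K T T"
    by (rule linear_map_cong) (simp_all add: mult_lift t module_T)
qed

lemma mult_pure [simp]:
  assumes "a \<in> carrier M" "b \<in> carrier N" "a' \<in> carrier M" "b' \<in> carrier N"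
  shows "pure a b \<otimes>\<^bsub>T\<^esub> pure a' b' = pure (a \<otimes>\<^bsub>M\<^esub> a') (b \<otimes>\<^bsub>N\<^esub> b')"
  using assms
  by (simp add: mult_lift lift_pure mult_bilinear_lift mult_bilinear_pure module_T)

lemma one_pure: "\<one>\<^bsub>T\<^esub> = pure \<one>\<^bsub>M\<^esub> \<one>\<^bsub>N\<^esub>"
  by (simp add: tensor_product_def)

lemma k_algebra_T: "k_algebra K T"
proof -
  note mult = bilinear_map_left[OF mult_bilinear] bilinear_map_right[OF mult_bilinear]
  note closed = bilinear_map_closed[OF mult_bilinear]
  have assoc: "(s \<otimes>\<^bsub>T\<^esub> t) \<otimes>\<^bsub>T\<^esub> u = s \<otimes>\<^bsub>T\<^esub> (t \<otimes>\<^bsub>T\<^esub> u)"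
    if s: "s \<in> carrier T" and t: "t \<in> carrier T" and u: "u \<in> carrier T" for s t u
  proof (rule linear_ext[of _ T _ s])
    fix a b assume ab: "a \<in> carrier M" "b \<in> carrier N"
    show "(pure a b \<otimes>\<^bsub>T\<^esub> t) \<otimes>\<^bsub>T\<^esub> u = pure a b \<otimes>\<^bsub>T\<^esub> (t \<otimes>\<^bsub>T\<^esub> u)"
    proof (rule linear_ext[of _ T _ t])
      fix a' b' assume ab': "a' \<in> carrier M" "b' \<in> carrier N"
      show "(pure a b \<otimes>\<^bsub>T\<^esub> pure a' b') \<otimes>\<^bsub>T\<^esub> u = pure a b \<otimes>\<^bsub>T\<^esub> (pure a' b' \<otimes>\<^bsub>T\<^esub> u)"
        by (rule linear_ext[of _ T _ u])
          (insert ab ab' u, auto intro!: mult linear_map_id simp: closed module_T M.m_assoc N.m_assoc)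
    qed (insert ab t u, auto intro!: mult linear_map_id simp: closed module_T)
  qed (insert s t u, auto intro!: mult linear_map_id simp: closed module_T)
  have one: "\<one>\<^bsub>T\<^esub> \<otimes>\<^bsub>T\<^esub> s = s" "s \<otimes>\<^bsub>T\<^esub> \<one>\<^bsub>T\<^esub> = s" if s: "s \<in> carrier T" for s
    by (rule linear_ext[of _ T _ s];
      insert s, auto intro!: mult linear_map_id simp: one_pure module_T)+
  have "Group.monoid T"
    by (rule monoidI) (auto simp: assoc one closed, simp add: one_pure)
  then have "ring T"
    by (intro ringI)
      (auto intro: T.abelian_group_axioms
        simp: one_pure linear_map_add[OF mult(1)[OF _ linear_map_id]]
          linear_map_add[OF mult(2)[OF _ linear_map_id]])
  then show ?thesis
    by (intro k_algebraI M.K.field_axioms module_T mult_bilinear)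
qed

sublocale T: k_algebra K T by (rule k_algebra_T)

text \<open>Multiplicativity compares two bilinear expressions in \<open>s\<close> and
  \<open>t\<close>, hence is decided by pure tensors in each argument.\<close>

lemma algebra_hom_tensorI:
  assumes "k_algebra K P" "F \<in> linear_maps K T P"
    and "\<And>a b a' b'. \<lbrakk>a \<in> carrier M; b \<in> carrier N; a' \<in> carrier M; b' \<in> carrier N\<rbrakk>
      \<Longrightarrow> F (pure (a \<otimes>\<^bsub>M\<^esub> a') (b \<otimes>\<^bsub>N\<^esub> b')) = F (pure a b) \<otimes>\<^bsub>P\<^esub> F (pure a' b')"
    and "F (pure \<one>\<^bsub>M\<^esub> \<one>\<^bsub>N\<^esub>) = \<one>\<^bsub>P\<^esub>"
  shows "F \<in> algebra_hom K T P"
proof (rule algebra_homI)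
  interpret P: k_algebra K P by fact
  note F = linear_map_comp[OF assms(2)] and F_closed = linear_map_closed[OF assms(2)]
  fix s t assume s: "s \<in> carrier T" and t: "t \<in> carrier T"
  show "F (s \<otimes>\<^bsub>T\<^esub> t) = F s \<otimes>\<^bsub>P\<^esub> F t"
  proof (rule linear_ext[of _ P _ s])
    fix a b assume ab: "a \<in> carrier M" "b \<in> carrier N"
    show "F (pure a b \<otimes>\<^bsub>T\<^esub> t) = F (pure a b) \<otimes>\<^bsub>P\<^esub> F t"
      by (rule linear_ext[of _ P _ t])
        (insert ab t, auto intro!: F T.mult_linear P.mult_linear linear_map_id
          simp: F_closed assms(3) P.module)
  qed (insert s t, auto intro!: F T.mult_linear P.mult_linear linear_map_id
      simp: F_closed P.module)
qed (use assms in \<open>auto simp: one_pure\<close>)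

lemma map_hom:
  assumes "tensor_algebras K M' N'" "f \<in> algebra_hom K M M'" "g \<in> algebra_hom K N N'"
  shows "tensor_map K M' N' f g \<in> algebra_hom K T (tensor_product K M' N')"
proof -
  interpret T': tensor_algebras K M' N' by fact
  note fg = algebra_hom_linear[OF assms(2)] algebra_hom_linear[OF assms(3)]
  note map = map_linear[OF T'.tensor_modules_axioms fg] map_pure[OF T'.tensor_modules_axioms fg]
  show ?thesis
    by (rule algebra_hom_tensorI)
      (auto simp: map T'.k_algebra_T T'.one_pure algebra_hom_mult[OF assms(2)]
        algebra_hom_mult[OF assms(3)] algebra_hom_one[OF assms(2)] algebra_hom_one[OF assms(3)]
        linear_map_closed[OF fg(1)] linear_map_closed[OF fg(2)])
qed

lemma pure_left_hom: "(\<lambda>a. pure a \<one>\<^bsub>N\<^esub>) \<in> algebra_hom K M T"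
  by (rule algebra_homI) (auto intro!: pure_linear linear_map_id simp: one_pure)

end

context
  fixes K and M :: "('k, 'a, 'm) module_scheme" and N :: "('k, 'b, 'n) module_scheme"
    and P :: "('k, 'c, 'p) module_scheme"
  assumes M: "module K M" and N: "module K N" and P: "module K P"
begin

interpretation MN: tensor_modules K M N using M N by (rule tensor_modulesI)
interpretation NP: tensor_modules K N P using N P by (rule tensor_modulesI)
interpretation L: tensor_modules K "tensor_product K M N" P
  using MN.module_T P by (rule tensor_modulesI)
interpretation R: tensor_modules K M "tensor_product K N P"
  using M NP.module_T by (rule tensor_modulesI)

private lemma assoc_inner_bilinear:
  assumes "c \<in> carrier P"
  shows "bilinear_map K M N R.T (\<lambda>a b. R.pure a (NP.pure b c))"
  using assms by (intro bilinear_mapI R.pure_linear NP.pure_linear linear_map_id) auto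

private lemma assoc_bilinear:
  "bilinear_map K MN.T P R.T (\<lambda>s c. tensor_lift R.T (\<lambda>a b. R.pure a (NP.pure b c)) s)"
  by (intro bilinear_mapI MN.lift_linear MN.lift_param_linear R.module_T P assoc_inner_bilinear
      R.pure_linear NP.pure_linear linear_map_id)

lemma assoc_linear: "tensor_assoc K M N P \<in> linear_maps K L.T R.T"
  unfolding tensor_assoc_def Let_def by (intro L.lift_linear R.module_T assoc_bilinear)

lemma assoc_pure:
  assumes "a \<in> carrier M" "b \<in> carrier N" "c \<in> carrier P"
  shows "tensor_assoc K M N P (L.pure (MN.pure a b) c) = R.pure a (NP.pure b c)"
  using assms
  by (simp add: tensor_assoc_def Let_def L.lift_pure MN.lift_pure R.module_T assoc_bilinear
      assoc_inner_bilinear)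

end

lemma assoc_hom:
  assumes "k_algebra K M" "k_algebra K N" "k_algebra K P"
  shows "tensor_assoc K M N P \<in>
    algebra_hom K (tensor_product K (tensor_product K M N) P) (tensor_product3 K M N P)"
proof -
  interpret M: k_algebra K M by fact
  interpret N: k_algebra K N by fact
  interpret P: k_algebra K P by fact
  interpret MN: tensor_algebras K M N ..
  interpret NP: tensor_algebras K N P ..
  interpret L: tensor_algebras K "tensor_product K M N" P ..
  interpret R: tensor_algebras K M "tensor_product K N P" ..
  note lin = linear_map_comp[OF assoc_linear[OF M.module N.module P.module]]
    L.pure_linear MN.T.mult_linear R.T.mult_linear linear_map_id
  note closed = linear_map_closed[OF assoc_linear[OF M.module N.module P.module]]
  note pure = assoc_pure[OF M.module N.module P.module]
  show ?thesis
  proof (rule L.algebra_hom_tensorI)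
    fix s c s' c' assume s: "s \<in> carrier MN.T" and c: "c \<in> carrier P"
      and s': "s' \<in> carrier MN.T" and c': "c' \<in> carrier P"
    show "tensor_assoc K M N P (L.pure (s \<otimes>\<^bsub>MN.T\<^esub> s') (c \<otimes>\<^bsub>P\<^esub> c')) =
      tensor_assoc K M N P (L.pure s c) \<otimes>\<^bsub>R.T\<^esub> tensor_assoc K M N P (L.pure s' c')"
    proof (rule MN.linear_ext[of _ R.T _ s])
      fix a b assume ab: "a \<in> carrier M" "b \<in> carrier N"
      show "tensor_assoc K M N P (L.pure (MN.pure a b \<otimes>\<^bsub>MN.T\<^esub> s') (c \<otimes>\<^bsub>P\<^esub> c')) =
        tensor_assoc K M N P (L.pure (MN.pure a b) c) \<otimes>\<^bsub>R.T\<^esub> tensor_assoc K M N P (L.pure s' c')"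
        by (rule MN.linear_ext[of _ R.T _ s'])
          (insert ab s' c c', auto intro!: lin simp: closed pure R.T.module)
    qed (insert s s' c c', auto intro!: lin simp: closed R.T.module)
  qed (auto simp: MN.one_pure pure R.one_pure NP.one_pure R.k_algebra_T
      intro!: assoc_linear M.module N.module P.module)
qed

subsection \<open>The maps between tensor powers\<close>

context
  fixes K and M :: "('k, 'a, 'm) module_scheme" and H :: "('k, 'h, 'n) module_scheme"
    and \<rho>
  assumes M: "k_algebra K M" and H: "k_algebra K H"
    and \<rho>: "\<rho> \<in> algebra_hom K M (tensor_product K M H)"
begin

interpretation M: k_algebra K M by (rule M)
interpretation H: k_algebra K H by (rule H)
interpretation MH: tensor_algebras K M H ..
interpretation HH: tensor_algebras K H H ..
interpretation MHH: tensor_algebras K M HH.T ..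
interpretation HHH: tensor_algebras K H HH.T ..
interpretation MHHH: tensor_algebras K M HHH.T ..
interpretation MH_H: tensor_algebras K MH.T H ..
interpretation MH_HH: tensor_algebras K MH.T HH.T ..

lemma coact_id_hom: "coact_id K M H \<rho> \<in> algebra_hom K MH.T MHH.T"
  unfolding coact_id_def comp_def
  by (intro algebra_hom_comp[OF MH.map_hom assoc_hom] MH_H.tensor_algebras_axioms M H \<rho> algebra_hom_id)

text \<open>The factor \<open>\<rho> m\<close> is not pure, so evaluation stops at
  \<open>tensor_assoc\<close>. Later arguments continue by replacing \<open>\<rho> m\<close> with an
  arbitrary tensor \<open>r\<close>.\<close>

lemma coact_id_pure:
  assumes "m \<in> carrier M" "h \<in> carrier H"
  shows "coact_id K M H \<rho> (MH.pure m h) = tensor_assoc K M H H (MH_H.pure (\<rho> m) h)"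
  unfolding coact_id_def comp_def
  using assms MH.map_pure[OF MH_H.tensor_modules_axioms algebra_hom_linear[OF \<rho>] linear_map_id]
  by simp

lemma coact_id_id_hom: "coact_id_id K M H \<rho> \<in> algebra_hom K MHH.T MHHH.T"
  unfolding coact_id_id_def comp_def
  by (intro algebra_hom_comp[OF MHH.map_hom assoc_hom] MH_HH.tensor_algebras_axioms M H
      HH.k_algebra_T \<rho> algebra_hom_id)

lemma coact_id_id_pure:
  assumes "m \<in> carrier M" "z \<in> carrier HH.T"
  shows "coact_id_id K M H \<rho> (MHH.pure m z) = tensor_assoc K M H HH.T (MH_HH.pure (\<rho> m) z)"
  unfolding coact_id_id_def comp_def
  using assms MHH.map_pure[OF MH_HH.tensor_modules_axioms algebra_hom_linear[OF \<rho>] linear_map_id]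
  by simp

end

context
  fixes K and M :: "('k, 'a, 'm) module_scheme" and H :: "('k, 'h, 'n) module_scheme"
    and \<Delta>
  assumes M: "k_algebra K M" and H: "k_algebra K H"
    and \<Delta>: "\<Delta> \<in> algebra_hom K H (tensor_product K H H)"
begin

interpretation M: k_algebra K M by (rule M)
interpretation H: k_algebra K H by (rule H)
interpretation MH: tensor_algebras K M H ..
interpretation HH: tensor_algebras K H H ..
interpretation MHH: tensor_algebras K M HH.T ..
interpretation HHH: tensor_algebras K H HH.T ..
interpretation MHHH: tensor_algebras K M HHH.T ..

lemma id_comult_hom: "id_comult K M H \<Delta> \<in> algebra_hom K MH.T MHH.T"
  unfolding id_comult_def
  by (intro MH.map_hom MHH.tensor_algebras_axioms \<Delta> algebra_hom_id)

lemma id_comult_pure: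
  assumes "m \<in> carrier M" "h \<in> carrier H"
  shows "id_comult K M H \<Delta> (MH.pure m h) = MHH.pure m (\<Delta> h)"
  unfolding id_comult_def
  by (intro MH.map_pure MHH.tensor_modules_axioms algebra_hom_linear[OF \<Delta>] linear_map_id assms)

end

context
  fixes K and M :: "('k, 'a, 'm) module_scheme" and H :: "('k, 'h, 'n) module_scheme"
    and \<Delta>
  assumes M: "k_algebra K M" and H: "k_algebra K H"
    and \<Delta>: "\<Delta> \<in> algebra_hom K H (tensor_product K H H)"
begin

interpretation M: k_algebra K M by (rule M)
interpretation H: k_algebra K H by (rule H)
interpretation HH: tensor_algebras K H H ..
interpretation MHH: tensor_algebras K M HH.T ..
interpretation HHH: tensor_algebras K H HH.T ..
interpretation MHHH: tensor_algebras K M HHH.T ..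

lemma id_comult_id_hom: "id_comult_id K M H \<Delta> \<in> algebra_hom K MHH.T MHHH.T"
  unfolding id_comult_id_def
  by (intro MHH.map_hom MHHH.tensor_algebras_axioms coact_id_hom H \<Delta> algebra_hom_id)

lemma id_comult_id_pure:
  assumes "m \<in> carrier M" "z \<in> carrier HH.T"
  shows "id_comult_id K M H \<Delta> (MHH.pure m z) = MHHH.pure m (coact_id K H H \<Delta> z)"
  unfolding id_comult_id_def
  by (intro MHH.map_pure MHHH.tensor_modules_axioms algebra_hom_linear coact_id_hom H \<Delta>
      algebra_hom_id assms)

lemma id_id_comult_hom: "id_id_comult K M H \<Delta> \<in> algebra_hom K MHH.T MHHH.T"
  unfolding id_id_comult_def
  by (intro MHH.map_hom MHHH.tensor_algebras_axioms id_comult_hom H \<Delta> algebra_hom_id)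

lemma id_id_comult_pure:
  assumes "m \<in> carrier M" "z \<in> carrier HH.T"
  shows "id_id_comult K M H \<Delta> (MHH.pure m z) = MHHH.pure m (id_comult K H H \<Delta> z)"
  unfolding id_id_comult_def
  by (intro MHH.map_pure MHHH.tensor_modules_axioms algebra_hom_linear id_comult_hom H \<Delta>
      algebra_hom_id assms)

end

context
  fixes K and M :: "('k, 'a, 'm) module_scheme" and H :: "('k, 'h, 'n) module_scheme"
  assumes M: "k_algebra K M" and H: "k_algebra K H"
begin

interpretation M: k_algebra K M by (rule M)
interpretation H: k_algebra K H by (rule H)
interpretation HH: tensor_algebras K H H ..
interpretation MHH: tensor_algebras K M HH.T ..
interpretation HHH: tensor_algebras K H HH.T ..
interpretation MHHH: tensor_algebras K M HHH.T ..

lemma tensor_one_hom: "tensor_one K M H \<in> algebra_hom K MHH.T MHHH.T"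
  unfolding tensor_one_def
  by (intro MHH.map_hom HH.map_hom MHHH.tensor_algebras_axioms HHH.tensor_algebras_axioms
      HH.pure_left_hom algebra_hom_id)

lemma tensor_one_pure:
  assumes "m \<in> carrier M" "h \<in> carrier H" "k \<in> carrier H"
  shows "tensor_one K M H (MHH.pure m (HH.pure h k)) = MHHH.pure m (HHH.pure h (HH.pure k \<one>\<^bsub>H\<^esub>))"
proof -
  note inner = HH.map_hom[OF HHH.tensor_algebras_axioms algebra_hom_id HH.pure_left_hom]
  show ?thesis
    unfolding tensor_one_def
    using assms MHH.map_pure[OF MHHH.tensor_modules_axioms linear_map_id algebra_hom_linear[OF inner]]
      HH.map_pure[OF HHH.tensor_modules_axioms linear_map_id algebra_hom_linear[OF HH.pure_left_hom]]
    by simp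
qed

end

section \<open>Quasi-bialgebras\<close>

named_theorems scal "moving scalars outwards"

context k_algebra
begin

lemmas [lin] = mult_linear
lemmas [scal] = smult_mult_left smult_mult_right smult_assoc1[symmetric]

end

context module
begin

lemmas [lin] = smult_linear

end

context tensor_modules
begin

lemmas [lin] = pure_linear
lemmas [scal] = smult_pure[symmetric]

end

context quasi_bialgebra
begin

sublocale HH: tensor_algebras K H H ..
sublocale HHH: tensor_algebras K H HH.T ..
sublocale HHHH: tensor_algebras K H HHH.T ..
sublocale HH_H: tensor_algebras K HH.T H ..
sublocale HH_HH: tensor_algebras K HH.T HH.T ..

lemma counit_closed [simp]: "h \<in> carrier H \<Longrightarrow> \<epsilon> h \<in> carrier K"
  and counit_add: "\<lbrakk>h \<in> carrier H; k \<in> carrier H\<rbrakk> \<Longrightarrow> \<epsilon> (h \<oplus>\<^bsub>H\<^esub> k) = \<epsilon> h \<oplus> \<epsilon> k"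
  and counit_mult [simp]: "\<lbrakk>h \<in> carrier H; k \<in> carrier H\<rbrakk> \<Longrightarrow> \<epsilon> (h \<otimes>\<^bsub>H\<^esub> k) = \<epsilon> h \<otimes> \<epsilon> k"
  and counit_one [simp]: "\<epsilon> \<one>\<^bsub>H\<^esub> = \<one>"
  using counit_hom by (auto simp: ring_hom_def)

lemma counit_linear:
  assumes "module K N" "a \<in> carrier N" "(\<lambda>x. h x) \<in> linear_maps K M H"
  shows "(\<lambda>x. \<epsilon> (h x) \<odot>\<^bsub>N\<^esub> a) \<in> linear_maps K M N"
proof -
  interpret N: module K N by fact
  show ?thesis
    using assms(2)
    by (intro N.smult_linear')
      (auto simp: counit_add counit_smult linear_map_closed[OF assms(3)]
        linear_map_add[OF assms(3)] linear_map_smult[OF assms(3)])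
qed

lemma counit_right_bilinear:
  assumes "module K M" shows "bilinear_map K M H M (\<lambda>a h. \<epsilon> h \<odot>\<^bsub>M\<^esub> a)"
proof -
  interpret M: module K M by fact
  show ?thesis by (intro bilinear_mapI M.smult_linear counit_linear linear_map_id assms) auto
qed

lemma counit_left_bilinear:
  assumes "module K M" shows "bilinear_map K H M M (\<lambda>h a. \<epsilon> h \<odot>\<^bsub>M\<^esub> a)"
proof -
  interpret M: module K M by fact
  show ?thesis by (intro bilinear_mapI M.smult_linear counit_linear linear_map_id assms) auto
qed

lemma counit_right_pure:
  assumes "module K M" "a \<in> carrier M" "h \<in> carrier H"
  shows "Defs.counit_right M \<epsilon> (pure_tensor K M H a h) = \<epsilon> h \<odot>\<^bsub>M\<^esub> a"
proof -
  interpret MH: tensor_modules K M H by (intro tensor_modulesI assms module)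
  show ?thesis
    unfolding Defs.counit_right_def by (intro MH.lift_pure counit_right_bilinear assms)
qed

lemma counit_left_pure:
  assumes "module K M" "a \<in> carrier M" "h \<in> carrier H"
  shows "Defs.counit_left M \<epsilon> (pure_tensor K H M h a) = \<epsilon> h \<odot>\<^bsub>M\<^esub> a"
proof -
  interpret HM: tensor_modules K H M by (intro tensor_modulesI assms module)
  show ?thesis
    unfolding Defs.counit_left_def by (intro HM.lift_pure counit_left_bilinear assms)
qed

lemma counit_right_hom:
  assumes "k_algebra K M"
  shows "Defs.counit_right M \<epsilon> \<in> algebra_hom K (tensor_product K M H) M"
proof -
  interpret M: k_algebra K M by fact
  interpret MH: tensor_algebras K M H ..
  show ?thesis
  proof (rule MH.algebra_hom_tensorI)
    show "Defs.counit_right M \<epsilon> \<in> linear_maps K MH.T M"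
      unfolding Defs.counit_right_def by (intro MH.lift_linear M.module counit_right_bilinear)
  qed (auto simp: counit_right_pure M.module scal M.k_algebra m_comm)
qed

lemma counit_left_hom:
  assumes "k_algebra K M"
  shows "Defs.counit_left M \<epsilon> \<in> algebra_hom K (tensor_product K H M) M"
proof -
  interpret M: k_algebra K M by fact
  interpret HM: tensor_algebras K H M ..
  show ?thesis
  proof (rule HM.algebra_hom_tensorI)
    show "Defs.counit_left M \<epsilon> \<in> linear_maps K HM.T M"
      unfolding Defs.counit_left_def by (intro HM.lift_linear M.module counit_left_bilinear)
  qed (auto simp: counit_left_pure M.module scal M.k_algebra m_comm)
qed

abbreviation "\<Phi>' \<equiv> inv\<^bsub>HHH.T\<^esub> \<Phi>"

lemma reassociator_closed [simp]: "\<Phi> \<in> carrier HHH.T" "\<Phi>' \<in> carrier HHH.T"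
  using reassociator_unit by auto

lemma comult_linear: "\<Delta> \<in> linear_maps K H HH.T"
  using comult_hom by (rule algebra_hom_linear)

lemmas comult_closed [simp] = linear_map_closed[OF comult_linear]
lemmas [lin] = linear_map_comp[OF comult_linear]
lemmas [lin] = counit_linear[OF module] counit_linear[OF HH.module_T] counit_linear[OF HHH.module_T]

lemma counit_right_comult [simp]: "h \<in> carrier H \<Longrightarrow> Defs.counit_right H \<epsilon> (\<Delta> h) = h"
  and counit_left_comult [simp]: "h \<in> carrier H \<Longrightarrow> Defs.counit_left H \<epsilon> (\<Delta> h) = h"
  by (fact counit_right counit_left)+

lemmas H_counit_hom = counit_left_hom[OF k_algebra] counit_left_hom[OF HH.k_algebra_T]
  counit_left_hom[OF HHH.k_algebra_T] counit_right_hom[OF k_algebra]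
lemmas H_hom = H_counit_hom
  coact_id_hom[OF k_algebra k_algebra comult_hom] id_comult_hom[OF k_algebra k_algebra comult_hom]
  coact_id_id_hom[OF k_algebra k_algebra comult_hom] id_comult_id_hom[OF k_algebra k_algebra comult_hom]
  id_id_comult_hom[OF k_algebra k_algebra comult_hom] tensor_one_hom[OF k_algebra k_algebra]
  assoc_hom[OF k_algebra k_algebra k_algebra] assoc_hom[OF k_algebra k_algebra HH.k_algebra_T]
  HH.map_hom[OF HH.tensor_algebras_axioms algebra_hom_id]
lemmas H_pure [simp] = counit_left_pure[OF module] counit_left_pure[OF HH.module_T]
  counit_left_pure[OF HHH.module_T] counit_right_pure[OF module]
  coact_id_pure[OF k_algebra k_algebra comult_hom] id_comult_pure[OF k_algebra k_algebra comult_hom]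
  coact_id_id_pure[OF k_algebra k_algebra comult_hom] id_comult_id_pure[OF k_algebra k_algebra comult_hom]
  id_id_comult_pure[OF k_algebra k_algebra comult_hom] tensor_one_pure[OF k_algebra k_algebra]
  assoc_pure[OF module module module] assoc_pure[OF module module HH.module_T]
  HHH.map_pure[OF HH.tensor_modules_axioms linear_map_id algebra_hom_linear[OF H_counit_hom(1)]]
lemmas H_linear = H_hom[THEN algebra_hom_linear]
  HHH.map_linear[OF HH.tensor_modules_axioms linear_map_id algebra_hom_linear[OF H_counit_hom(1)]]
lemmas H_closed [simp] = H_linear[THEN linear_map_closed]
lemmas [lin] = H_linear[THEN linear_map_comp]
lemmas [scal] = H_linear[THEN linear_map_smult] linear_map_smult[OF comult_linear]

lemmas HHH_ext = linear_ext3[OF module module module]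
lemmas [simp] = HH.module_T HHH.module_T HHHH.module_T module

text \<open>The pentagon yields \<open>P \<cdot> P = P\<close> for the invertible element \<open>P = (\<epsilon> \<otimes> id \<otimes> id) \<Phi>\<close>.\<close>

lemma counit_reassociator_left: "Defs.counit_left HH.T \<epsilon> \<Phi> = \<one>\<^bsub>HH.T\<^esub>"
proof -
  let ?c1 = "Defs.counit_left HH.T \<epsilon>" and ?c2 = "\<lambda>t. Defs.counit_left HH.T \<epsilon> (Defs.counit_left HHH.T \<epsilon> t)"
  have hom: "?c2 \<in> algebra_hom K HHHH.T HH.T"
    by (rule algebra_hom_comp[OF H_counit_hom(3,2)])
  let ?m = "tensor_map K H H (\<lambda>x. x) (Defs.counit_left H \<epsilon>)"
  \<comment> \<open>\<open>?c2\<close> is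
    \<open>\<epsilon> \<otimes> \<epsilon> \<otimes> id \<otimes> id\<close>. The counit axioms turn
    the factors \<open>(id \<otimes> \<Delta> \<otimes> id) \<Phi>\<close> and
    \<open>(\<Delta> \<otimes> id \<otimes> id) \<Phi>\<close> into \<open>P\<close>, as happens to
    \<open>1 \<otimes> \<Phi>\<close> directly; the other two become 1, because there the counit
    hits the middle leg of \<open>\<Phi>\<close>.\<close>
  have c1: "?c2 (id_comult_id K H H \<Delta> t) = ?c1 t" if "t \<in> carrier HHH.T" for t
  proof (rule HHH_ext[of HH.T t])
    fix x y z assume xyz: "x \<in> carrier H" "y \<in> carrier H" "z \<in> carrier H"
    have "?c1 (tensor_assoc K H H H (HH_H.pure r z)) = HH.pure (Defs.counit_left H \<epsilon> r) z"
      if "r \<in> carrier HH.T" for r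
      by (rule HH.linear_ext[of _ HH.T _ r])
        (insert that xyz, auto intro!: lin simp: scal)
    from this[of "\<Delta> y"] show "?c2 (id_comult_id K H H \<Delta> (HHH.pure x (HH.pure y z))) =
        ?c1 (HHH.pure x (HH.pure y z))"
      using xyz by (simp add: scal)
  qed (insert that, auto intro!: lin)
  have c2: "?c2 (tensor_one K H H t) = HH.pure (Defs.counit_left H \<epsilon> (?m t)) \<one>\<^bsub>H\<^esub>"
    if "t \<in> carrier HHH.T" for t
    by (rule HHH_ext[of HH.T t]) (insert that, auto intro!: lin simp: scal m_comm)
  have c3: "?c2 (id_id_comult K H H \<Delta> t) = \<Delta> (Defs.counit_left H \<epsilon> (?m t))"
    if "t \<in> carrier HHH.T" for t
    by (rule HHH_ext[of HH.T t]) (insert that, auto intro!: lin simp: scal m_comm)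
  have c4: "?c2 (coact_id_id K H H \<Delta> t) = ?c1 t" if "t \<in> carrier HHH.T" for t
  proof (rule HHH.linear_ext[of _ HH.T _ t])
    fix x z assume xz: "x \<in> carrier H" "z \<in> carrier HH.T"
    have "?c2 (tensor_assoc K H H HH.T (HH_HH.pure r z)) = \<epsilon> (Defs.counit_left H \<epsilon> r) \<odot>\<^bsub>HH.T\<^esub> z"
      if "r \<in> carrier HH.T" for r
      by (rule HH.linear_ext[of _ HH.T _ r])
        (insert that xz, auto intro!: lin simp: scal counit_smult)
    from this[of "\<Delta> x"] show "?c2 (coact_id_id K H H \<Delta> (HHH.pure x z)) = ?c1 (HHH.pure x z)"
      using xz by simp
  qed (insert that, auto intro!: lin)
  let ?P = "?c1 \<Phi>"
  have m: "?m \<Phi> = HH.pure \<one>\<^bsub>H\<^esub> \<one>\<^bsub>H\<^esub>"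
    by (simp add: counit_reassociator HH.one_pure)
  have P: "?P \<in> carrier HH.T" by simp
  have c5: "?c2 (HHHH.pure \<one>\<^bsub>H\<^esub> \<Phi>) = ?P" by simp
  have "?c2 (HHHH.pure \<one>\<^bsub>H\<^esub> \<Phi> \<otimes>\<^bsub>HHHH.T\<^esub> id_comult_id K H H \<Delta> \<Phi> \<otimes>\<^bsub>HHHH.T\<^esub> tensor_one K H H \<Phi>)
      = ?P \<otimes>\<^bsub>HH.T\<^esub> ?P"
    using P by (simp add: algebra_hom_mult[OF hom] c1 c2 c5 m HH.one_pure[symmetric] 
        algebra_hom_one[OF H_counit_hom(1)] del: H_pure)
  moreover have "?c2 (id_id_comult K H H \<Delta> \<Phi> \<otimes>\<^bsub>HHHH.T\<^esub> coact_id_id K H H \<Delta> \<Phi>) = ?P"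
    using P by (simp add: algebra_hom_mult[OF hom] c3 c4 m HH.one_pure[symmetric] algebra_hom_one[OF comult_hom] 
        algebra_hom_one[OF H_counit_hom(1)] del: H_pure)
  ultimately have PP: "?P \<otimes>\<^bsub>HH.T\<^esub> ?P = ?P" using pentagon by simp
  have "\<one>\<^bsub>HH.T\<^esub> = ?c1 (\<Phi>' \<otimes>\<^bsub>HHH.T\<^esub> \<Phi>)"
    using reassociator_unit algebra_hom_one[OF H_counit_hom(2)] by simp
  also have "\<dots> = ?c1 \<Phi>' \<otimes>\<^bsub>HH.T\<^esub> ?P" by (simp add: algebra_hom_mult[OF H_counit_hom(2)])
  finally have "?c1 \<Phi>' \<otimes>\<^bsub>HH.T\<^esub> ?P = \<one>\<^bsub>HH.T\<^esub>" by simp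
  then show ?thesis using PP P
    by (metis HH.T.l_one HH.T.m_assoc H_closed(2) reassociator_closed(2))
qed

end

section \<open>Comodule algebras\<close>

context right_comodule_algebra
begin

sublocale BH: tensor_algebras K B H ..
sublocale BHH: tensor_algebras K B HH.T ..
sublocale BHHH: tensor_algebras K B HHH.T ..
sublocale BH_H: tensor_algebras K BH.T H ..
sublocale BH_HH: tensor_algebras K BH.T HH.T ..

abbreviation "\<Phi>\<^sub>\<rho>' \<equiv> inv\<^bsub>BHH.T\<^esub> \<Phi>\<^sub>\<rho>"

lemma coassociator_closed [simp]: "\<Phi>\<^sub>\<rho> \<in> carrier BHH.T" "\<Phi>\<^sub>\<rho>' \<in> carrier BHH.T"
  and coassociator_inverse [simp]: "\<Phi>\<^sub>\<rho> \<otimes>\<^bsub>BHH.T\<^esub> \<Phi>\<^sub>\<rho>' = \<one>\<^bsub>BHH.T\<^esub>" "\<Phi>\<^sub>\<rho>' \<otimes>\<^bsub>BHH.T\<^esub> \<Phi>\<^sub>\<rho> = \<one>\<^bsub>BHH.T\<^esub>"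
  using coassociator_unit by auto

abbreviation "emb_one \<equiv> tensor_map K B HH.T (\<lambda>x. x) (\<lambda>h. HH.pure h \<one>\<^bsub>H\<^esub>)"
abbreviation "counit_mid \<equiv> tensor_map K B H (\<lambda>x. x) (Defs.counit_left H \<epsilon>)"
abbreviation "counit_last \<equiv> tensor_map K B H (\<lambda>x. x) (Defs.counit_right H \<epsilon>)"

lemmas B_hom = coaction_hom counit_right_hom[OF B.k_algebra]
  coact_id_hom[OF B.k_algebra k_algebra coaction_hom] id_comult_hom[OF B.k_algebra k_algebra comult_hom]
  coact_id_id_hom[OF B.k_algebra k_algebra coaction_hom]
  id_comult_id_hom[OF B.k_algebra k_algebra comult_hom]
  id_id_comult_hom[OF B.k_algebra k_algebra comult_hom] tensor_one_hom[OF B.k_algebra k_algebra]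
  assoc_hom[OF B.k_algebra k_algebra k_algebra] assoc_hom[OF B.k_algebra k_algebra HH.k_algebra_T]
  BH.map_hom[OF BHH.tensor_algebras_axioms algebra_hom_id HH.pure_left_hom]
  BHH.map_hom[OF BH.tensor_algebras_axioms algebra_hom_id counit_left_hom[OF k_algebra]]
  BHH.map_hom[OF BH.tensor_algebras_axioms algebra_hom_id counit_right_hom[OF k_algebra]]
lemmas B_linear = B_hom[THEN algebra_hom_linear]
lemmas B_pure [simp] = counit_right_pure[OF B.module]
  coact_id_pure[OF B.k_algebra k_algebra coaction_hom] id_comult_pure[OF B.k_algebra k_algebra comult_hom]
  coact_id_id_pure[OF B.k_algebra k_algebra coaction_hom]
  id_comult_id_pure[OF B.k_algebra k_algebra comult_hom]
  id_id_comult_pure[OF B.k_algebra k_algebra comult_hom] tensor_one_pure[OF B.k_algebra k_algebra]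
  assoc_pure[OF B.module module module] assoc_pure[OF B.module module HH.module_T]
  BH.map_pure[OF BHH.tensor_modules_axioms linear_map_id algebra_hom_linear[OF HH.pure_left_hom]]
  BHH.map_pure[OF BH.tensor_modules_axioms linear_map_id algebra_hom_linear[OF counit_left_hom[OF k_algebra]]]
  BHH.map_pure[OF BH.tensor_modules_axioms linear_map_id algebra_hom_linear[OF counit_right_hom[OF k_algebra]]]
lemmas B_closed [simp] = B_linear[THEN linear_map_closed]
lemmas [lin] = B_linear[THEN linear_map_comp]
lemmas [scal] = B_linear[THEN linear_map_smult]
lemmas B_mult = B_hom[THEN algebra_hom_mult]
lemmas B_one = B_hom[THEN algebra_hom_one]
lemmas [simp] = B.module BH.module_T BHH.module_T BHHH.module_T
lemmas [lin] = counit_linear[OF B.module] counit_linear[OF BH.module_T]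
lemmas BHH_ext = linear_ext3[OF B.module module module]
lemmas BHHH_ext = linear_ext4[OF B.module module module module]

lemma counit_coaction [simp]: "b \<in> carrier B \<Longrightarrow> Defs.counit_right B \<epsilon> (\<rho> b) = b"
  by (rule coaction_counit)

text \<open>An algebra map fixing the unit sends the inverse of an element with image 1 to 1. The
  inverse appears once the pentagon is solved for
  \<open>(\<rho> \<otimes> id \<otimes> id) \<Phi>\<^sub>\<rho>\<close>.\<close>

lemma counit_inverse_coassociator_right: "counit_last \<Phi>\<^sub>\<rho>' = \<one>\<^bsub>BH.T\<^esub>"
proof -
  have "\<one>\<^bsub>BH.T\<^esub> = counit_last (\<Phi>\<^sub>\<rho>' \<otimes>\<^bsub>BHH.T\<^esub> \<Phi>\<^sub>\<rho>)" using B_one(13) by simp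
  also have "\<dots> = counit_last \<Phi>\<^sub>\<rho>'" by (simp add: B_mult(13) counit_coassociator_right del: coassociator_inverse)
  finally show ?thesis ..
qed

lemma coaction_conjugate:
  assumes "b \<in> carrier B"
  shows "coact_id K B H \<rho> (\<rho> b) = \<Phi>\<^sub>\<rho>' \<otimes>\<^bsub>BHH.T\<^esub> (id_comult K B H \<Delta> (\<rho> b) \<otimes>\<^bsub>BHH.T\<^esub> \<Phi>\<^sub>\<rho>)"
  using assms
  by (simp add: coaction_coassoc[symmetric] BHH.T.m_assoc[symmetric])

text \<open>\<open>h\<close> sits alone in the third leg and commutes with
  \<open>r' \<otimes> 1\<close>. Pulled out to the right, it can leave the contraction that defines
  \<open>E\<close>.\<close>

lemma assoc_pure_emb:
  assumes "r \<in> carrier BH.T" "r' \<in> carrier BH.T" "h \<in> carrier H"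
  shows "tensor_assoc K B H H (BH_H.pure r h) \<otimes>\<^bsub>BHH.T\<^esub> emb_one r' =
    emb_one (r \<otimes>\<^bsub>BH.T\<^esub> r') \<otimes>\<^bsub>BHH.T\<^esub> BHH.pure \<one>\<^bsub>B\<^esub> (HH.pure \<one>\<^bsub>H\<^esub> h)"
proof (rule BH.linear_ext[of _ BHH.T _ r])
  fix b u assume bu: "b \<in> carrier B" "u \<in> carrier H"
  show "tensor_assoc K B H H (BH_H.pure (BH.pure b u) h) \<otimes>\<^bsub>BHH.T\<^esub> emb_one r' =
    emb_one (BH.pure b u \<otimes>\<^bsub>BH.T\<^esub> r') \<otimes>\<^bsub>BHH.T\<^esub> BHH.pure \<one>\<^bsub>B\<^esub> (HH.pure \<one>\<^bsub>H\<^esub> h)"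
    by (rule BH.linear_ext[of _ BHH.T _ r']) (insert bu assms, auto intro!: lin)
qed (insert assms, auto intro!: lin)

text \<open>Applying \<open>\<rho> \<otimes> id \<otimes> id\<close> to
  \<open>\<Phi>\<^sub>\<rho> (\<rho>(m) \<otimes> 1)\<close> thus produces
  \<open>(\<rho> \<otimes> id)(\<rho>(m)) \<otimes> 1\<close>, to which quasi-coassociativity
  applies.\<close>

lemma coact_id_id_emb:
  assumes "s \<in> carrier BH.T"
  shows "coact_id_id K B H \<rho> (emb_one s) = tensor_one K B H (coact_id K B H \<rho> s)"
proof (rule BH.linear_ext[of _ BHHH.T _ s])
  fix c h assume ch: "c \<in> carrier B" "h \<in> carrier H"
  have "tensor_assoc K B H HH.T (BH_HH.pure r (HH.pure h \<one>\<^bsub>H\<^esub>)) =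
    tensor_one K B H (tensor_assoc K B H H (BH_H.pure r h))" if "r \<in> carrier BH.T" for r
    by (rule BH.linear_ext[of _ BHHH.T _ r]) (insert ch that, auto intro!: lin)
  then show "coact_id_id K B H \<rho> (emb_one (BH.pure c h)) =
    tensor_one K B H (coact_id K B H \<rho> (BH.pure c h))"
    using ch by simp
qed (insert assms, auto intro!: lin)

end

section \<open>The projection onto the coinvariants\<close>

locale quasi_hopf_comodule_algebra =
  quasi_hopf_algebra K H \<Delta> \<epsilon> \<Phi> S \<alpha> \<beta> + right_comodule_algebra K H \<Delta> \<epsilon> \<Phi> B \<rho> \<Phi>\<^sub>\<rho>
  for K :: "'k ring" (structure) and H :: "('k, 'h) module" (structure) and \<Delta> \<epsilon> \<Phi> S \<alpha> \<beta>
    and B :: "('k, 'b) module" (structure) and \<rho> \<Phi>\<^sub>\<rho> +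
  fixes v :: "'h \<Rightarrow> 'b"
  assumes v_morphism: "comodule_algebra_morphism K H H \<Delta> \<Phi> B \<rho> \<Phi>\<^sub>\<rho> v"
begin

abbreviation "v1 \<equiv> tensor_map K B H v (\<lambda>x. x)"
abbreviation "v2 \<equiv> tensor_map K B HH.T v (\<lambda>x. x)"

lemma v_hom: "v \<in> algebra_hom K H B"
  and coaction_v: "h \<in> carrier H \<Longrightarrow> \<rho> (v h) = v1 (\<Delta> h)"
  and coassociator_v: "\<Phi>\<^sub>\<rho> = v2 \<Phi>"
  using v_morphism by (auto simp: comodule_algebra_morphism_def)

lemmas v_homs = v_hom HH.map_hom[OF BH.tensor_algebras_axioms v_hom algebra_hom_id]
  HHH.map_hom[OF BHH.tensor_algebras_axioms v_hom algebra_hom_id]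
lemmas v_linear = v_homs[THEN algebra_hom_linear]
lemmas v_closed [simp] = v_linear[THEN linear_map_closed]
lemmas v_pure [simp] =
  HH.map_pure[OF BH.tensor_modules_axioms algebra_hom_linear[OF v_hom] linear_map_id]
  HHH.map_pure[OF BHH.tensor_modules_axioms algebra_hom_linear[OF v_hom] linear_map_id]
lemmas v_mult = v_homs[THEN algebra_hom_mult]
lemmas v_one [simp] = v_homs[THEN algebra_hom_one]
lemmas [lin] = v_linear[THEN linear_map_comp]
lemmas [scal] = v_linear[THEN linear_map_smult]

lemmas S_closed [simp] = linear_map_closed[OF antipode_linear]
lemmas [lin] = linear_map_comp[OF antipode_linear]
lemmas [scal] = linear_map_smult[OF antipode_linear]
lemmas [simp] = alpha_closed beta_closed

text \<open>\<open>v \<otimes> id \<otimes> id\<close> is an algebra map and preserves inverses. So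
  the legs \<open>x1\<close>, \<open>x2\<close>, \<open>x3\<close> of \<open>\<Phi>'\<close>, which
  occur in the smash product, can stand for those of \<open>\<Phi>\<^sub>\<rho>'\<close>.\<close>

lemma inverse_coassociator_v: "\<Phi>\<^sub>\<rho>' = v2 \<Phi>'"
proof (rule BHH.T.inv_char)
  show "\<Phi>\<^sub>\<rho> \<otimes>\<^bsub>BHH.T\<^esub> v2 \<Phi>' = \<one>\<^bsub>BHH.T\<^esub>" "v2 \<Phi>' \<otimes>\<^bsub>BHH.T\<^esub> \<Phi>\<^sub>\<rho> = \<one>\<^bsub>BHH.T\<^esub>"
    using reassociator_unit by (simp_all add: coassociator_v v_mult(3)[symmetric])
qed auto

section \<open>Contractions built from the antipode axioms\<close>

definition "ev = tensor_lift H (\<lambda>u w. S u \<otimes>\<^bsub>H\<^esub> \<alpha> \<otimes>\<^bsub>H\<^esub> w)"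
definition "coev = tensor_lift H (\<lambda>u w. u \<otimes>\<^bsub>H\<^esub> \<beta> \<otimes>\<^bsub>H\<^esub> S w)"

lemma ev_bilinear: "bilinear_map K H H H (\<lambda>u w. S u \<otimes>\<^bsub>H\<^esub> \<alpha> \<otimes>\<^bsub>H\<^esub> w)"
  and coev_bilinear: "bilinear_map K H H H (\<lambda>u w. u \<otimes>\<^bsub>H\<^esub> \<beta> \<otimes>\<^bsub>H\<^esub> S w)"
  by (auto intro!: bilinear_mapI lin)

lemma ev_linear: "ev \<in> linear_maps K HH.T H" and coev_linear: "coev \<in> linear_maps K HH.T H"
  unfolding ev_def coev_def by (intro HH.lift_linear ev_bilinear coev_bilinear module)+

lemma ev_pure [simp]:
    "\<lbrakk>u \<in> carrier H; w \<in> carrier H\<rbrakk> \<Longrightarrow> ev (HH.pure u w) = S u \<otimes>\<^bsub>H\<^esub> \<alpha> \<otimes>\<^bsub>H\<^esub> w"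
  and coev_pure [simp]:
    "\<lbrakk>u \<in> carrier H; w \<in> carrier H\<rbrakk> \<Longrightarrow> coev (HH.pure u w) = u \<otimes>\<^bsub>H\<^esub> \<beta> \<otimes>\<^bsub>H\<^esub> S w"
  unfolding ev_def coev_def by (intro HH.lift_pure ev_bilinear coev_bilinear module; assumption)+

text \<open>These are the two antipode axioms; all cancellations of coproducts around
  \<open>\<alpha>\<close> and \<open>\<beta>\<close> go through them.\<close>

lemma ev_comult [simp]: "h \<in> carrier H \<Longrightarrow> ev (\<Delta> h) = \<epsilon> h \<odot>\<^bsub>H\<^esub> \<alpha>"
  and coev_comult [simp]: "h \<in> carrier H \<Longrightarrow> coev (\<Delta> h) = \<epsilon> h \<odot>\<^bsub>H\<^esub> \<beta>"
  unfolding ev_def coev_def by (fact antipode_alpha antipode_beta)+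

lemmas ev_closed [simp] = linear_map_closed[OF ev_linear] linear_map_closed[OF coev_linear]
lemmas [lin] = linear_map_comp[OF ev_linear] linear_map_comp[OF coev_linear]
lemmas [scal] = linear_map_smult[OF ev_linear] linear_map_smult[OF coev_linear]

lemmas H_simps = m_assoc antipode_mult antipode_one v_mult B.m_assoc

text \<open>\<open>S\<close> reverses products, so
  \<open>S(h1 u) \<alpha> h2 w = S(u) (S(h1) \<alpha> h2) w\<close>: the coproduct encloses
  \<open>\<alpha>\<close>.\<close>

lemma ev_comult_mult:
  assumes "h \<in> carrier H" "z \<in> carrier HH.T"
  shows "ev (\<Delta> h \<otimes>\<^bsub>HH.T\<^esub> z) = \<epsilon> h \<odot>\<^bsub>H\<^esub> ev z"
proof (rule HH.linear_ext[of _ H _ z])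
  fix u w assume uw: "u \<in> carrier H" "w \<in> carrier H"
  have "ev (y \<otimes>\<^bsub>HH.T\<^esub> HH.pure u w) = S u \<otimes>\<^bsub>H\<^esub> ev y \<otimes>\<^bsub>H\<^esub> w" if "y \<in> carrier HH.T" for y
    by (rule HH.linear_ext[of _ H _ y]) (insert that uw, auto intro!: lin simp: H_simps)
  from this[of "\<Delta> h"] show "ev (\<Delta> h \<otimes>\<^bsub>HH.T\<^esub> HH.pure u w) = \<epsilon> h \<odot>\<^bsub>H\<^esub> ev (HH.pure u w)"
    using uw assms by (simp add: scal)
qed (insert assms, auto intro!: lin)

definition "contract = tensor_lift H (\<lambda>x z. x \<otimes>\<^bsub>H\<^esub> \<beta> \<otimes>\<^bsub>H\<^esub> ev z)"

lemma contract_bilinear: "bilinear_map K H HH.T H (\<lambda>x z. x \<otimes>\<^bsub>H\<^esub> \<beta> \<otimes>\<^bsub>H\<^esub> ev z)"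
  by (auto intro!: bilinear_mapI lin)

lemma contract_linear: "contract \<in> linear_maps K HHH.T H"
  unfolding contract_def by (intro HHH.lift_linear contract_bilinear module)

lemma contract_pure [simp]:
  "\<lbrakk>x \<in> carrier H; z \<in> carrier HH.T\<rbrakk> \<Longrightarrow> contract (HHH.pure x z) = x \<otimes>\<^bsub>H\<^esub> \<beta> \<otimes>\<^bsub>H\<^esub> ev z"
  unfolding contract_def by (intro HHH.lift_pure contract_bilinear module)

lemmas contract_closed [simp] = linear_map_closed[OF contract_linear]
lemmas [lin] = linear_map_comp[OF contract_linear]
lemmas [scal] = linear_map_smult[OF contract_linear]

lemma contract_reassociator [simp]: "contract \<Phi> = \<one>\<^bsub>H\<^esub>"
proof -
  have "contract \<Phi> = tensor_lift3 H
      (\<lambda>x y z. x \<otimes>\<^bsub>H\<^esub> \<beta> \<otimes>\<^bsub>H\<^esub> S y \<otimes>\<^bsub>H\<^esub> \<alpha> \<otimes>\<^bsub>H\<^esub> z) \<Phi>"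
    by (rule linear_map_expand3[OF module module module module _ contract_linear])
      (auto simp: H_simps)
  then show ?thesis by (simp add: antipode_reassociator)
qed

definition "contractB = tensor_lift B (\<lambda>b z. b \<otimes>\<^bsub>B\<^esub> v (\<beta> \<otimes>\<^bsub>H\<^esub> ev z))"

lemma contractB_bilinear: "bilinear_map K B HH.T B (\<lambda>b z. b \<otimes>\<^bsub>B\<^esub> v (\<beta> \<otimes>\<^bsub>H\<^esub> ev z))"
  by (auto intro!: bilinear_mapI lin)

lemma contractB_linear: "contractB \<in> linear_maps K BHH.T B"
  unfolding contractB_def by (intro BHH.lift_linear contractB_bilinear B.module)

lemma contractB_pure [simp]:
  "\<lbrakk>b \<in> carrier B; z \<in> carrier HH.T\<rbrakk> \<Longrightarrow> contractB (BHH.pure b z) = b \<otimes>\<^bsub>B\<^esub> v (\<beta> \<otimes>\<^bsub>H\<^esub> ev z)"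
  unfolding contractB_def by (intro BHH.lift_pure contractB_bilinear B.module)

lemmas contractB_closed [simp] = linear_map_closed[OF contractB_linear]
lemmas [lin] = linear_map_comp[OF contractB_linear]
lemmas [scal] = linear_map_smult[OF contractB_linear]

text \<open>Multiplied from the left, the coproduct in legs two and three encloses
  \<open>\<alpha>\<close> and leaves its counit, while the first leg of \<open>s\<close> stays in
  front.\<close>

lemma contractB_id_comult:
  assumes "s \<in> carrier BH.T" "t \<in> carrier BHH.T"
  shows "contractB (id_comult K B H \<Delta> s \<otimes>\<^bsub>BHH.T\<^esub> t) = Defs.counit_right B \<epsilon> s \<otimes>\<^bsub>B\<^esub> contractB t"
proof (rule BH.linear_ext[of _ B _ s])
  fix c h assume ch: "c \<in> carrier B" "h \<in> carrier H"
  show "contractB (id_comult K B H \<Delta> (BH.pure c h) \<otimes>\<^bsub>BHH.T\<^esub> t) =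
      Defs.counit_right B \<epsilon> (BH.pure c h) \<otimes>\<^bsub>B\<^esub> contractB t"
    by (rule BHH.linear_ext[of _ B _ t])
      (insert ch assms, auto intro!: lin simp: scal ev_comult_mult H_simps)
qed (insert assms, auto intro!: lin)

text \<open>Multiplied from the right, \<open>h1\<close> and \<open>h2\<close> enclose
  \<open>\<beta>\<close>: \<open>b h1 \<beta> S(u h2) \<alpha> w = b (h1 \<beta> S(h2)) S(u)
  \<alpha> w\<close>.\<close>

lemma contractB_emb_v:
  assumes "t \<in> carrier BHH.T" "h \<in> carrier H"
  shows "contractB (t \<otimes>\<^bsub>BHH.T\<^esub> emb_one (v1 (\<Delta> h))) = \<epsilon> h \<odot>\<^bsub>B\<^esub> contractB t"
proof (rule BHH_ext[of B t])
  fix b u w assume buw: "b \<in> carrier B" "u \<in> carrier H" "w \<in> carrier H"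
  have "contractB (BHH.pure b (HH.pure u w) \<otimes>\<^bsub>BHH.T\<^esub> emb_one (v1 y)) =
      b \<otimes>\<^bsub>B\<^esub> v (coev y \<otimes>\<^bsub>H\<^esub> S u \<otimes>\<^bsub>H\<^esub> \<alpha> \<otimes>\<^bsub>H\<^esub> w)" if "y \<in> carrier HH.T" for y
    by (rule HH.linear_ext[of _ B _ y]) (insert that buw, auto intro!: lin simp: H_simps)
  from this[of "\<Delta> h"] show "contractB (BHH.pure b (HH.pure u w) \<otimes>\<^bsub>BHH.T\<^esub> emb_one (v1 (\<Delta> h))) =
      \<epsilon> h \<odot>\<^bsub>B\<^esub> contractB (BHH.pure b (HH.pure u w))"
    using buw assms by (simp add: scal H_simps)
qed (insert assms, auto intro!: lin B.smult_linear)

text \<open>In \<open>b \<beta> S(u) \<alpha> w\<close> the third leg stands last, so a right factor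
  there simply passes through.\<close>

lemma contractB_mult_right:
  assumes "t \<in> carrier BHH.T" "h \<in> carrier H"
  shows "contractB (t \<otimes>\<^bsub>BHH.T\<^esub> BHH.pure \<one>\<^bsub>B\<^esub> (HH.pure \<one>\<^bsub>H\<^esub> h)) = contractB t \<otimes>\<^bsub>B\<^esub> v h"
  by (rule BHH_ext[of B t]) (insert assms, auto intro!: lin simp: H_simps)

section \<open>The projection \<open>E\<close> and what it absorbs\<close>

definition "E m = contractB (\<Phi>\<^sub>\<rho> \<otimes>\<^bsub>BHH.T\<^esub> emb_one (\<rho> m))"

lemma E_linear: "E \<in> linear_maps K B B"
  unfolding E_def by (auto intro!: lin)

lemmas E_closed [simp] = linear_map_closed[OF E_linear]
lemmas [lin] = linear_map_comp[OF E_linear]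
lemmas [scal] = linear_map_smult[OF E_linear]

text \<open>As \<open>v\<close> respects the coactions, \<open>\<rho>(m v(h))\<close> ends in
  \<open>v(h1) \<otimes> h2\<close>, and these two legs enclose \<open>\<beta>\<close> in the
  contraction.\<close>

lemma E_mult_v [simp]:
  assumes "m \<in> carrier B" "h \<in> carrier H"
  shows "E (m \<otimes>\<^bsub>B\<^esub> v h) = \<epsilon> h \<odot>\<^bsub>B\<^esub> E m"
  using assms
  by (simp add: E_def B_mult coaction_v BHH.T.m_assoc[symmetric] contractB_emb_v)

text \<open>Because \<open>\<Phi>\<^sub>\<rho>\<close> comes from \<open>\<Phi>\<close> through
  \<open>v\<close>, its contraction is \<open>v(X1 \<beta> S(X2) \<alpha> X3)\<close>, which an
  antipode axiom evaluates.\<close>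

lemma E_one [simp]: "E \<one>\<^bsub>B\<^esub> = \<one>\<^bsub>B\<^esub>"
proof -
  have "contractB (v2 t) = v (contract t)" if "t \<in> carrier HHH.T" for t
    by (rule HHH.linear_ext[of _ B _ t]) (insert that, auto intro!: lin simp: H_simps)
  from this[of \<Phi>] show ?thesis by (simp add: E_def B_one flip: coassociator_v)
qed

text \<open>A left inverse of \<open>\<rho>\<close>, by \<open>recompose_coaction_one\<close>; it
  will decompose elements of \<open>B\<close> into coinvariants and elements of
  \<open>H\<close>.\<close>

definition "recompose = tensor_lift B (\<lambda>c h. E c \<otimes>\<^bsub>B\<^esub> v h)"

lemma recompose_bilinear: "bilinear_map K B H B (\<lambda>c h. E c \<otimes>\<^bsub>B\<^esub> v h)"
  by (auto intro!: bilinear_mapI lin)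

lemma recompose_linear: "recompose \<in> linear_maps K BH.T B"
  unfolding recompose_def by (intro BH.lift_linear recompose_bilinear B.module)

lemma recompose_pure [simp]:
  "\<lbrakk>b \<in> carrier B; h \<in> carrier H\<rbrakk> \<Longrightarrow> recompose (BH.pure b h) = E b \<otimes>\<^bsub>B\<^esub> v h"
  unfolding recompose_def by (intro BH.lift_pure recompose_bilinear B.module)

lemmas recompose_closed [simp] = linear_map_closed[OF recompose_linear]
lemmas [lin] = linear_map_comp[OF recompose_linear]
lemmas [scal] = linear_map_smult[OF recompose_linear]

text \<open>Quasi-coassociativity moves \<open>\<Phi>\<^sub>\<rho>\<close> past
  \<open>(\<rho> \<otimes> id)(\<rho>(b))\<close>. What then stands in front is
  \<open>(id \<otimes> \<Delta>)(\<rho>(b))\<close>, which the contraction reduces to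
  \<open>b\<close> by the axiom for \<open>\<alpha>\<close> and the counit axiom.\<close>

lemma recompose_coaction:
  assumes "b \<in> carrier B" "m \<in> carrier B"
  shows "recompose (\<rho> b \<otimes>\<^bsub>BH.T\<^esub> BH.pure m \<one>\<^bsub>H\<^esub>) = b \<otimes>\<^bsub>B\<^esub> E m"
proof -
  \<comment> \<open>For \<open>s = c \<otimes> h\<close> the left side is
    \<open>E(c m) v(h)\<close>, and \<open>v(h)\<close> re-enters the contraction as a factor of the
    third leg.\<close>
  have "recompose (s \<otimes>\<^bsub>BH.T\<^esub> BH.pure m \<one>\<^bsub>H\<^esub>) =
      contractB (\<Phi>\<^sub>\<rho> \<otimes>\<^bsub>BHH.T\<^esub> (coact_id K B H \<rho> s \<otimes>\<^bsub>BHH.T\<^esub> emb_one (\<rho> m)))" if "s \<in> carrier BH.T" for s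
  proof (rule BH.linear_ext[of _ B _ s])
    fix c h assume "c \<in> carrier B" "h \<in> carrier H"
    then show "recompose (BH.pure c h \<otimes>\<^bsub>BH.T\<^esub> BH.pure m \<one>\<^bsub>H\<^esub>) =
      contractB (\<Phi>\<^sub>\<rho> \<otimes>\<^bsub>BHH.T\<^esub> (coact_id K B H \<rho> (BH.pure c h) \<otimes>\<^bsub>BHH.T\<^esub> emb_one (\<rho> m)))"
      using assms
      by (simp add: assoc_pure_emb BHH.T.m_assoc[symmetric] contractB_mult_right E_def B_mult)
  qed (insert assms that, auto intro!: lin)
  then have "recompose (\<rho> b \<otimes>\<^bsub>BH.T\<^esub> BH.pure m \<one>\<^bsub>H\<^esub>) =
      contractB (\<Phi>\<^sub>\<rho> \<otimes>\<^bsub>BHH.T\<^esub> (coact_id K B H \<rho> (\<rho> b) \<otimes>\<^bsub>BHH.T\<^esub> emb_one (\<rho> m)))"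
    using assms by simp
  also have "\<dots> = contractB (id_comult K B H \<Delta> (\<rho> b) \<otimes>\<^bsub>BHH.T\<^esub> (\<Phi>\<^sub>\<rho> \<otimes>\<^bsub>BHH.T\<^esub> emb_one (\<rho> m)))"
    using assms by (simp add: BHH.T.m_assoc[symmetric] coaction_coassoc)
  also have "\<dots> = b \<otimes>\<^bsub>B\<^esub> E m"
    using assms by (simp add: contractB_id_comult E_def)
  finally show ?thesis .
qed

lemma recompose_coaction_one [simp]: "b \<in> carrier B \<Longrightarrow> recompose (\<rho> b) = b"
  using recompose_coaction[of b "\<one>\<^bsub>B\<^esub>"] by (simp add: BH.one_pure[symmetric])

text \<open>The outer \<open>E\<close> forgets \<open>v h\<close> in \<open>E(b) v(h)\<close>. At
  \<open>s = \<rho>(b)\<close> and \<open>s = \<rho>(b)(m \<otimes> 1)\<close>, where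
  \<open>recompose\<close> is known, this yields \<open>E_idem\<close> and
  \<open>E_mult_E\<close>.\<close>

lemma E_recompose:
  assumes "s \<in> carrier BH.T"
  shows "E (recompose s) = E (E (Defs.counit_right B \<epsilon> s))"
  by (rule BH.linear_ext[of _ B _ s]) (insert assms, auto intro!: lin simp: scal)

lemma E_idem [simp]: "b \<in> carrier B \<Longrightarrow> E (E b) = E b"
  using E_recompose[of "\<rho> b"] by simp

lemma E_mult_E [simp]: "\<lbrakk>b \<in> carrier B; m \<in> carrier B\<rbrakk> \<Longrightarrow> E (b \<otimes>\<^bsub>B\<^esub> E m) = E (b \<otimes>\<^bsub>B\<^esub> m)"
  using E_recompose[of "\<rho> b \<otimes>\<^bsub>BH.T\<^esub> BH.pure m \<one>\<^bsub>H\<^esub>"] recompose_coaction[of b m]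
  by (simp add: B_mult)

end

section \<open>Coinvariance of the image of \<open>E\<close>\<close>

context quasi_hopf_comodule_algebra
begin

abbreviation "E1 \<equiv> tensor_map K B H E (\<lambda>x. x)"

lemma E1_linear: "E1 \<in> linear_maps K BH.T BH.T"
  by (rule BH.map_linear[OF BH.tensor_modules_axioms E_linear linear_map_id])

lemmas E1_pure [simp] = BH.map_pure[OF BH.tensor_modules_axioms E_linear linear_map_id]
lemmas E1_closed [simp] = linear_map_closed[OF E1_linear]
lemmas [lin] = linear_map_comp[OF E1_linear]
lemmas [scal] = linear_map_smult[OF E1_linear]

lemma E1_mult_E1:
  assumes "s \<in> carrier BH.T" "r \<in> carrier BH.T"
  shows "E1 (s \<otimes>\<^bsub>BH.T\<^esub> E1 r) = E1 (s \<otimes>\<^bsub>BH.T\<^esub> r)"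
proof (rule BH.linear_ext[of _ BH.T _ s])
  fix b h assume bh: "b \<in> carrier B" "h \<in> carrier H"
  show "E1 (BH.pure b h \<otimes>\<^bsub>BH.T\<^esub> E1 r) = E1 (BH.pure b h \<otimes>\<^bsub>BH.T\<^esub> r)"
    by (rule BH.linear_ext[of _ BH.T _ r]) (insert bh assms, auto intro!: lin)
qed (insert assms, auto intro!: lin)

lemma E1_mult_right:
  assumes "r \<in> carrier BH.T" "h \<in> carrier H"
  shows "E1 (r \<otimes>\<^bsub>BH.T\<^esub> BH.pure \<one>\<^bsub>B\<^esub> h) = E1 r \<otimes>\<^bsub>BH.T\<^esub> BH.pure \<one>\<^bsub>B\<^esub> h"
  by (rule BH.linear_ext[of _ BH.T _ r]) (insert assms, auto intro!: lin)

text \<open>\<open>E\<close> reduces \<open>v(h1)\<close> to \<open>\<epsilon>(h1)\<close>, and the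
  counit axiom joins this with \<open>h2\<close> to give back \<open>h\<close>.\<close>

lemma E1_mult_v:
  assumes "r \<in> carrier BH.T" "h \<in> carrier H"
  shows "E1 (r \<otimes>\<^bsub>BH.T\<^esub> v1 (\<Delta> h)) = E1 r \<otimes>\<^bsub>BH.T\<^esub> BH.pure \<one>\<^bsub>B\<^esub> h"
proof (rule BH.linear_ext[of _ BH.T _ r])
  fix b k assume bk: "b \<in> carrier B" "k \<in> carrier H"
  have "E1 (BH.pure b k \<otimes>\<^bsub>BH.T\<^esub> v1 y) = BH.pure (E b) (k \<otimes>\<^bsub>H\<^esub> Defs.counit_left H \<epsilon> y)"
    if "y \<in> carrier HH.T" for y
    by (rule HH.linear_ext[of _ BH.T _ y]) (insert bk that, auto intro!: lin simp: scal)
  from this[of "\<Delta> h"] show "E1 (BH.pure b k \<otimes>\<^bsub>BH.T\<^esub> v1 (\<Delta> h)) =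
      E1 (BH.pure b k) \<otimes>\<^bsub>BH.T\<^esub> BH.pure \<one>\<^bsub>B\<^esub> h"
    using assms bk by simp
qed (insert assms, auto intro!: lin)

abbreviation "contract1 \<equiv> tensor_map K B H (\<lambda>x. x) contract"

lemma contract1_linear: "contract1 \<in> linear_maps K BHHH.T BH.T"
  by (rule BHHH.map_linear[OF BH.tensor_modules_axioms linear_map_id contract_linear])

lemmas contract1_pure [simp] = BHHH.map_pure[OF BH.tensor_modules_axioms linear_map_id contract_linear]
lemmas contract1_closed [simp] = linear_map_closed[OF contract1_linear]
lemmas [lin] = linear_map_comp[OF contract1_linear]
lemmas [scal] = linear_map_smult[OF contract1_linear]

text \<open>This avoids the coproduct of \<open>S h\<close>, which would bring in the Drinfeld twist: \<open>E\<close> absorbs the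
  first leg of \<open>\<Delta> (\<beta> S(u) \<alpha> w)\<close>.\<close>

lemma E1_coaction_contractB:
  assumes "t \<in> carrier BHH.T"
  shows "E1 (\<rho> (contractB t)) = E1 (contract1 (coact_id_id K B H \<rho> t))"
proof (rule BHH.linear_ext[of _ BH.T _ t])
  fix b z assume bz: "b \<in> carrier B" "z \<in> carrier HH.T"
  have "contract1 (tensor_assoc K B H HH.T (BH_HH.pure r z)) =
      r \<otimes>\<^bsub>BH.T\<^esub> BH.pure \<one>\<^bsub>B\<^esub> (\<beta> \<otimes>\<^bsub>H\<^esub> ev z)" if "r \<in> carrier BH.T" for r
    by (rule BH.linear_ext[of _ BH.T _ r]) (insert bz that, auto intro!: lin simp: H_simps)
  then show "E1 (\<rho> (contractB (BHH.pure b z))) = E1 (contract1 (coact_id_id K B H \<rho> (BHH.pure b z)))"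
    using bz by (simp add: B_mult coaction_v E1_mult_v E1_mult_right)
qed (insert assms, auto intro!: lin)

text \<open>The first leg of \<open>\<Phi>\<^sub>\<rho>\<close> lies in the image of
  \<open>v\<close> and is forgotten by \<open>E\<close>; what remains of the factor is
  \<open>(\<epsilon> \<otimes> id \<otimes> id) \<Phi> = 1\<close>.\<close>

lemma E1_contract1_tensor_one:
  assumes "t \<in> carrier BHHH.T"
  shows "E1 (contract1 (t \<otimes>\<^bsub>BHHH.T\<^esub> tensor_one K B H \<Phi>\<^sub>\<rho>)) = E1 (contract1 t)"
proof (rule BHHH_ext[of BH.T t])
  fix c u y z assume cuyz: "c \<in> carrier B" "u \<in> carrier H" "y \<in> carrier H" "z \<in> carrier H"
  let ?t = "BHHH.pure c (HHH.pure u (HH.pure y z))"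
  have "E1 (contract1 (?t \<otimes>\<^bsub>BHHH.T\<^esub> tensor_one K B H (v2 x))) =
      BH.pure (E c) (u \<otimes>\<^bsub>H\<^esub> coev (Defs.counit_left HH.T \<epsilon> x) \<otimes>\<^bsub>H\<^esub> S y \<otimes>\<^bsub>H\<^esub> \<alpha> \<otimes>\<^bsub>H\<^esub> z)"
    if "x \<in> carrier HHH.T" for x
    by (rule HHH_ext[of BH.T x]) (insert cuyz that, auto intro!: lin simp: scal H_simps)
  from this[of \<Phi>] show "E1 (contract1 (?t \<otimes>\<^bsub>BHHH.T\<^esub> tensor_one K B H \<Phi>\<^sub>\<rho>)) = E1 (contract1 ?t)"
    using cuyz
    by (simp add: coassociator_v[symmetric] counit_reassociator_left HH.one_pure H_simps)
qed (insert assms, auto intro!: lin)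

text \<open>Legs two and three of the right factor are a coproduct enclosing \<open>\<beta>\<close>,
  so only its counit is left.\<close>

lemma contract1_tensor_one_id_comult:
  assumes "t \<in> carrier BHHH.T" "s \<in> carrier BH.T"
  shows "contract1 (t \<otimes>\<^bsub>BHHH.T\<^esub> tensor_one K B H (id_comult K B H \<Delta> s)) =
    contract1 (t \<otimes>\<^bsub>BHHH.T\<^esub> BHHH.pure (Defs.counit_right B \<epsilon> s) \<one>\<^bsub>HHH.T\<^esub>)"
proof (rule BHHH_ext[of BH.T t])
  fix c u y z assume cuyz: "c \<in> carrier B" "u \<in> carrier H" "y \<in> carrier H" "z \<in> carrier H"
  let ?t = "BHHH.pure c (HHH.pure u (HH.pure y z))"
  have eq: "contract1 (?t \<otimes>\<^bsub>BHHH.T\<^esub> tensor_one K B H (BHH.pure c' x)) =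
      BH.pure (c \<otimes>\<^bsub>B\<^esub> c') (u \<otimes>\<^bsub>H\<^esub> coev x \<otimes>\<^bsub>H\<^esub> S y \<otimes>\<^bsub>H\<^esub> \<alpha> \<otimes>\<^bsub>H\<^esub> z)"
    if "x \<in> carrier HH.T" "c' \<in> carrier B" for x c'
    by (rule HH.linear_ext[of _ BH.T _ x]) (insert cuyz that, auto intro!: lin simp: scal H_simps)
  show "contract1 (?t \<otimes>\<^bsub>BHHH.T\<^esub> tensor_one K B H (id_comult K B H \<Delta> s)) =
    contract1 (?t \<otimes>\<^bsub>BHHH.T\<^esub> BHHH.pure (Defs.counit_right B \<epsilon> s) \<one>\<^bsub>HHH.T\<^esub>)"
    by (rule BH.linear_ext[of _ BH.T _ s])
      (insert cuyz assms, auto intro!: lin simp: scal H_simps eq)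
qed (insert assms, auto intro!: lin)

abbreviation "insert_ones \<equiv> tensor_map K B HHH.T (\<lambda>x. x) (\<lambda>k. HHH.pure \<one>\<^bsub>H\<^esub> (HH.pure \<one>\<^bsub>H\<^esub> k))"

lemma ones_linear: "(\<lambda>k. HHH.pure \<one>\<^bsub>H\<^esub> (HH.pure \<one>\<^bsub>H\<^esub> k)) \<in> linear_maps K H HHH.T"
  by (auto intro!: lin)

lemma ins_linear: "insert_ones \<in> linear_maps K BH.T BHHH.T"
  by (rule BH.map_linear[OF BHHH.tensor_modules_axioms linear_map_id ones_linear])

lemmas ins_pure [simp] = BH.map_pure[OF BHHH.tensor_modules_axioms linear_map_id ones_linear]
lemmas ins_closed [simp] = linear_map_closed[OF ins_linear]
lemmas [lin] = linear_map_comp[OF ins_linear]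
lemmas [scal] = linear_map_smult[OF ins_linear]

text \<open>The coproduct of the middle leg of \<open>r\<close> encloses \<open>\<beta>\<close> and
  leaves the other two legs of \<open>r\<close> in positions one and four, which is where
  \<open>insert_ones\<close> puts them. The factor \<open>m \<otimes> 1\<close> is carried along,
  since it stands to the right of this term in the application; it does not separate the coproduct
  from \<open>\<beta>\<close>.\<close>

lemma contract1_id_comult_id:
  assumes "t \<in> carrier BHHH.T" "r \<in> carrier BHH.T" "m \<in> carrier B"
  shows "contract1 (t \<otimes>\<^bsub>BHHH.T\<^esub> (id_comult_id K B H \<Delta> r \<otimes>\<^bsub>BHHH.T\<^esub> BHHH.pure m \<one>\<^bsub>HHH.T\<^esub>)) =
    contract1 (t \<otimes>\<^bsub>BHHH.T\<^esub> (insert_ones (counit_mid r) \<otimes>\<^bsub>BHHH.T\<^esub> BHHH.pure m \<one>\<^bsub>HHH.T\<^esub>))"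
proof (rule BHHH_ext[of BH.T t])
  fix c u y z assume cuyz: "c \<in> carrier B" "u \<in> carrier H" "y \<in> carrier H" "z \<in> carrier H"
  let ?t = "BHHH.pure c (HHH.pure u (HH.pure y z))"
  have eq: "contract1 (?t \<otimes>\<^bsub>BHHH.T\<^esub> (BHHH.pure c' (tensor_assoc K H H H (HH_H.pure x k))
        \<otimes>\<^bsub>BHHH.T\<^esub> BHHH.pure m \<one>\<^bsub>HHH.T\<^esub>)) =
      BH.pure (c \<otimes>\<^bsub>B\<^esub> c' \<otimes>\<^bsub>B\<^esub> m) (u \<otimes>\<^bsub>H\<^esub> coev x \<otimes>\<^bsub>H\<^esub> S y \<otimes>\<^bsub>H\<^esub> \<alpha> \<otimes>\<^bsub>H\<^esub> z \<otimes>\<^bsub>H\<^esub> k)"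
    if "x \<in> carrier HH.T" "c' \<in> carrier B" "k \<in> carrier H" for x c' k
    by (rule HH.linear_ext[of _ BH.T _ x])
      (insert cuyz that assms, auto intro!: lin simp: scal H_simps)
  show "contract1 (?t \<otimes>\<^bsub>BHHH.T\<^esub> (id_comult_id K B H \<Delta> r \<otimes>\<^bsub>BHHH.T\<^esub> BHHH.pure m \<one>\<^bsub>HHH.T\<^esub>)) =
    contract1 (?t \<otimes>\<^bsub>BHHH.T\<^esub> (insert_ones (counit_mid r) \<otimes>\<^bsub>BHHH.T\<^esub> BHHH.pure m \<one>\<^bsub>HHH.T\<^esub>))"
  proof (rule BHH_ext[of BH.T r])
    fix c' h k assume "c' \<in> carrier B" "h \<in> carrier H" "k \<in> carrier H"
    then show "contract1 (?t \<otimes>\<^bsub>BHHH.T\<^esub> (id_comult_id K B H \<Delta> (BHH.pure c' (HH.pure h k))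
          \<otimes>\<^bsub>BHHH.T\<^esub> BHHH.pure m \<one>\<^bsub>HHH.T\<^esub>)) =
        contract1 (?t \<otimes>\<^bsub>BHHH.T\<^esub> (insert_ones (counit_mid (BHH.pure c' (HH.pure h k)))
          \<otimes>\<^bsub>BHHH.T\<^esub> BHHH.pure m \<one>\<^bsub>HHH.T\<^esub>))"
      using cuyz assms eq[of "\<Delta> h" c' k] by (simp add: scal H_simps)
  qed (insert cuyz assms, auto intro!: lin)
qed (insert assms, auto intro!: lin)

text \<open>The coproduct in the last two legs stands on the left and therefore encloses
  \<open>\<alpha>\<close>; the first two legs of \<open>r\<close> come out in front.\<close>

lemma contract1_id_id_comult:
  assumes "r \<in> carrier BHH.T" "t \<in> carrier BHHH.T"
  shows "contract1 (id_id_comult K B H \<Delta> r \<otimes>\<^bsub>BHHH.T\<^esub> t) = counit_last r \<otimes>\<^bsub>BH.T\<^esub> contract1 t"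
proof (rule BHH_ext[of BH.T r])
  fix c h k assume chk: "c \<in> carrier B" "h \<in> carrier H" "k \<in> carrier H"
  show "contract1 (id_id_comult K B H \<Delta> (BHH.pure c (HH.pure h k)) \<otimes>\<^bsub>BHHH.T\<^esub> t) =
    counit_last (BHH.pure c (HH.pure h k)) \<otimes>\<^bsub>BH.T\<^esub> contract1 t"
    by (rule linear_ext3[OF B.module module HH.module_T, of BH.T t])
      (insert chk assms, auto intro!: lin simp: scal H_simps ev_comult_mult)
qed (insert assms, auto intro!: lin)

text \<open>Up to \<open>E1\<close> and \<open>contract1\<close>, \<open>\<rho>(E(m))\<close> is
  \<open>(\<rho> \<otimes> id \<otimes> id)(\<Phi>\<^sub>\<rho>)\<close> times
  \<open>(\<rho> \<otimes> id)(\<rho>(m)) \<otimes> 1\<close>. The pentagon splits the first factor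
  into pieces that \<open>\<alpha>\<close>, \<open>\<beta>\<close> or \<open>E\<close> can remove;
  the last piece \<open>1 \<otimes> \<Phi>\<close> contracts to 1.\<close>

lemma E1_coaction_E:
  assumes m: "m \<in> carrier B"
  shows "E1 (\<rho> (E m)) = BH.pure (E m) \<one>\<^bsub>H\<^esub>"
proof -
  let ?M = "\<lambda>x y. x \<otimes>\<^bsub>BHHH.T\<^esub> y"
  let ?\<Phi>1 = "BHHH.pure \<one>\<^bsub>B\<^esub> \<Phi>" and ?i = "id_comult_id K B H \<Delta> \<Phi>\<^sub>\<rho>"
    and ?t = "tensor_one K B H" and ?d = "id_id_comult K B H \<Delta>" and ?c = "coact_id_id K B H \<rho>"
    and ?m = "BHHH.pure m \<one>\<^bsub>HHH.T\<^esub>" and ?idc = "id_comult K B H \<Delta> (\<rho> m)"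
  \<comment> \<open>The pentagon solved for
    \<open>(\<rho> \<otimes> id \<otimes> id) \<Phi>\<^sub>\<rho>\<close>.\<close>
  have c: "?c \<Phi>\<^sub>\<rho> = ?M (?d \<Phi>\<^sub>\<rho>') (?M ?\<Phi>1 (?M ?i (?t \<Phi>\<^sub>\<rho>)))"
  proof -
    have "?c \<Phi>\<^sub>\<rho> = ?M (?d (\<Phi>\<^sub>\<rho>' \<otimes>\<^bsub>BHH.T\<^esub> \<Phi>\<^sub>\<rho>)) (?c \<Phi>\<^sub>\<rho>)" by (simp add: B_one)
    also have "\<dots> = ?M (?d \<Phi>\<^sub>\<rho>') (?M (?d \<Phi>\<^sub>\<rho>) (?c \<Phi>\<^sub>\<rho>))"
      by (simp add: B_mult BHHH.T.m_assoc del: coassociator_inverse)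
    finally show ?thesis by (simp add: coaction_pentagon[symmetric] BHHH.T.m_assoc)
  qed
  \<comment> \<open>Quasi-coassociativity tensored with 1 brings
    \<open>\<Phi>\<^sub>\<rho> \<otimes> 1\<close> to the right end, the only place where
    \<open>E\<close> can forget it.\<close>
  have t: "?M (?t \<Phi>\<^sub>\<rho>) (?t (coact_id K B H \<rho> (\<rho> m))) = ?M (?t ?idc) (?t \<Phi>\<^sub>\<rho>)"
  proof -
    have "?M (?t \<Phi>\<^sub>\<rho>) (?t (coact_id K B H \<rho> (\<rho> m))) =
        ?t (\<Phi>\<^sub>\<rho> \<otimes>\<^bsub>BHH.T\<^esub> coact_id K B H \<rho> (\<rho> m))"
      using m by (simp add: B_mult)
    also have "\<dots> = ?t (?idc \<otimes>\<^bsub>BHH.T\<^esub> \<Phi>\<^sub>\<rho>)" using m by (simp add: coaction_coassoc)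
    finally show ?thesis using m by (simp add: B_mult)
  qed
  have "E1 (\<rho> (E m)) = E1 (contract1 (?M (?c \<Phi>\<^sub>\<rho>) (?t (coact_id K B H \<rho> (\<rho> m)))))"
    using m by (simp add: E_def E1_coaction_contractB B_mult coact_id_id_emb)
  also have "?M (?c \<Phi>\<^sub>\<rho>) (?t (coact_id K B H \<rho> (\<rho> m))) =
      ?M (?d \<Phi>\<^sub>\<rho>') (?M (?M ?\<Phi>1 (?M ?i (?t ?idc))) (?t \<Phi>\<^sub>\<rho>))"
    using m t by (simp add: c BHHH.T.m_assoc)
  \<comment> \<open>The leftmost factor collapses at \<open>\<alpha>\<close> to 1 and the rightmost
    one is absorbed by \<open>E\<close>.\<close>
  also have "E1 (contract1 \<dots>) = E1 (contract1 (?M ?\<Phi>1 (?M ?i (?t ?idc))))"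
    using m by (simp add: contract1_id_id_comult counit_inverse_coassociator_right E1_contract1_tensor_one)
  also have "\<dots> = E1 (contract1 (?M (?M ?\<Phi>1 ?i) (?t ?idc)))"
    using m by (simp add: BHHH.T.m_assoc)
  also have "\<dots> = E1 (contract1 (?M ?\<Phi>1 (?M ?i ?m)))"
    using m by (simp add: contract1_tensor_one_id_comult) (simp add: BHHH.T.m_assoc)
  \<comment> \<open>With \<open>(id \<otimes> \<Delta>)(\<rho>(m)) \<otimes> 1\<close> reduced to
    \<open>m \<otimes> 1\<close>, nothing stands between
    \<open>(id \<otimes> \<Delta> \<otimes> id) \<Phi>\<^sub>\<rho>\<close> and
    \<open>\<beta>\<close> any more.\<close>
  also have "\<dots> = E1 (contract1 (?M ?\<Phi>1 (?M (insert_ones (BH.pure \<one>\<^bsub>B\<^esub> \<one>\<^bsub>H\<^esub>)) ?m)))"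
    using m by (simp add: contract1_id_comult_id counit_coassociator_middle BH.one_pure del: ins_pure)
  also have "\<dots> = BH.pure (E m) \<one>\<^bsub>H\<^esub>"
    using m by (simp add: HHH.one_pure[symmetric] HH.one_pure[symmetric])
  finally show ?thesis .
qed

section \<open>The coaction on coinvariant elements\<close>

definition "recompose1 = tensor_lift BH.T (\<lambda>c z. BH.pure (E c) \<one>\<^bsub>H\<^esub> \<otimes>\<^bsub>BH.T\<^esub> v1 z)"

lemma recompose1_bilinear: "bilinear_map K B HH.T BH.T (\<lambda>c z. BH.pure (E c) \<one>\<^bsub>H\<^esub> \<otimes>\<^bsub>BH.T\<^esub> v1 z)"
  by (auto intro!: bilinear_mapI lin)

lemma recompose1_linear: "recompose1 \<in> linear_maps K BHH.T BH.T"
  unfolding recompose1_def by (intro BHH.lift_linear recompose1_bilinear BH.module_T)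

lemma recompose1_pure: "\<lbrakk>c \<in> carrier B; z \<in> carrier HH.T\<rbrakk>
  \<Longrightarrow> recompose1 (BHH.pure c z) = BH.pure (E c) \<one>\<^bsub>H\<^esub> \<otimes>\<^bsub>BH.T\<^esub> v1 z"
  unfolding recompose1_def by (intro BHH.lift_pure recompose1_bilinear BH.module_T)

lemma recompose1_pure3 [simp]:
  "\<lbrakk>c \<in> carrier B; u \<in> carrier H; w \<in> carrier H\<rbrakk>
    \<Longrightarrow> recompose1 (BHH.pure c (HH.pure u w)) = BH.pure (E c \<otimes>\<^bsub>B\<^esub> v u) w"
  by (simp add: recompose1_pure)

lemmas recompose1_closed [simp] = linear_map_closed[OF recompose1_linear]
lemmas [lin] = linear_map_comp[OF recompose1_linear]
lemmas [scal] = linear_map_smult[OF recompose1_linear]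

text \<open>Up to rebracketing \<open>recompose1\<close> is \<open>recompose \<otimes> id\<close>,
  and \<open>recompose\<close> is a left inverse of \<open>\<rho>\<close>.\<close>

lemma recompose1_coact_id:
  assumes "s \<in> carrier BH.T"
  shows "recompose1 (coact_id K B H \<rho> s) = s"
proof (rule BH.linear_ext[of _ BH.T _ s])
  fix c h assume ch: "c \<in> carrier B" "h \<in> carrier H"
  have "recompose1 (tensor_assoc K B H H (BH_H.pure r h)) = BH.pure (recompose r) h" if "r \<in> carrier BH.T" for r
    by (rule BH.linear_ext[of _ BH.T _ r]) (insert ch that, auto intro!: lin)
  then show "recompose1 (coact_id K B H \<rho> (BH.pure c h)) = BH.pure c h" using ch by simp
qed (insert assms, auto intro!: lin)

lemma recompose1_coassociator:
  assumes "t \<in> carrier BHH.T"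
  shows "recompose1 (t \<otimes>\<^bsub>BHH.T\<^esub> \<Phi>\<^sub>\<rho>) = recompose1 t"
proof (rule BHH_ext[of BH.T t])
  fix c u w assume cuw: "c \<in> carrier B" "u \<in> carrier H" "w \<in> carrier H"
  have "recompose1 (BHH.pure c (HH.pure u w) \<otimes>\<^bsub>BHH.T\<^esub> v2 x) =
      BH.pure (E c) \<one>\<^bsub>H\<^esub> \<otimes>\<^bsub>BH.T\<^esub> v1 (HH.pure u w \<otimes>\<^bsub>HH.T\<^esub> Defs.counit_left HH.T \<epsilon> x)"
    if "x \<in> carrier HHH.T" for x
    by (rule HHH_ext[of BH.T x]) (insert cuw that, auto intro!: lin simp: scal)
  from this[of \<Phi>] show "recompose1 (BHH.pure c (HH.pure u w) \<otimes>\<^bsub>BHH.T\<^esub> \<Phi>\<^sub>\<rho>) = recompose1 (BHH.pure c (HH.pure u w))"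
    using cuw by (simp add: coassociator_v[symmetric] counit_reassociator_left)
qed (insert assms, auto intro!: lin)

text \<open>By \<open>E_mult_E\<close>, an inner \<open>E\<close> on the right factor is invisible
  to the outer \<open>E\<close>. So a coaction may be replaced by its image under
  \<open>E1\<close>.\<close>

lemma recompose1_id_comult_E1:
  assumes "t \<in> carrier BHH.T" "r \<in> carrier BH.T"
  shows "recompose1 (t \<otimes>\<^bsub>BHH.T\<^esub> id_comult K B H \<Delta> (E1 r)) = recompose1 (t \<otimes>\<^bsub>BHH.T\<^esub> id_comult K B H \<Delta> r)"
proof (rule BHH.linear_ext[of _ BH.T _ t])
  fix c z assume cz: "c \<in> carrier B" "z \<in> carrier HH.T"
  show "recompose1 (BHH.pure c z \<otimes>\<^bsub>BHH.T\<^esub> id_comult K B H \<Delta> (E1 r)) =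
    recompose1 (BHH.pure c z \<otimes>\<^bsub>BHH.T\<^esub> id_comult K B H \<Delta> r)"
    by (rule BH.linear_ext[of _ BH.T _ r]) (insert cz assms, auto intro!: lin simp: recompose1_pure)
qed (insert assms, auto intro!: lin)

text \<open>Apply the left inverse \<open>recompose1\<close> to \<open>(\<rho> \<otimes>
  id)(\<rho>(a)) = \<Phi>\<^sub>\<rho>' (id \<otimes> \<Delta>)(\<rho>(a))
  \<Phi>\<^sub>\<rho>\<close>: the last factor is absorbed, and \<open>\<rho>(a)\<close> inside may
  be replaced by \<open>E1 (\<rho>(a)) = a \<otimes> 1\<close>. In Sweedler notation the result is
  \<open>E(x1 a) x2 \<otimes> x3\<close>.\<close>

lemma coaction_coinvariant:
  assumes "a \<in> carrier B" "E a = a"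
  shows "\<rho> a = recompose1 (v2 \<Phi>' \<otimes>\<^bsub>BHH.T\<^esub> BHH.pure a \<one>\<^bsub>HH.T\<^esub>)"
proof -
  have "\<rho> a = recompose1 (coact_id K B H \<rho> (\<rho> a))" using assms by (simp add: recompose1_coact_id)
  also have "\<dots> = recompose1 (\<Phi>\<^sub>\<rho>' \<otimes>\<^bsub>BHH.T\<^esub> id_comult K B H \<Delta> (\<rho> a))"
    using assms by (simp add: coaction_conjugate BHH.T.m_assoc[symmetric] recompose1_coassociator)
  also have "\<dots> = recompose1 (\<Phi>\<^sub>\<rho>' \<otimes>\<^bsub>BHH.T\<^esub> id_comult K B H \<Delta> (E1 (\<rho> a)))"
    using assms by (simp add: recompose1_id_comult_E1)
  also have "E1 (\<rho> a) = BH.pure a \<one>\<^bsub>H\<^esub>" using assms E1_coaction_E[of a] by simp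
  finally show ?thesis
    using assms by (simp add: inverse_coassociator_v algebra_hom_one[OF comult_hom])
qed

end

section \<open>The module algebra of coinvariants\<close>

context quasi_hopf_comodule_algebra
begin

abbreviation "E0 \<equiv> E_map K H \<Phi> S \<alpha> \<beta> B \<rho> v"
abbreviation "A \<equiv> E_algebra B E0"
abbreviation "act \<equiv> E_action B E0 v"
abbreviation "inv_S \<equiv> inv_into (carrier H) S"

lemma inv_antipode [simp]:
  "h \<in> carrier H \<Longrightarrow> inv_S h \<in> carrier H" "h \<in> carrier H \<Longrightarrow> S (inv_S h) = h"
  using antipode_bij bij_betw_inv_into_right[OF antipode_bij]
  by (auto simp: bij_betw_def inv_into_into)

text \<open>The antipode undoes \<open>inv_S\<close>:
  \<open>S(inv_S(\<alpha> X3) X2 b1) = S(b1) S(X2) \<alpha> X3\<close>, so the map of the theorem is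
  the contraction \<open>E\<close>.\<close>

lemma E_map_eq [simp]:
  assumes b: "b \<in> carrier B"
  shows "E0 b = E b"
proof -
  let ?f = "\<lambda>q r b\<^sub>0 b\<^sub>1. v q \<otimes>\<^bsub>B\<^esub> b\<^sub>0 \<otimes>\<^bsub>B\<^esub> v (\<beta> \<otimes>\<^bsub>H\<^esub> S (r \<otimes>\<^bsub>H\<^esub> b\<^sub>1))"
  let ?F = "\<lambda>q r. tensor_lift B (?f q r) (\<rho> b)"
  have F: "bilinear_map K H H B ?F"
    by (rule bilinear_mapI; rule BH.lift_param_linear) (use b in \<open>auto intro!: lin\<close>)
  have F_lin: "tensor_lift B ?F \<in> linear_maps K HH.T B"
    by (rule HH.lift_linear[OF B.module F])
  \<comment> \<open>The sum over \<open>q_element\<close> is a lift of a lift over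
    \<open>\<Phi>\<close>; the outer lift is linear and moves inside.\<close>
  have "E0 b = tensor_lift3 B (\<lambda>x y z. tensor_lift B ?F (HH.pure x (inv_S (\<alpha> \<otimes>\<^bsub>H\<^esub> z) \<otimes>\<^bsub>H\<^esub> y))) \<Phi>"
    unfolding E_map_def q_element_def
    by (rule linear_map_lift3[OF module module module HH.module_T B.module _ F_lin]) auto
  also have "\<dots> = contractB (v2 \<Phi> \<otimes>\<^bsub>BHH.T\<^esub> emb_one (\<rho> b))"
  proof (rule linear_map_expand3[OF module module module B.module, symmetric])
    fix x y z assume xyz: "x \<in> carrier H" "y \<in> carrier H" "z \<in> carrier H"
    have "contractB (v2 (HHH.pure x (HH.pure y z)) \<otimes>\<^bsub>BHH.T\<^esub> emb_one (\<rho> b)) =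
        ?F x (inv_S (\<alpha> \<otimes>\<^bsub>H\<^esub> z) \<otimes>\<^bsub>H\<^esub> y)"
      by (rule BH.linear_map_expand[OF B.module])
        (use xyz b in \<open>auto intro!: lin simp: H_simps\<close>)
    then show "contractB (v2 (HHH.pure x (HH.pure y z)) \<otimes>\<^bsub>BHH.T\<^esub> emb_one (\<rho> b)) =
        tensor_lift B ?F (HH.pure x (inv_S (\<alpha> \<otimes>\<^bsub>H\<^esub> z) \<otimes>\<^bsub>H\<^esub> y))"
      using xyz by (simp add: HH.lift_pure[OF B.module F])
  qed (use b in \<open>auto intro!: lin\<close>)
  finally show ?thesis by (simp add: E_def coassociator_v[symmetric])
qed

lemma A_simps [simp]:
  "\<zero>\<^bsub>A\<^esub> = \<zero>\<^bsub>B\<^esub>" "\<one>\<^bsub>A\<^esub> = \<one>\<^bsub>B\<^esub>" "x \<oplus>\<^bsub>A\<^esub> y = x \<oplus>\<^bsub>B\<^esub> y" "c \<odot>\<^bsub>A\<^esub> x = c \<odot>\<^bsub>B\<^esub> x"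
  by (simp_all add: E_algebra_def)

text \<open>For an idempotent map the image is the set of fixed points, so membership becomes an
  equation usable by rewriting.\<close>

lemma A_carrier: "a \<in> carrier A \<longleftrightarrow> a \<in> carrier B \<and> E a = a"
proof -
  have "carrier A = E ` carrier B" by (auto simp: E_algebra_def)
  then show ?thesis by (auto simp: image_iff) metis
qed

lemma A_mult [simp]: "\<lbrakk>a \<in> carrier B; a' \<in> carrier B\<rbrakk> \<Longrightarrow> a \<otimes>\<^bsub>A\<^esub> a' = E (a \<otimes>\<^bsub>B\<^esub> a')"
  by (simp add: E_algebra_def)

lemma act_eq [simp]: "\<lbrakk>h \<in> carrier H; a \<in> carrier B\<rbrakk> \<Longrightarrow> act h a = E (v h \<otimes>\<^bsub>B\<^esub> a)"
  by (simp add: E_action_def)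

lemma A_carrierI: "\<lbrakk>a \<in> carrier B; E a = a\<rbrakk> \<Longrightarrow> a \<in> carrier A"
  by (simp add: A_carrier)

lemma A_carrierD [simp]: "a \<in> carrier A \<Longrightarrow> a \<in> carrier B" "a \<in> carrier A \<Longrightarrow> E a = a"
  by (simp_all add: A_carrier)

lemma A_closed [simp]:
  "b \<in> carrier B \<Longrightarrow> E b \<in> carrier A"
  "\<one>\<^bsub>B\<^esub> \<in> carrier A"
  "\<zero>\<^bsub>B\<^esub> \<in> carrier A"
  "\<lbrakk>a \<in> carrier A; a' \<in> carrier A\<rbrakk> \<Longrightarrow> a \<oplus>\<^bsub>B\<^esub> a' \<in> carrier A"
  "\<lbrakk>c \<in> carrier K; a \<in> carrier A\<rbrakk> \<Longrightarrow> c \<odot>\<^bsub>B\<^esub> a \<in> carrier A"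
  by (rule A_carrierI; simp add: linear_map_zero[OF _ _ E_linear] linear_map_add[OF E_linear] scal)+

lemma module_A: "module K A"
proof (rule moduleI)
  show "cring K" ..
  show "abelian_group A"
  proof (rule abelian_groupI)
    fix x assume x: "x \<in> carrier A"
    have "(\<ominus> \<one>) \<odot>\<^bsub>B\<^esub> x \<oplus>\<^bsub>B\<^esub> x = \<zero>\<^bsub>B\<^esub>" using x by (simp add: B.smult_l_minus B.l_neg)
    then show "\<exists>y\<in>carrier A. y \<oplus>\<^bsub>A\<^esub> x = \<zero>\<^bsub>A\<^esub>"
      using x by (intro bexI[of _ "(\<ominus> \<one>) \<odot>\<^bsub>B\<^esub> x"]) simp_all
  next
    fix x y assume "x \<in> carrier A" "y \<in> carrier A"
    then show "x \<oplus>\<^bsub>A\<^esub> y = y \<oplus>\<^bsub>A\<^esub> x" by (simp add: B.a_comm)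
  qed (simp_all add: B.a_assoc)
qed (simp_all add: B.smult_l_distr B.smult_r_distr B.smult_assoc1)

sublocale A: module K A by (rule module_A)

lemma linear_map_A:
  assumes "f \<in> linear_maps K M B" "\<And>x. x \<in> carrier M \<Longrightarrow> E (f x) = f x"
  shows "f \<in> linear_maps K M A"
  using assms by (auto simp: linear_maps_def intro: A_carrierI)

lemma inclusion_linear: "(\<lambda>x. x) \<in> linear_maps K A B"
  by (auto intro: linear_mapsI)

lemma E_linear_A: "E \<in> linear_maps K B A"
  by (rule linear_map_A) (auto intro: E_linear)

lemma linear_map_A_cong:
  assumes "f \<in> linear_maps K B A" "\<And>x. x \<in> carrier A \<Longrightarrow> f x = g x"
  shows "g \<in> linear_maps K A A"
  using linear_map_comp[OF assms(1) inclusion_linear] assms(2) module_A by (rule linear_map_cong)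

text \<open>For coinvariant \<open>a\<close> one has \<open>h a = E(h1 a) h2\<close>. Hence
  \<open>E(h a a') = E(E(h1 a) h2 a')\<close>, and an inner \<open>E\<close> may be put around
  \<open>h2 a'\<close>.\<close>

lemma act_mult_eq:
  assumes h: "h \<in> carrier H" and a: "a \<in> carrier A" and a': "a' \<in> carrier A"
  shows "act h (a \<otimes>\<^bsub>A\<^esub> a') = tensor_lift A (\<lambda>h\<^sub>1 h\<^sub>2. act h\<^sub>1 a \<otimes>\<^bsub>A\<^esub> act h\<^sub>2 a') (\<Delta> h)"
proof -
  let ?F = "\<lambda>y. E (recompose (v1 y \<otimes>\<^bsub>BH.T\<^esub> BH.pure a \<one>\<^bsub>H\<^esub>) \<otimes>\<^bsub>B\<^esub> a')"
  have "act h (a \<otimes>\<^bsub>A\<^esub> a') = ?F (\<Delta> h)"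
    using assms by (simp add: coaction_v[symmetric] recompose_coaction B.m_assoc)
  also have "\<dots> = tensor_lift A (\<lambda>h\<^sub>1 h\<^sub>2. act h\<^sub>1 a \<otimes>\<^bsub>A\<^esub> act h\<^sub>2 a') (\<Delta> h)"
    by (rule HH.linear_map_expand[OF module_A])
      (use assms in \<open>auto intro!: linear_map_comp[OF E_linear_A] lin simp: B.m_assoc\<close>)
  finally show ?thesis .
qed

text \<open>Oriented so that an expression evaluated at a general tensor folds back into
  \<open>\<rho> a\<close> once that tensor is specialised to \<open>\<Phi>'\<close>.\<close>

lemma recompose1_coinvariant [simp]:
  "a \<in> carrier A \<Longrightarrow> recompose1 (v2 \<Phi>' \<otimes>\<^bsub>BHH.T\<^esub> BHH.pure a \<one>\<^bsub>HH.T\<^esub>) = \<rho> a"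
  using coaction_coinvariant by simp

lemma E_mult_mult_E [simp]:
  "\<lbrakk>b \<in> carrier B; c \<in> carrier B; m \<in> carrier B\<rbrakk>
    \<Longrightarrow> E (b \<otimes>\<^bsub>B\<^esub> (c \<otimes>\<^bsub>B\<^esub> E m)) = E (b \<otimes>\<^bsub>B\<^esub> (c \<otimes>\<^bsub>B\<^esub> m))"
  using E_mult_E[of "b \<otimes>\<^bsub>B\<^esub> c" m] by (simp add: B.m_assoc)

section \<open>Quasi-associativity\<close>

definition "W a a' = tensor_lift B (\<lambda>x z. E (v x \<otimes>\<^bsub>B\<^esub> a) \<otimes>\<^bsub>B\<^esub> recompose (v1 z \<otimes>\<^bsub>BH.T\<^esub> BH.pure a' \<one>\<^bsub>H\<^esub>))"

lemma W_bilinear: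
  assumes "a \<in> carrier B" "a' \<in> carrier B"
  shows "bilinear_map K H HH.T B (\<lambda>x z. E (v x \<otimes>\<^bsub>B\<^esub> a) \<otimes>\<^bsub>B\<^esub> recompose (v1 z \<otimes>\<^bsub>BH.T\<^esub> BH.pure a' \<one>\<^bsub>H\<^esub>))"
  using assms by (auto intro!: bilinear_mapI lin)

lemma W_linear:
  "\<lbrakk>a \<in> carrier B; a' \<in> carrier B\<rbrakk> \<Longrightarrow> W a a' \<in> linear_maps K HHH.T B"
  unfolding W_def by (intro HHH.lift_linear W_bilinear B.module)

lemma W_pure:
  "\<lbrakk>a \<in> carrier B; a' \<in> carrier B; x \<in> carrier H; y \<in> carrier H; z \<in> carrier H\<rbrakk>
    \<Longrightarrow> W a a' (HHH.pure x (HH.pure y z)) =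
      E (v x \<otimes>\<^bsub>B\<^esub> a) \<otimes>\<^bsub>B\<^esub> (E (v y \<otimes>\<^bsub>B\<^esub> a') \<otimes>\<^bsub>B\<^esub> v z)"
  unfolding W_def by (simp add: HHH.lift_pure W_bilinear)

text \<open>Let \<open>?N a a' t\<close> stand for \<open>E(E(t1 a) t2 a') t3\<close>. At
  \<open>t = \<Phi>'\<close> it is \<open>a E(a')\<close>, by the formula for
  \<open>\<rho>(a)\<close>; at \<open>t = 1\<close> it is \<open>E(a a')\<close> for coinvariant
  \<open>a\<close>. Multiplying \<open>\<Phi>'\<close> by \<open>t\<close> on the right turns it
  into \<open>W a a' t\<close>, and \<open>t = \<Phi>\<close> cancels
  \<open>\<Phi>'\<close>.\<close>

lemma W_reassociator:
  assumes a: "a \<in> carrier A" and a': "a' \<in> carrier A"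
  shows "W a a' \<Phi> = E (a \<otimes>\<^bsub>B\<^esub> a')"
proof -
  let ?N = "\<lambda>a a' t. recompose (recompose1 (v2 t \<otimes>\<^bsub>BHH.T\<^esub> BHH.pure a \<one>\<^bsub>HH.T\<^esub>) \<otimes>\<^bsub>BH.T\<^esub> BH.pure a' \<one>\<^bsub>H\<^esub>)"
  have one: "BHH.pure a \<one>\<^bsub>HH.T\<^esub> = BHH.pure a (HH.pure \<one>\<^bsub>H\<^esub> \<one>\<^bsub>H\<^esub>)" for a
    by (simp add: HH.one_pure)
  have "W a a' t = ?N a a' (\<Phi>' \<otimes>\<^bsub>HHH.T\<^esub> t)" if t: "t \<in> carrier HHH.T" for t
  proof (rule HHH_ext[of B t])
    fix x y z assume xyz: "x \<in> carrier H" "y \<in> carrier H" "z \<in> carrier H"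
    \<comment> \<open>\<open>x\<close> and \<open>y\<close> can be grouped with \<open>a\<close> and
      \<open>a'\<close> because an inner \<open>E\<close> on a right factor is free;
      \<open>z\<close> passes out on the right.\<close>
    have "?N a a' (s \<otimes>\<^bsub>HHH.T\<^esub> HHH.pure x (HH.pure y z)) =
        ?N (E (v x \<otimes>\<^bsub>B\<^esub> a)) (E (v y \<otimes>\<^bsub>B\<^esub> a')) s \<otimes>\<^bsub>B\<^esub> v z" if "s \<in> carrier HHH.T" for s
      by (rule HHH_ext[of B s])
        (insert a a' that xyz, auto intro!: lin simp: one H_simps)
    from this[of \<Phi>'] show "W a a' (HHH.pure x (HH.pure y z)) =
        ?N a a' (\<Phi>' \<otimes>\<^bsub>HHH.T\<^esub> HHH.pure x (HH.pure y z))"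
      using a a' xyz by (simp add: W_pure recompose_coaction B.m_assoc)
  qed (insert a a' t, auto intro!: lin W_linear)
  from this[of \<Phi>] show ?thesis
    using a a' reassociator_unit by (simp add: one)
qed

text \<open>In \<open>E(E(a a') a'')\<close> the inner term is expanded as
  \<open>E(X1 a) E(X2 a') X3\<close>. Then \<open>X3\<close> acts on \<open>a''\<close>, and the
  missing inner projections are free under the outer \<open>E\<close>.\<close>

lemma quasi_assoc_A:
  assumes "a \<in> carrier A" "a' \<in> carrier A" "a'' \<in> carrier A"
  shows "(a \<otimes>\<^bsub>A\<^esub> a') \<otimes>\<^bsub>A\<^esub> a'' =
    tensor_lift3 A (\<lambda>x y z. act x a \<otimes>\<^bsub>A\<^esub> (act y a' \<otimes>\<^bsub>A\<^esub> act z a'')) \<Phi>"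
proof -
  have "E (W a a' \<Phi> \<otimes>\<^bsub>B\<^esub> a'') =
      tensor_lift3 A (\<lambda>x y z. act x a \<otimes>\<^bsub>A\<^esub> (act y a' \<otimes>\<^bsub>A\<^esub> act z a'')) \<Phi>"
    by (rule linear_map_expand3[OF module module module module_A])
      (use assms in \<open>auto intro!: linear_map_comp[OF E_linear_A] lin W_linear simp: W_pure B.m_assoc\<close>)
  then show ?thesis using assms by (simp add: W_reassociator)
qed

lemma module_algebra_A: "left_module_algebra K H \<Delta> \<epsilon> \<Phi> A act"
proof unfold_locales
  show "bilinear_map K H A A act"
  proof (rule bilinear_mapI)
    fix h assume h: "h \<in> carrier H"
    show "(\<lambda>a. act h a) \<in> linear_maps K A A"
      by (rule linear_map_A_cong[of "\<lambda>a. E (v h \<otimes>\<^bsub>B\<^esub> a)"])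
        (use h in \<open>auto intro!: linear_map_comp[OF E_linear_A] lin\<close>)
  next
    fix a assume a: "a \<in> carrier A"
    show "(\<lambda>h. act h a) \<in> linear_maps K H A"
      by (rule linear_map_cong[of "\<lambda>h. E (v h \<otimes>\<^bsub>B\<^esub> a)"])
        (use a in \<open>auto intro!: linear_map_comp[OF E_linear_A] lin\<close>)
  qed
  show "bilinear_map K A A A (mult A)"
  proof (rule bilinear_mapI)
    fix a assume a: "a \<in> carrier A"
    show "(\<lambda>a'. a \<otimes>\<^bsub>A\<^esub> a') \<in> linear_maps K A A"
      by (rule linear_map_A_cong[of "\<lambda>a'. E (a \<otimes>\<^bsub>B\<^esub> a')"])
        (use a in \<open>auto intro!: linear_map_comp[OF E_linear_A] lin\<close>)
    show "(\<lambda>a'. a' \<otimes>\<^bsub>A\<^esub> a) \<in> linear_maps K A A"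
      by (rule linear_map_A_cong[of "\<lambda>a'. E (a' \<otimes>\<^bsub>B\<^esub> a)"])
        (use a in \<open>auto intro!: linear_map_comp[OF E_linear_A] lin\<close>)
  qed
  show "(a \<otimes>\<^bsub>A\<^esub> a') \<otimes>\<^bsub>A\<^esub> a'' =
      tensor_lift3 A (\<lambda>X\<^sub>1 X\<^sub>2 X\<^sub>3. act X\<^sub>1 a \<otimes>\<^bsub>A\<^esub> (act X\<^sub>2 a' \<otimes>\<^bsub>A\<^esub> act X\<^sub>3 a'')) \<Phi>"
    if "a \<in> carrier A" "a' \<in> carrier A" "a'' \<in> carrier A" for a a' a''
    using that by (rule quasi_assoc_A)
  show "act h (a \<otimes>\<^bsub>A\<^esub> a') = tensor_lift A (\<lambda>h\<^sub>1 h\<^sub>2. act h\<^sub>1 a \<otimes>\<^bsub>A\<^esub> act h\<^sub>2 a') (\<Delta> h)"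
    if "h \<in> carrier H" "a \<in> carrier A" "a' \<in> carrier A" for h a a'
    using that by (rule act_mult_eq)
  \<comment> \<open>\<open>E\<close> forgets the right factor in \<open>1 v(h)\<close>, leaving
    \<open>\<epsilon>(h) E(1)\<close>.\<close>
  show "act h \<one>\<^bsub>A\<^esub> = \<epsilon> h \<odot>\<^bsub>A\<^esub> \<one>\<^bsub>A\<^esub>" if "h \<in> carrier H" for h
    using that E_mult_v[of "\<one>\<^bsub>B\<^esub>" h] by simp
qed (auto simp: H_simps)

section \<open>The isomorphism with the smash product\<close>

sublocale AH: tensor_modules K A H by (intro tensor_modulesI module_A module)

text \<open>Differs from \<open>E1\<close> only in its target. Tensors over \<open>A\<close> are
  classes of lists with entries in \<open>carrier A\<close> and in general not elements of
  \<open>B \<otimes> H\<close>, so computations with \<open>E1\<close> are transferred by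
  \<open>EA_E1\<close>.\<close>

abbreviation "EA \<equiv> tensor_map K A H E (\<lambda>x. x)"

lemma EA_linear: "EA \<in> linear_maps K BH.T AH.T"
  by (rule BH.map_linear[OF AH.tensor_modules_axioms E_linear_A linear_map_id])

lemmas EA_pure [simp] = BH.map_pure[OF AH.tensor_modules_axioms E_linear_A linear_map_id]
lemmas EA_closed [simp] = linear_map_closed[OF EA_linear]
lemmas [lin] = linear_map_comp[OF EA_linear]
lemmas [simp] = module_A AH.module_T

lemma EA_E1:
  assumes "s \<in> carrier BH.T"
  shows "EA (E1 s) = EA s"
  by (rule BH.linear_ext[of _ AH.T _ s]) (insert assms, auto intro!: lin)

definition "to_smash b = EA (\<rho> b)"
definition "from_smash = tensor_lift B (\<lambda>a h. a \<otimes>\<^bsub>B\<^esub> v h)"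

lemma from_smash_bilinear: "bilinear_map K A H B (\<lambda>a h. a \<otimes>\<^bsub>B\<^esub> v h)"
  by (auto intro!: bilinear_mapI lin inclusion_linear)

lemma from_smash_linear: "from_smash \<in> linear_maps K AH.T B"
  unfolding from_smash_def by (intro AH.lift_linear from_smash_bilinear B.module)

lemma from_smash_pure [simp]:
  "\<lbrakk>a \<in> carrier A; h \<in> carrier H\<rbrakk> \<Longrightarrow> from_smash (AH.pure a h) = a \<otimes>\<^bsub>B\<^esub> v h"
  unfolding from_smash_def by (intro AH.lift_pure from_smash_bilinear B.module)

lemma to_smash_linear: "to_smash \<in> linear_maps K B AH.T"
  unfolding to_smash_def by (auto intro!: lin)

lemmas smash_closed [simp] = linear_map_closed[OF from_smash_linear]
  linear_map_closed[OF to_smash_linear]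
lemmas [lin] = linear_map_comp[OF from_smash_linear] linear_map_comp[OF to_smash_linear]

lemma from_to_smash:
  assumes "b \<in> carrier B"
  shows "from_smash (to_smash b) = b"
proof -
  have "from_smash (EA s) = recompose s" if "s \<in> carrier BH.T" for s
    by (rule BH.linear_ext[of _ B _ s]) (insert that, auto intro!: lin)
  then show ?thesis using assms by (simp add: to_smash_def)
qed

text \<open>\<open>\<rho>(a v(h)) = \<rho>(a) (v(h1) \<otimes> h2)\<close>; \<open>E\<close> absorbs
  \<open>v(h1)\<close> and leaves \<open>h\<close> in the second leg, while coinvariance reduces
  \<open>\<rho>(a)\<close> to \<open>a \<otimes> 1\<close>.\<close>

lemma to_smash_mult_v:
  assumes "a \<in> carrier A" "h \<in> carrier H"
  shows "to_smash (a \<otimes>\<^bsub>B\<^esub> v h) = AH.pure a h"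
proof -
  have "to_smash (a \<otimes>\<^bsub>B\<^esub> v h) = EA (E1 (\<rho> a \<otimes>\<^bsub>BH.T\<^esub> v1 (\<Delta> h)))"
    using assms by (simp add: to_smash_def B_mult coaction_v EA_E1)
  also have "\<dots> = AH.pure a h"
    using assms E1_coaction_E[of a] by (simp add: E1_mult_v)
  finally show ?thesis .
qed

lemma to_from_smash:
  assumes "t \<in> carrier AH.T"
  shows "to_smash (from_smash t) = t"
  by (rule AH.linear_ext[of _ AH.T _ t]) (insert assms, auto intro!: lin simp: to_smash_mult_v)

text \<open>In \<open>\<rho>(a) \<Delta>(h) \<rho>(a') \<Delta>(h')\<close> the projection turns the
  last factor into \<open>1 \<otimes> h'\<close>, and then \<open>\<rho>(a')\<close> into
  \<open>a' \<otimes> 1\<close>. The factor \<open>\<rho>(a)\<close> is shielded from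
  \<open>E\<close> by what follows, so it is expanded as \<open>E(x1 a) x2 \<otimes> x3\<close>;
  this is the origin of \<open>\<Phi>'\<close> in the smash product.\<close>

lemma to_smash_mult:
  assumes a: "a \<in> carrier A" and a': "a' \<in> carrier A" and h: "h \<in> carrier H" and h': "h' \<in> carrier H"
  shows "to_smash (a \<otimes>\<^bsub>B\<^esub> v h \<otimes>\<^bsub>B\<^esub> (a' \<otimes>\<^bsub>B\<^esub> v h')) =
    tensor_lift3 AH.T (\<lambda>x\<^sub>1 x\<^sub>2 x\<^sub>3. tensor_lift AH.T (\<lambda>h\<^sub>1 h\<^sub>2.
      AH.pure (act x\<^sub>1 a \<otimes>\<^bsub>A\<^esub> act (x\<^sub>2 \<otimes>\<^bsub>H\<^esub> h\<^sub>1) a') (x\<^sub>3 \<otimes>\<^bsub>H\<^esub> h\<^sub>2 \<otimes>\<^bsub>H\<^esub> h')) (\<Delta> h)) \<Phi>'"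
proof -
  let ?M = "\<lambda>x y. x \<otimes>\<^bsub>BH.T\<^esub> y"
  \<comment> \<open>Linear in each of \<open>x\<close> and \<open>y\<close>, so the sums over
    \<open>\<Phi>'\<close> and over \<open>\<Delta> h\<close> can be expanded one after the
    other.\<close>
  let ?F = "\<lambda>x y. EA (?M (?M (?M (recompose1 (v2 x \<otimes>\<^bsub>BHH.T\<^esub> BHH.pure a \<one>\<^bsub>HH.T\<^esub>)) (v1 y))
    (BH.pure a' \<one>\<^bsub>H\<^esub>)) (BH.pure \<one>\<^bsub>B\<^esub> h'))"
  let ?s = "?M (\<rho> a) (v1 (\<Delta> h))"
  have "to_smash (a \<otimes>\<^bsub>B\<^esub> v h \<otimes>\<^bsub>B\<^esub> (a' \<otimes>\<^bsub>B\<^esub> v h')) = EA (E1 (?M (?M ?s (\<rho> a')) (v1 (\<Delta> h'))))"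
    using assms by (simp add: to_smash_def B_mult coaction_v EA_E1 BH.T.m_assoc)
  also have "\<dots> = EA (?M (E1 (?M ?s (E1 (\<rho> a')))) (BH.pure \<one>\<^bsub>B\<^esub> h'))"
    using assms by (simp add: E1_mult_v E1_mult_E1)
  also have "E1 (\<rho> a') = BH.pure a' \<one>\<^bsub>H\<^esub>" using a' E1_coaction_E[of a'] by simp
  also have "EA (?M (E1 (?M ?s (BH.pure a' \<one>\<^bsub>H\<^esub>))) (BH.pure \<one>\<^bsub>B\<^esub> h')) = ?F \<Phi>' (\<Delta> h)"
    using assms by (simp add: E1_mult_right[symmetric] EA_E1)
  also have "\<dots> = tensor_lift3 AH.T (\<lambda>x\<^sub>1 x\<^sub>2 x\<^sub>3. tensor_lift AH.T (\<lambda>h\<^sub>1 h\<^sub>2.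
      AH.pure (act x\<^sub>1 a \<otimes>\<^bsub>A\<^esub> act (x\<^sub>2 \<otimes>\<^bsub>H\<^esub> h\<^sub>1) a') (x\<^sub>3 \<otimes>\<^bsub>H\<^esub> h\<^sub>2 \<otimes>\<^bsub>H\<^esub> h')) (\<Delta> h)) \<Phi>'"
  proof (rule linear_map_expand3[OF module module module AH.module_T])
    fix x y z assume xyz: "x \<in> carrier H" "y \<in> carrier H" "z \<in> carrier H"
    show "?F (HHH.pure x (HH.pure y z)) (\<Delta> h) = tensor_lift AH.T (\<lambda>h\<^sub>1 h\<^sub>2.
        AH.pure (act x a \<otimes>\<^bsub>A\<^esub> act (y \<otimes>\<^bsub>H\<^esub> h\<^sub>1) a') (z \<otimes>\<^bsub>H\<^esub> h\<^sub>2 \<otimes>\<^bsub>H\<^esub> h')) (\<Delta> h)"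
      by (rule HH.linear_map_expand[OF AH.module_T])
        (use assms xyz in \<open>auto intro!: lin simp: H_simps HH.one_pure\<close>)
  qed (use assms in \<open>auto intro!: lin\<close>)
  finally show ?thesis .
qed

section \<open>The structure maps of the smash product as images of those of
  \<open>B\<close>\<close>

abbreviation "AsH \<equiv> smash_product K H \<Delta> \<Phi> A act"

lemma AsH_simps [simp]:
  "carrier AsH = carrier AH.T" "\<zero>\<^bsub>AsH\<^esub> = \<zero>\<^bsub>AH.T\<^esub>" "\<one>\<^bsub>AsH\<^esub> = \<one>\<^bsub>AH.T\<^esub>"
  "s \<oplus>\<^bsub>AsH\<^esub> t = s \<oplus>\<^bsub>AH.T\<^esub> t" "c \<odot>\<^bsub>AsH\<^esub> t = c \<odot>\<^bsub>AH.T\<^esub> t"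
  by (simp_all add: smash_product_def Let_def)

text \<open>The right side is linear in each argument, so it expands into the nested sums defining
  the smash product as soon as its value on pure tensors, \<open>to_smash_mult\<close>, is
  known.\<close>

lemma AsH_mult:
  assumes "s \<in> carrier AH.T" "t \<in> carrier AH.T"
  shows "s \<otimes>\<^bsub>AsH\<^esub> t = to_smash (from_smash s \<otimes>\<^bsub>B\<^esub> from_smash t)"
proof -
  have "to_smash (from_smash s \<otimes>\<^bsub>B\<^esub> from_smash t) = tensor_lift AH.T (\<lambda>a h. tensor_lift AH.T (\<lambda>a' h'.
      tensor_lift3 AH.T (\<lambda>x\<^sub>1 x\<^sub>2 x\<^sub>3. tensor_lift AH.T (\<lambda>h\<^sub>1 h\<^sub>2.
        AH.pure (act x\<^sub>1 a \<otimes>\<^bsub>A\<^esub> act (x\<^sub>2 \<otimes>\<^bsub>H\<^esub> h\<^sub>1) a') (x\<^sub>3 \<otimes>\<^bsub>H\<^esub> h\<^sub>2 \<otimes>\<^bsub>H\<^esub> h')) (\<Delta> h)) \<Phi>') t) s"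
  proof (rule AH.linear_map_expand[OF AH.module_T])
    fix a h assume ah: "a \<in> carrier A" "h \<in> carrier H"
    show "to_smash (from_smash (AH.pure a h) \<otimes>\<^bsub>B\<^esub> from_smash t) = tensor_lift AH.T (\<lambda>a' h'.
      tensor_lift3 AH.T (\<lambda>x\<^sub>1 x\<^sub>2 x\<^sub>3. tensor_lift AH.T (\<lambda>h\<^sub>1 h\<^sub>2.
        AH.pure (act x\<^sub>1 a \<otimes>\<^bsub>A\<^esub> act (x\<^sub>2 \<otimes>\<^bsub>H\<^esub> h\<^sub>1) a') (x\<^sub>3 \<otimes>\<^bsub>H\<^esub> h\<^sub>2 \<otimes>\<^bsub>H\<^esub> h')) (\<Delta> h)) \<Phi>') t"
      by (rule AH.linear_map_expand[OF AH.module_T])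
        (use ah assms in \<open>auto intro!: lin simp: to_smash_mult simp del: act_eq A_mult\<close>)
  qed (use assms in \<open>auto intro!: lin\<close>)
  then show ?thesis by (simp add: smash_product_def Let_def)
qed

lemma module_AsH: "module K AsH"
proof -
  have "add AsH = add AH.T" by (simp add: smash_product_def Let_def)
  then show ?thesis using AH.module_T
    by (simp add: module_def abelian_group_def abelian_monoid_def abelian_group_axioms_def
        module_axioms_def)
qed

lemma to_smash_linear_AsH: "to_smash \<in> linear_maps K B AsH"
  using to_smash_linear by (simp add: linear_maps_def)

lemma to_smash_one: "to_smash \<one>\<^bsub>B\<^esub> = \<one>\<^bsub>AsH\<^esub>"
  using to_smash_mult_v[of "\<one>\<^bsub>B\<^esub>" "\<one>\<^bsub>H\<^esub>"]
  by (simp add: tensor_product_def)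

lemma to_smash_bij: "bij_betw to_smash (carrier B) (carrier AsH)"
  by (rule bij_betw_byWitness[of _ from_smash]) (auto simp: from_to_smash to_from_smash)

text \<open>\<open>\<rho>(a v(h)) = E(x1 a) x2 h1 \<otimes> x3 h2\<close>, and
  \<open>to_smash\<close> reads the first leg as \<open>E(x1 a) # x2 h1\<close> because
  \<open>E(x1 a)\<close> is coinvariant.\<close>

lemma smash_coaction_eq:
  assumes "t \<in> carrier AH.T"
  shows "smash_coaction K H \<Delta> \<Phi> A act t = tensor_map K AsH H to_smash (\<lambda>x. x) (\<rho> (from_smash t))"
proof -
  interpret SH: tensor_modules K AsH H by (intro tensor_modulesI module_AsH module)
  note map = BH.map_linear[OF SH.tensor_modules_axioms to_smash_linear_AsH linear_map_id]
  note map_pure = BH.map_pure[OF SH.tensor_modules_axioms to_smash_linear_AsH linear_map_id]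
  note lin = lin linear_map_comp[OF map]
  let ?m = "tensor_map K AsH H to_smash (\<lambda>x. x)"
  have "?m (\<rho> (from_smash t)) = tensor_lift SH.T (\<lambda>a h. tensor_lift3 SH.T (\<lambda>x\<^sub>1 x\<^sub>2 x\<^sub>3.
      tensor_lift SH.T (\<lambda>h\<^sub>1 h\<^sub>2.
        SH.pure (AH.pure (act x\<^sub>1 a) (x\<^sub>2 \<otimes>\<^bsub>H\<^esub> h\<^sub>1)) (x\<^sub>3 \<otimes>\<^bsub>H\<^esub> h\<^sub>2)) (\<Delta> h)) \<Phi>') t"
  proof (rule AH.linear_map_expand[OF SH.module_T])
    fix a h assume ah: "a \<in> carrier A" "h \<in> carrier H"
    let ?F = "\<lambda>x y. ?m (recompose1 (v2 x \<otimes>\<^bsub>BHH.T\<^esub> BHH.pure a \<one>\<^bsub>HH.T\<^esub>) \<otimes>\<^bsub>BH.T\<^esub> v1 y)"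
    have "?m (\<rho> (from_smash (AH.pure a h))) = ?F \<Phi>' (\<Delta> h)"
      using ah by (simp add: B_mult coaction_v)
    also have "\<dots> = tensor_lift3 SH.T (\<lambda>x\<^sub>1 x\<^sub>2 x\<^sub>3. tensor_lift SH.T (\<lambda>h\<^sub>1 h\<^sub>2.
        SH.pure (AH.pure (act x\<^sub>1 a) (x\<^sub>2 \<otimes>\<^bsub>H\<^esub> h\<^sub>1)) (x\<^sub>3 \<otimes>\<^bsub>H\<^esub> h\<^sub>2)) (\<Delta> h)) \<Phi>'"
    proof (rule linear_map_expand3[OF module module module SH.module_T])
      fix x y z assume xyz: "x \<in> carrier H" "y \<in> carrier H" "z \<in> carrier H"
      show "?F (HHH.pure x (HH.pure y z)) (\<Delta> h) = tensor_lift SH.T (\<lambda>h\<^sub>1 h\<^sub>2.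
          SH.pure (AH.pure (act x a) (y \<otimes>\<^bsub>H\<^esub> h\<^sub>1)) (z \<otimes>\<^bsub>H\<^esub> h\<^sub>2)) (\<Delta> h)"
      proof (rule HH.linear_map_expand[OF SH.module_T])
        fix h\<^sub>1 h\<^sub>2 assume "h\<^sub>1 \<in> carrier H" "h\<^sub>2 \<in> carrier H"
        then show "?F (HHH.pure x (HH.pure y z)) (HH.pure h\<^sub>1 h\<^sub>2) =
            SH.pure (AH.pure (act x a) (y \<otimes>\<^bsub>H\<^esub> h\<^sub>1)) (z \<otimes>\<^bsub>H\<^esub> h\<^sub>2)"
          using ah xyz to_smash_mult_v[of "E (v x \<otimes>\<^bsub>B\<^esub> a)" "y \<otimes>\<^bsub>H\<^esub> h\<^sub>1"]
          by (simp add: H_simps HH.one_pure map_pure)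
      qed (use ah xyz in \<open>auto intro!: lin\<close>)
    qed (use ah in \<open>auto intro!: lin\<close>)
    finally show "?m (\<rho> (from_smash (AH.pure a h))) = tensor_lift3 SH.T (\<lambda>x\<^sub>1 x\<^sub>2 x\<^sub>3.
      tensor_lift SH.T (\<lambda>h\<^sub>1 h\<^sub>2.
        SH.pure (AH.pure (act x\<^sub>1 a) (x\<^sub>2 \<otimes>\<^bsub>H\<^esub> h\<^sub>1)) (x\<^sub>3 \<otimes>\<^bsub>H\<^esub> h\<^sub>2)) (\<Delta> h)) \<Phi>'" .
  qed (use assms in \<open>auto intro!: lin\<close>)
  then show ?thesis by (simp add: smash_coaction_def Let_def)
qed

text \<open>The first leg of \<open>\<Phi>\<^sub>\<rho>\<close> is \<open>v(X1)\<close>, that is 1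
  times \<open>v(X1)\<close>, which \<open>to_smash\<close> sends to \<open>1 # X1\<close>.\<close>

lemma smash_coassociator_eq:
  "smash_coassociator K H \<Delta> \<Phi> A act = tensor_map K AsH HH.T to_smash (\<lambda>x. x) \<Phi>\<^sub>\<rho>"
proof -
  interpret SHH: tensor_modules K AsH HH.T by (intro tensor_modulesI module_AsH HH.module_T)
  note map = BHH.map_linear[OF SHH.tensor_modules_axioms to_smash_linear_AsH linear_map_id]
  note map_pure = BHH.map_pure[OF SHH.tensor_modules_axioms to_smash_linear_AsH linear_map_id]
  have "tensor_map K AsH HH.T to_smash (\<lambda>x. x) (v2 \<Phi>) =
    tensor_lift3 SHH.T (\<lambda>x y z. SHH.pure (AH.pure \<one>\<^bsub>A\<^esub> x) (HH.pure y z)) \<Phi>"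
  proof (rule linear_map_expand3[where F = "\<lambda>t. tensor_map K AsH HH.T to_smash (\<lambda>x. x) (v2 t)",
        OF module module module SHH.module_T])
    fix x y z assume "x \<in> carrier H" "y \<in> carrier H" "z \<in> carrier H"
    then show "tensor_map K AsH HH.T to_smash (\<lambda>x. x) (v2 (HHH.pure x (HH.pure y z))) =
        SHH.pure (AH.pure \<one>\<^bsub>A\<^esub> x) (HH.pure y z)"
      using to_smash_mult_v[of "\<one>\<^bsub>B\<^esub>" x] by (simp add: map_pure)
  qed (auto intro!: lin linear_map_comp[OF map])
  then show ?thesis by (simp add: smash_coassociator_def Let_def coassociator_v)
qed

end

section \<open>Transport of structure\<close>

context right_comodule_algebra
begin

text \<open>All maps in the axioms are natural in the algebra, so \<open>f \<otimes> id\<close>,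
  \<open>f \<otimes> id \<otimes> id\<close> and
  \<open>f \<otimes> id \<otimes> id \<otimes> id\<close> carry each axiom of \<open>B\<close> to
  that of \<open>C\<close>. The algebra laws of \<open>C\<close>, given only as a vector space with
  some product, come along with the rest.\<close>

lemma right_comodule_algebra_transport:
  fixes C :: "('k, 'c) module" and \<Phi>\<^sub>C
  assumes C: "module K C" and f: "f \<in> linear_maps K B C"
    and bij: "bij_betw f (carrier B) (carrier C)"
    and f_mult: "\<And>b b'. \<lbrakk>b \<in> carrier B; b' \<in> carrier B\<rbrakk> \<Longrightarrow> f (b \<otimes>\<^bsub>B\<^esub> b') = f b \<otimes>\<^bsub>C\<^esub> f b'"
    and f_one: "f \<one>\<^bsub>B\<^esub> = \<one>\<^bsub>C\<^esub>"
    and f_coaction: "\<And>b. b \<in> carrier B \<Longrightarrow> \<rho>' (f b) = tensor_map K C H f (\<lambda>x. x) (\<rho> b)"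
    and f_coassociator: "\<Phi>\<^sub>C = tensor_map K C HH.T f (\<lambda>x. x) \<Phi>\<^sub>\<rho>"
  shows "right_comodule_algebra K H \<Delta> \<epsilon> \<Phi> C \<rho>' \<Phi>\<^sub>C"
proof -
  interpret C: module K C by fact
  note f_closed [simp] = linear_map_closed[OF f]
  define g where "g = inv_into (carrier B) f"
  have g_closed [simp]: "g c \<in> carrier B" and fg [simp]: "f (g c) = c" if "c \<in> carrier C" for c
    using bij that bij_betw_inv_into_right[OF bij]
    by (auto simp: g_def bij_betw_def inv_into_into)
  have gf [simp]: "g (f b) = b" if "b \<in> carrier B" for b
    using bij_betw_inv_into_left[OF bij that] by (simp add: g_def)
  have C_cases: thesis if "c \<in> carrier C" "\<And>b. \<lbrakk>b \<in> carrier B; c = f b\<rbrakk> \<Longrightarrow> thesis" for c thesis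
    using that(2)[of "g c"] that(1) by simp
  \<comment> \<open>Written through the linear inverse \<open>g\<close>, the product of
    \<open>C\<close> is visibly a composite of bilinear and linear maps.\<close>
  have mult_eq: "c \<otimes>\<^bsub>C\<^esub> c' = f (g c \<otimes>\<^bsub>B\<^esub> g c')" if "c \<in> carrier C" "c' \<in> carrier C" for c c'
    using that by (simp add: f_mult)
  have g: "g \<in> linear_maps K C B"
    by (rule linear_mapsI)
      (auto elim!: C_cases simp: linear_map_add[OF f, symmetric] linear_map_smult[OF f, symmetric])
  have "bilinear_map K C C C (mult C)"
  proof (rule bilinear_mapI)
    fix c assume c: "c \<in> carrier C"
    show "(\<lambda>c'. c \<otimes>\<^bsub>C\<^esub> c') \<in> linear_maps K C C"
      by (rule linear_map_cong[of "\<lambda>c'. f (g c \<otimes>\<^bsub>B\<^esub> g c')"])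
        (use c in \<open>auto intro!: lin linear_map_comp[OF f] linear_map_comp[OF g] simp: mult_eq C\<close>)
    show "(\<lambda>c'. c' \<otimes>\<^bsub>C\<^esub> c) \<in> linear_maps K C C"
      by (rule linear_map_cong[of "\<lambda>c'. f (g c' \<otimes>\<^bsub>B\<^esub> g c)"])
        (use c in \<open>auto intro!: lin linear_map_comp[OF f] linear_map_comp[OF g] simp: mult_eq C\<close>)
  qed
  moreover have "ring C"
  proof (rule ringI)
    show "abelian_group C" by (rule C.abelian_group_axioms)
    show "Group.monoid C"
      by (rule monoidI) (auto elim!: C_cases simp: f_mult[symmetric] f_one[symmetric] B.m_assoc)
  qed (auto elim!: C_cases simp: f_mult[symmetric] linear_map_add[OF f, symmetric] B.l_distr B.r_distr)
  ultimately have k_algebra_C: "k_algebra K C"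
    by (intro k_algebraI K.field_axioms C)
  interpret C: k_algebra K C by (rule k_algebra_C)
  interpret CH: tensor_algebras K C H ..
  interpret CHH: tensor_algebras K C HH.T ..
  interpret CHHH: tensor_algebras K C HHH.T ..
  interpret CH_H: tensor_algebras K CH.T H ..
  interpret CH_HH: tensor_algebras K CH.T HH.T ..
  let ?f1 = "tensor_map K C H f (\<lambda>x. x)" and ?f2 = "tensor_map K C HH.T f (\<lambda>x. x)"
    and ?f3 = "tensor_map K C HHH.T f (\<lambda>x. x)"
  have f_hom: "f \<in> algebra_hom K B C" by (rule algebra_homI[OF f f_mult f_one])
  have g_mult: "g (c \<otimes>\<^bsub>C\<^esub> c') = g c \<otimes>\<^bsub>B\<^esub> g c'" if "c \<in> carrier C" "c' \<in> carrier C" for c c'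
    using that by (simp add: mult_eq)
  have g_one: "g \<one>\<^bsub>C\<^esub> = \<one>\<^bsub>B\<^esub>" using gf[of "\<one>\<^bsub>B\<^esub>"] by (simp add: f_one)
  note f_homs = f_hom BH.map_hom[OF CH.tensor_algebras_axioms f_hom algebra_hom_id]
    BHH.map_hom[OF CHH.tensor_algebras_axioms f_hom algebra_hom_id]
    BHHH.map_hom[OF CHHH.tensor_algebras_axioms f_hom algebra_hom_id]
  note f_linear = f_homs[THEN algebra_hom_linear]
  note f_pure [simp] = BH.map_pure[OF CH.tensor_modules_axioms f linear_map_id]
    BHH.map_pure[OF CHH.tensor_modules_axioms f linear_map_id]
    BHHH.map_pure[OF CHHH.tensor_modules_axioms f linear_map_id]
  note fs_closed [simp] = f_linear[THEN linear_map_closed]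
  note fs_mult = f_homs[THEN algebra_hom_mult]
  note fs_one = f_homs[THEN algebra_hom_one]
  have g_hom: "g \<in> algebra_hom K C B" by (rule algebra_homI[OF g g_mult g_one])
  have \<rho>'_eq: "\<rho>' c = ?f1 (\<rho> (g c))" if "c \<in> carrier C" for c
    using f_coaction[of "g c"] that by simp
  have \<rho>': "\<rho>' \<in> algebra_hom K C CH.T"
  proof (rule algebra_homI)
    show "\<rho>' \<in> linear_maps K C CH.T"
      by (rule linear_map_cong[of "\<lambda>c. ?f1 (\<rho> (g c))"])
        (auto intro!: lin f_linear[THEN linear_map_comp] linear_map_comp[OF g] simp: \<rho>'_eq C)
  qed (auto simp: \<rho>'_eq g_mult B_mult fs_mult g_one B_one fs_one)
  note C_hom = counit_right_hom[OF C.k_algebra]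
    coact_id_hom[OF C.k_algebra k_algebra \<rho>'] id_comult_hom[OF C.k_algebra k_algebra comult_hom]
    coact_id_id_hom[OF C.k_algebra k_algebra \<rho>']
    id_comult_id_hom[OF C.k_algebra k_algebra comult_hom]
    id_id_comult_hom[OF C.k_algebra k_algebra comult_hom] tensor_one_hom[OF C.k_algebra k_algebra]
    assoc_hom[OF C.k_algebra k_algebra k_algebra] assoc_hom[OF C.k_algebra k_algebra HH.k_algebra_T]
    CHH.map_hom[OF CH.tensor_algebras_axioms algebra_hom_id counit_left_hom[OF k_algebra]]
    CHH.map_hom[OF CH.tensor_algebras_axioms algebra_hom_id counit_right_hom[OF k_algebra]]
  note C_pure [simp] = counit_right_pure[OF C.module]
    coact_id_pure[OF C.k_algebra k_algebra \<rho>'] id_comult_pure[OF C.k_algebra k_algebra comult_hom]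
    coact_id_id_pure[OF C.k_algebra k_algebra \<rho>']
    id_comult_id_pure[OF C.k_algebra k_algebra comult_hom]
    id_id_comult_pure[OF C.k_algebra k_algebra comult_hom] tensor_one_pure[OF C.k_algebra k_algebra]
    assoc_pure[OF C.module module module] assoc_pure[OF C.module module HH.module_T]
    CHH.map_pure[OF CH.tensor_modules_axioms linear_map_id algebra_hom_linear[OF counit_left_hom[OF k_algebra]]]
    CHH.map_pure[OF CH.tensor_modules_axioms linear_map_id algebra_hom_linear[OF counit_right_hom[OF k_algebra]]]
  note C_linear = C_hom[THEN algebra_hom_linear]
  note lin' = lin C_linear[THEN linear_map_comp] f_linear[THEN linear_map_comp]
  note [simp] = C.module CH.module_T CHH.module_T CHHH.module_T
  have coact_id: "coact_id K C H \<rho>' (?f1 s) = ?f2 (coact_id K B H \<rho> s)" if "s \<in> carrier BH.T" for s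
  proof (rule BH.linear_ext[of _ CHH.T _ s])
    fix b h assume bh: "b \<in> carrier B" "h \<in> carrier H"
    have "tensor_assoc K C H H (CH_H.pure (?f1 r) h) = ?f2 (tensor_assoc K B H H (BH_H.pure r h))"
      if "r \<in> carrier BH.T" for r
      by (rule BH.linear_ext[of _ CHH.T _ r]) (insert that bh, auto intro!: lin')
    then show "coact_id K C H \<rho>' (?f1 (BH.pure b h)) = ?f2 (coact_id K B H \<rho> (BH.pure b h))"
      using bh by (simp add: f_coaction)
  qed (insert that, auto intro!: lin')
  have id_comult: "id_comult K C H \<Delta> (?f1 s) = ?f2 (id_comult K B H \<Delta> s)" if "s \<in> carrier BH.T" for s
    by (rule BH.linear_ext[of _ CHH.T _ s]) (insert that, auto intro!: lin')
  have coact_id_id: "coact_id_id K C H \<rho>' (?f2 t) = ?f3 (coact_id_id K B H \<rho> t)"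
    if "t \<in> carrier BHH.T" for t
  proof (rule BHH.linear_ext[of _ CHHH.T _ t])
    fix b z assume bz: "b \<in> carrier B" "z \<in> carrier HH.T"
    have "tensor_assoc K C H HH.T (CH_HH.pure (?f1 r) z) =
        ?f3 (tensor_assoc K B H HH.T (BH_HH.pure r z))" if "r \<in> carrier BH.T" for r
      by (rule BH.linear_ext[of _ CHHH.T _ r]) (insert that bz, auto intro!: lin')
    then show "coact_id_id K C H \<rho>' (?f2 (BHH.pure b z)) = ?f3 (coact_id_id K B H \<rho> (BHH.pure b z))"
      using bz by (simp add: f_coaction)
  qed (insert that, auto intro!: lin')
  have id_comult_id: "id_comult_id K C H \<Delta> (?f2 t) = ?f3 (id_comult_id K B H \<Delta> t)"
    and id_id_comult: "id_id_comult K C H \<Delta> (?f2 t) = ?f3 (id_id_comult K B H \<Delta> t)"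
    if "t \<in> carrier BHH.T" for t
    by (rule BHH.linear_ext[of _ CHHH.T _ t]; insert that, auto intro!: lin')+
  have tensor_one: "tensor_one K C H (?f2 t) = ?f3 (tensor_one K B H t)" if "t \<in> carrier BHH.T" for t
    by (rule BHH_ext[of CHHH.T t]) (insert that, auto intro!: lin')
  have counit_mid: "tensor_map K C H (\<lambda>x. x) (Defs.counit_left H \<epsilon>) (?f2 t) = ?f1 (counit_mid t)"
    and counit_last: "tensor_map K C H (\<lambda>x. x) (Defs.counit_right H \<epsilon>) (?f2 t) = ?f1 (counit_last t)"
    if "t \<in> carrier BHH.T" for t
    by (rule BHH.linear_ext[of _ CH.T _ t]; insert that, auto intro!: lin')+
  have counit: "Defs.counit_right C \<epsilon> (?f1 s) = f (Defs.counit_right B \<epsilon> s)" if "s \<in> carrier BH.T" for s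
    by (rule BH.linear_ext[of _ C _ s])
      (insert that, auto intro!: lin' simp: linear_map_smult[OF f])
  have pure_\<Phi>: "CHHH.pure \<one>\<^bsub>C\<^esub> \<Phi> = ?f3 (BHHH.pure \<one>\<^bsub>B\<^esub> \<Phi>)" by (simp add: f_one)
  show ?thesis
  proof (intro right_comodule_algebra.intro right_comodule_algebra_axioms.intro)
    show "quasi_bialgebra K H \<Delta> \<epsilon> \<Phi>" by (rule quasi_bialgebra_axioms)
    show "k_algebra K C" by (rule k_algebra_C)
    show "\<rho>' \<in> algebra_hom K C CH.T" by (rule \<rho>')
    show "\<Phi>\<^sub>C \<in> Units CHH.T"
      unfolding Units_def f_coassociator
      by (auto intro!: bexI[of _ "?f2 \<Phi>\<^sub>\<rho>'"] simp: fs_mult[symmetric] fs_one)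
  next
    fix c assume "c \<in> carrier C"
    then obtain b where b: "b \<in> carrier B" "c = f b" by (rule C_cases)
    show "\<Phi>\<^sub>C \<otimes>\<^bsub>CHH.T\<^esub> coact_id K C H \<rho>' (\<rho>' c) = id_comult K C H \<Delta> (\<rho>' c) \<otimes>\<^bsub>CHH.T\<^esub> \<Phi>\<^sub>C"
      using b by (simp add: f_coaction f_coassociator coact_id id_comult fs_mult[symmetric]
          coaction_coassoc)
    show "Defs.counit_right C \<epsilon> (\<rho>' c) = c"
      using b by (simp add: f_coaction counit)
  next
    show "CHHH.pure \<one>\<^bsub>C\<^esub> \<Phi> \<otimes>\<^bsub>CHHH.T\<^esub> id_comult_id K C H \<Delta> \<Phi>\<^sub>C \<otimes>\<^bsub>CHHH.T\<^esub> tensor_one K C H \<Phi>\<^sub>C =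
      id_id_comult K C H \<Delta> \<Phi>\<^sub>C \<otimes>\<^bsub>CHHH.T\<^esub> coact_id_id K C H \<rho>' \<Phi>\<^sub>C"
      unfolding f_coassociator pure_\<Phi>
      by (simp add: id_comult_id id_id_comult coact_id_id tensor_one fs_mult[symmetric]
          coaction_pentagon del: f_pure)
    show "tensor_map K C H (\<lambda>x. x) (Defs.counit_left H \<epsilon>) \<Phi>\<^sub>C = \<one>\<^bsub>CH.T\<^esub>"
      by (simp add: f_coassociator counit_mid counit_coassociator_middle fs_one)
    show "tensor_map K C H (\<lambda>x. x) (Defs.counit_right H \<epsilon>) \<Phi>\<^sub>C = \<one>\<^bsub>CH.T\<^esub>"
      by (simp add: f_coassociator counit_last counit_coassociator_right fs_one)
  qed
qed

end

section \<open>Transport from \<open>B\<close> to the smash product\<close>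

context quasi_hopf_comodule_algebra
begin

lemma to_smash_mult_AsH:
  "\<lbrakk>b \<in> carrier B; b' \<in> carrier B\<rbrakk> \<Longrightarrow> to_smash (b \<otimes>\<^bsub>B\<^esub> b') = to_smash b \<otimes>\<^bsub>AsH\<^esub> to_smash b'"
  by (simp add: AsH_mult from_to_smash)

lemma smash_coaction_to_smash:
  "b \<in> carrier B \<Longrightarrow> smash_coaction K H \<Delta> \<Phi> A act (to_smash b) =
    tensor_map K AsH H to_smash (\<lambda>x. x) (\<rho> b)"
  by (simp add: smash_coaction_eq from_to_smash)

lemma right_comodule_algebra_AsH:
  "right_comodule_algebra K H \<Delta> \<epsilon> \<Phi> AsH (smash_coaction K H \<Delta> \<Phi> A act)
    (smash_coassociator K H \<Delta> \<Phi> A act)"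
  by (intro right_comodule_algebra_transport[of AsH to_smash] module_AsH to_smash_linear_AsH
      to_smash_bij to_smash_mult_AsH to_smash_one smash_coaction_to_smash smash_coassociator_eq)

lemma comodule_algebra_isomorphic_AsH:
  "comodule_algebra_isomorphic K H B \<rho> \<Phi>\<^sub>\<rho> AsH (smash_coaction K H \<Delta> \<Phi> A act)
    (smash_coassociator K H \<Delta> \<Phi> A act)"
  unfolding comodule_algebra_isomorphic_def comodule_algebra_morphism_def
  by (intro exI[of _ to_smash] conjI ballI algebra_homI to_smash_linear_AsH to_smash_bij
      to_smash_mult_AsH to_smash_one smash_coaction_to_smash smash_coassociator_eq)

end

theorem theorem2p5:
  fixes K :: "'k ring"
    and H :: "('k, 'h) module"
    and \<Delta> :: "'h \<Rightarrow> ('h, 'h) tensor"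
    and \<epsilon> :: "'h \<Rightarrow> 'k"
    and \<Phi> :: "('h, 'h, 'h) tensor3"
    and S :: "'h \<Rightarrow> 'h"
    and \<alpha> \<beta> :: 'h
    and B :: "('k, 'b) module"
    and \<rho> :: "'b \<Rightarrow> ('b, 'h) tensor"
    and \<Phi>\<^sub>\<rho> :: "('b, 'h, 'h) tensor3"
    and v :: "'h \<Rightarrow> 'b"
  assumes "quasi_hopf_algebra K H \<Delta> \<epsilon> \<Phi> S \<alpha> \<beta>"
    and "right_comodule_algebra K H \<Delta> \<epsilon> \<Phi> B \<rho> \<Phi>\<^sub>\<rho>"
    and "comodule_algebra_morphism K H H \<Delta> \<Phi> B \<rho> \<Phi>\<^sub>\<rho> v"
  defines "E \<equiv> E_map K H \<Phi> S \<alpha> \<beta> B \<rho> v"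
  defines "A \<equiv> E_algebra B E"
    and "act \<equiv> E_action B E v"
  shows "left_module_algebra K H \<Delta> \<epsilon> \<Phi> A act \<and>
    right_comodule_algebra K H \<Delta> \<epsilon> \<Phi> (smash_product K H \<Delta> \<Phi> A act)
      (smash_coaction K H \<Delta> \<Phi> A act) (smash_coassociator K H \<Delta> \<Phi> A act) \<and>
    comodule_algebra_isomorphic K H B \<rho> \<Phi>\<^sub>\<rho>
      (smash_product K H \<Delta> \<Phi> A act)
      (smash_coaction K H \<Delta> \<Phi> A act) (smash_coassociator K H \<Delta> \<Phi> A act)"
proof -
  interpret quasi_hopf_comodule_algebra K H \<Delta> \<epsilon> \<Phi> S \<alpha> \<beta> B \<rho> \<Phi>\<^sub>\<rho> v
    by (intro quasi_hopf_comodule_algebra.intro quasi_hopf_comodule_algebra_axioms.intro assms(1-3))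
  show ?thesis
    unfolding assms(4-6)
    by (intro conjI module_algebra_A right_comodule_algebra_AsH comodule_algebra_isomorphic_AsH)
qed

end
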